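(* Let $R$ be any object of $\mathbf a_p$, and let $(F^R_*,d^R_* )$ be a lifting of the complex $(F_*,d_* )$ to $R$. Then: (1) $H^m(F^R_*,d^R_* )=0$ for all $m\ge1$; (2) $H^0(F^R_*,d^R_* )$ is a lifting of the family $\mathbf M$ to $R$.
   Context: Let $k$ be an algebraically closed field, $A$ an associative $k$-algebra, $\mathbf M=\{M_1,\dots,M_p\}$ a finite family of left $A$-modules. The category $\mathbf a_p$: objects are associative unital $k$-algebras $R$ with $k$-algebra homomorphisms $f:k^p\to R$, $g:R\to k^p$, $g\circ f=\mathrm{id}$, such that $R$ is Artinian and $I(R)=\ker g$ is nilpotent; morphisms are $k$-algebra homomorphisms commuting with the $f$'s and $g$'s. Put $R_{ij}=e_iRe_j$ with $e_i$ the standard idempotents of $k^p$. Write $(N_i\otimes_kR_{ij})$ for $\bigoplus_{i,j}N_i\otimes_kR_{ij}$ with right $R$-module structure from multiplication in $R$. A lifting of $\mathbf M$ to $R$ is a left $A\otimes_kR^{op}$-module $M_R$ with left $A$-isomorphisms $\eta_i:M_R\otimes_Rk_i\to M_i$ ($1\le i\le p$), such that $M_R\cong(M_i\otimes_kR_{ij})$ as right $R$-modules; here $k_i$ is the $i$-th factor of $k^p$, a left $R$-module via $g$. Fix a free resolution $(L_{*,i},d_{*,i})$ of $M_i$ as a left $A$-module for each $i$, with $d_{m,i}:L_{m+1,i}\to L_{m,i}$, $m\ge0$. Together they give the complex $(F_*,d_* )$ over $k^p$ with $F_m=(L_{m,i}\otimes_k(k^p)_{ij})$, $d_m=\sum_i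 d_{m,i}\otimes e_i$. A lifting of $(F_*,d_* )$ to $R$ is a complex of left $A\otimes_kR^{op}$-modules $(F^R_*,d^R_* )$ with $F^R_m=(L_{m,i}\otimes_kR_{ij})$ ($A$ acting through the $L_{m,i}$) and $d^R_m:F^R_{m+1}\to F^R_m$, such that the natural maps $F^R_m\to F_m$ induced by $R\to k^p$ commute with the differentials. $H^0=\mathrm{coker}(d^R_0)$ and $H^m=\ker(d^R_{m-1})/\mathrm{im}(d^R_m)$ for $m\ge1$. The isomorphisms $\eta_i$ on $H^0(F^R_*,d^R_* )$ are those induced by reduction to $(F_*,d_* )$ and the augmentations $L_{0,i}\to M_i$. *)

theory Defs
  imports "HOL-Algebra.Algebra"
begin

section \<open>Algebras, modules and bimodules\<close>

text \<open>The algebra locales of the library presuppose commutativity, so associative algebras and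
  modules over noncommutative rings are introduced here.  As for the library's modules, the fields
  \<open>mult\<close> and \<open>one\<close> of a record that is used as a module carry no information.\<close>

locale assoc_algebra = module K A + ring A for K :: "('k, 'u) ring_scheme" (structure)
    and A :: "('k, 'a, 'v) module_scheme" (structure) +
  assumes smult_mult_left:
      "\<lbrakk> c \<in> carrier K; x \<in> carrier A; y \<in> carrier A \<rbrakk> \<Longrightarrow>
        (c \<odot>\<^bsub>A\<^esub> x) \<otimes>\<^bsub>A\<^esub> y = c \<odot>\<^bsub>A\<^esub> (x \<otimes>\<^bsub>A\<^esub> y)"
    and smult_mult_right:
      "\<lbrakk> c \<in> carrier K; x \<in> carrier A; y \<in> carrier A \<rbrakk> \<Longrightarrow>
        x \<otimes>\<^bsub>A\<^esub> (c \<odot>\<^bsub>A\<^esub> y) = c \<odot>\<^bsub>A\<^esub> (x \<otimes>\<^bsub>A\<^esub> y)"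

definition algebra_hom ::
    "('k, 'u) ring_scheme \<Rightarrow> ('k, 'a, 'v) module_scheme \<Rightarrow> ('k, 'b, 'w) module_scheme
      \<Rightarrow> ('a \<Rightarrow> 'b) set"
  where "algebra_hom K A B =
    {h \<in> ring_hom A B. \<forall>c \<in> carrier K. \<forall>x \<in> carrier A. h (c \<odot>\<^bsub>A\<^esub> x) = c \<odot>\<^bsub>B\<^esub> h x}"

locale left_module = ring A + M?: abelian_group M for A :: "('a, 'u) ring_scheme" (structure)
    and M :: "('a, 'b, 'z) module_scheme" (structure) +
  assumes left_closed:
      "\<lbrakk> a \<in> carrier A; x \<in> carrier M \<rbrakk> \<Longrightarrow> a \<odot>\<^bsub>M\<^esub> x \<in> carrier M"
    and left_add_scalar:
      "\<lbrakk> a \<in> carrier A; b \<in> carrier A; x \<in> carrier M \<rbrakk> \<Longrightarrow>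
        (a \<oplus>\<^bsub>A\<^esub> b) \<odot>\<^bsub>M\<^esub> x = a \<odot>\<^bsub>M\<^esub> x \<oplus>\<^bsub>M\<^esub> b \<odot>\<^bsub>M\<^esub> x"
    and left_add:
      "\<lbrakk> a \<in> carrier A; x \<in> carrier M; y \<in> carrier M \<rbrakk> \<Longrightarrow>
        a \<odot>\<^bsub>M\<^esub> (x \<oplus>\<^bsub>M\<^esub> y) = a \<odot>\<^bsub>M\<^esub> x \<oplus>\<^bsub>M\<^esub> a \<odot>\<^bsub>M\<^esub> y"
    and left_assoc:
      "\<lbrakk> a \<in> carrier A; b \<in> carrier A; x \<in> carrier M \<rbrakk> \<Longrightarrow>
        (a \<otimes>\<^bsub>A\<^esub> b) \<odot>\<^bsub>M\<^esub> x = a \<odot>\<^bsub>M\<^esub> (b \<odot>\<^bsub>M\<^esub> x)"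
    and left_one: "x \<in> carrier M \<Longrightarrow> \<one>\<^bsub>A\<^esub> \<odot>\<^bsub>M\<^esub> x = x"

record ('a, 'r, 'b) bimodule = "('a, 'b) module" +
  rsmult :: "'b \<Rightarrow> 'r \<Rightarrow> 'b"

locale right_module = ring R + M?: abelian_group M for R :: "('r, 'u) ring_scheme" (structure)
    and M :: "('a, 'r, 'b, 'z) bimodule_scheme" (structure) +
  assumes right_closed:
      "\<lbrakk> r \<in> carrier R; x \<in> carrier M \<rbrakk> \<Longrightarrow> rsmult M x r \<in> carrier M"
    and right_add_scalar:
      "\<lbrakk> r \<in> carrier R; s \<in> carrier R; x \<in> carrier M \<rbrakk> \<Longrightarrow>
        rsmult M x (r \<oplus>\<^bsub>R\<^esub> s) = rsmult M x r \<oplus>\<^bsub>M\<^esub> rsmult M x s"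
    and right_add:
      "\<lbrakk> r \<in> carrier R; x \<in> carrier M; y \<in> carrier M \<rbrakk> \<Longrightarrow>
        rsmult M (x \<oplus>\<^bsub>M\<^esub> y) r = rsmult M x r \<oplus>\<^bsub>M\<^esub> rsmult M y r"
    and right_assoc:
      "\<lbrakk> r \<in> carrier R; s \<in> carrier R; x \<in> carrier M \<rbrakk> \<Longrightarrow>
        rsmult M x (r \<otimes>\<^bsub>R\<^esub> s) = rsmult M (rsmult M x r) s"
    and right_one: "x \<in> carrier M \<Longrightarrow> rsmult M x \<one>\<^bsub>R\<^esub> = x"

text \<open>A left module over \<open>A \<otimes>\<^sub>K R\<^sup>o\<^sup>p\<close>, given by the actions of \<open>a \<otimes> 1\<close> (from the left) and of
  \<open>1 \<otimes> r\<close> (written from the right): these commute, and the two resulting actions of \<open>K\<close>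
  agree.\<close>

definition is_bimodule ::
    "('k, 'u) ring_scheme \<Rightarrow> ('k, 'a, 'v) module_scheme \<Rightarrow> ('k, 'r, 'w) module_scheme
      \<Rightarrow> ('a, 'r, 'b, 'z) bimodule_scheme \<Rightarrow> bool"
  where "is_bimodule K A R M \<longleftrightarrow> left_module A M \<and> right_module R M \<and>
    (\<forall>a \<in> carrier A. \<forall>r \<in> carrier R. \<forall>x \<in> carrier M.
      a \<odot>\<^bsub>M\<^esub> rsmult M x r = rsmult M (a \<odot>\<^bsub>M\<^esub> x) r) \<and>
    (\<forall>c \<in> carrier K. \<forall>x \<in> carrier M.
      (c \<odot>\<^bsub>A\<^esub> \<one>\<^bsub>A\<^esub>) \<odot>\<^bsub>M\<^esub> x = rsmult M x (c \<odot>\<^bsub>R\<^esub> \<one>\<^bsub>R\<^esub>))"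

definition left_module_hom ::
    "('a, 'v) ring_scheme \<Rightarrow> ('a, 'b, 'y) module_scheme \<Rightarrow> ('a, 'c, 'z) module_scheme
      \<Rightarrow> ('b \<Rightarrow> 'c) set"
  where "left_module_hom A M N = {h \<in> carrier M \<rightarrow> carrier N.
    (\<forall>x \<in> carrier M. \<forall>y \<in> carrier M. h (x \<oplus>\<^bsub>M\<^esub> y) = h x \<oplus>\<^bsub>N\<^esub> h y) \<and>
    (\<forall>a \<in> carrier A. \<forall>x \<in> carrier M. h (a \<odot>\<^bsub>M\<^esub> x) = a \<odot>\<^bsub>N\<^esub> h x)}"

definition right_module_hom ::
    "('r, 'v) ring_scheme \<Rightarrow> ('a, 'r, 'b, 'y) bimodule_scheme
      \<Rightarrow> ('d, 'r, 'c, 'z) bimodule_scheme \<Rightarrow> ('b \<Rightarrow> 'c) set"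
  where "right_module_hom R M N = {h \<in> carrier M \<rightarrow> carrier N.
    (\<forall>x \<in> carrier M. \<forall>y \<in> carrier M. h (x \<oplus>\<^bsub>M\<^esub> y) = h x \<oplus>\<^bsub>N\<^esub> h y) \<and>
    (\<forall>r \<in> carrier R. \<forall>x \<in> carrier M. h (rsmult M x r) = rsmult N (h x) r)}"

definition left_module_iso ::
    "('a, 'v) ring_scheme \<Rightarrow> ('a, 'b, 'y) module_scheme \<Rightarrow> ('a, 'c, 'z) module_scheme
      \<Rightarrow> ('b \<Rightarrow> 'c) set"
  where "left_module_iso A M N =
    {h \<in> left_module_hom A M N. bij_betw h (carrier M) (carrier N)}"

definition right_module_iso ::
    "('r, 'v) ring_scheme \<Rightarrow> ('a, 'r, 'b, 'y) bimodule_scheme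
      \<Rightarrow> ('d, 'r, 'c, 'z) bimodule_scheme \<Rightarrow> ('b \<Rightarrow> 'c) set"
  where "right_module_iso R M N =
    {h \<in> right_module_hom R M N. bij_betw h (carrier M) (carrier N)}"


section \<open>Tensor products\<close>

text \<open>\<open>M \<otimes>\<^sub>R N\<close> for a right \<open>R\<close>-module \<open>M\<close> and a left \<open>R\<close>-module \<open>N\<close>: the quotient of the free
  abelian group on pairs by the usual relations.  Its elements are cosets.\<close>

abbreviation tensor_free ::
    "('a, 'r, 'b, 'y) bimodule_scheme \<Rightarrow> ('r, 'c, 'z) module_scheme
      \<Rightarrow> ('b \<times> 'c \<Rightarrow>\<^sub>0 int) monoid"
  where "tensor_free M N \<equiv> free_Abelian_group (carrier M \<times> carrier N)"

definition tensor_relations ::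
    "('r, 'u) ring_scheme \<Rightarrow> ('a, 'r, 'b, 'y) bimodule_scheme
      \<Rightarrow> ('r, 'c, 'z) module_scheme \<Rightarrow> ('b \<times> 'c \<Rightarrow>\<^sub>0 int) set"
  where "tensor_relations R M N = generate (tensor_free M N)
    ({frag_of (x \<oplus>\<^bsub>M\<^esub> x', y) - frag_of (x, y) - frag_of (x', y) | x x' y.
        x \<in> carrier M \<and> x' \<in> carrier M \<and> y \<in> carrier N} \<union>
     {frag_of (x, y \<oplus>\<^bsub>N\<^esub> y') - frag_of (x, y) - frag_of (x, y') | x y y'.
        x \<in> carrier M \<and> y \<in> carrier N \<and> y' \<in> carrier N} \<union>
     {frag_of (rsmult M x r, y) - frag_of (x, r \<odot>\<^bsub>N\<^esub> y) | x r y.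
        x \<in> carrier M \<and> r \<in> carrier R \<and> y \<in> carrier N})"

definition pure_tensor ::
    "('r, 'u) ring_scheme \<Rightarrow> ('a, 'r, 'b, 'y) bimodule_scheme
      \<Rightarrow> ('r, 'c, 'z) module_scheme \<Rightarrow> 'b \<Rightarrow> 'c \<Rightarrow> ('b \<times> 'c \<Rightarrow>\<^sub>0 int) set"
  where "pure_tensor R M N x y =
    tensor_relations R M N #>\<^bsub>tensor_free M N\<^esub> frag_of (x, y)"

definition tensor_group ::
    "('r, 'u) ring_scheme \<Rightarrow> ('a, 'r, 'b, 'y) bimodule_scheme
      \<Rightarrow> ('r, 'c, 'z) module_scheme \<Rightarrow> ('b \<times> 'c \<Rightarrow>\<^sub>0 int) set ring"
  where "tensor_group R M N =
    (let G = tensor_free M N Mod tensor_relations R M N in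
      \<lparr> carrier = carrier G, monoid.mult = undefined, one = undefined,
        ring.zero = \<one>\<^bsub>G\<^esub>, add = monoid.mult G \<rparr>)"

text \<open>The homomorphism from a tensor product to \<open>P\<close> that is induced by a balanced map \<open>\<phi>\<close>; for a
  balanced map the value does not depend on the representative \<open>z\<close>.\<close>

definition tensor_lift ::
    "('d, 'u) ring_scheme \<Rightarrow> ('b \<times> 'c \<Rightarrow> 'd) \<Rightarrow> ('b \<times> 'c \<Rightarrow>\<^sub>0 int) set \<Rightarrow> 'd"
  where "tensor_lift P \<phi> W = (THE v. \<exists>z \<in> W.
    v = (\<Oplus>\<^bsub>P\<^esub>t \<in> Poly_Mapping.keys z. add_pow P (Poly_Mapping.lookup z t) (\<phi> t)))"

definition tensor ::
    "('r, 'u) ring_scheme \<Rightarrow> ('a, 'r, 'b, 'y) bimodule_scheme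
      \<Rightarrow> ('r, 'c, 'z) module_scheme \<Rightarrow> ('a, ('b \<times> 'c \<Rightarrow>\<^sub>0 int) set) module"
  where "tensor R M N = ring.extend (tensor_group R M N)
    (module.fields (\<lambda>a. tensor_lift (tensor_group R M N)
      (\<lambda>(x, y). pure_tensor R M N (a \<odot>\<^bsub>M\<^esub> x) y)))"

text \<open>The map \<open>h \<otimes> h' : M \<otimes>\<^sub>R N \<rightarrow> M' \<otimes>\<^sub>R N'\<close>; only the target has to be named.\<close>

definition tensor_map ::
    "('r, 'u) ring_scheme \<Rightarrow> ('a, 'r, 'b, 'y) bimodule_scheme
      \<Rightarrow> ('r, 'c, 'z) module_scheme \<Rightarrow> ('d \<Rightarrow> 'b) \<Rightarrow> ('e \<Rightarrow> 'c)
      \<Rightarrow> ('d \<times> 'e \<Rightarrow>\<^sub>0 int) set \<Rightarrow> ('b \<times> 'c \<Rightarrow>\<^sub>0 int) set"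
  where "tensor_map R M' N' h h' =
    tensor_lift (tensor_group R M' N') (\<lambda>(x, y). pure_tensor R M' N' (h x) (h' y))"


section \<open>The category of pointed Artinian algebras\<close>

definition pow_algebra :: "('k, 'u) ring_scheme \<Rightarrow> nat \<Rightarrow> ('k, nat \<Rightarrow> 'k) module"
  where "pow_algebra K p =
    \<lparr> carrier = {1..p} \<rightarrow>\<^sub>E carrier K,
      monoid.mult = (\<lambda>x y. \<lambda>i\<in>{1..p}. x i \<otimes>\<^bsub>K\<^esub> y i), one = (\<lambda>i\<in>{1..p}. \<one>\<^bsub>K\<^esub>),
      ring.zero = (\<lambda>i\<in>{1..p}. \<zero>\<^bsub>K\<^esub>), add = (\<lambda>x y. \<lambda>i\<in>{1..p}. x i \<oplus>\<^bsub>K\<^esub> y i),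
      smult = (\<lambda>c x. \<lambda>i\<in>{1..p}. c \<otimes>\<^bsub>K\<^esub> x i) \<rparr>"

definition std_idem :: "('k, 'u) ring_scheme \<Rightarrow> nat \<Rightarrow> nat \<Rightarrow> (nat \<Rightarrow> 'k)"
  where "std_idem K p i = (\<lambda>j\<in>{1..p}. if j = i then \<one>\<^bsub>K\<^esub> else \<zero>\<^bsub>K\<^esub>)"

definition left_ideal :: "'r set \<Rightarrow> ('r, 'u) ring_scheme \<Rightarrow> bool"
  where "left_ideal J R \<longleftrightarrow>
    additive_subgroup J R \<and> (\<forall>r \<in> carrier R. \<forall>x \<in> J. r \<otimes>\<^bsub>R\<^esub> x \<in> J)"

definition right_ideal :: "'r set \<Rightarrow> ('r, 'u) ring_scheme \<Rightarrow> bool"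
  where "right_ideal J R \<longleftrightarrow>
    additive_subgroup J R \<and> (\<forall>r \<in> carrier R. \<forall>x \<in> J. x \<otimes>\<^bsub>R\<^esub> r \<in> J)"

definition artinian :: "('r, 'u) ring_scheme \<Rightarrow> bool"
  where "artinian R \<longleftrightarrow>
    (\<forall>J. (\<forall>n. left_ideal (J n) R \<and> J (Suc n) \<subseteq> J n) \<longrightarrow> (\<exists>N::nat. \<forall>n\<ge>N. J n = J N)) \<and>
    (\<forall>J. (\<forall>n. right_ideal (J n) R \<and> J (Suc n) \<subseteq> J n) \<longrightarrow> (\<exists>N::nat. \<forall>n\<ge>N. J n = J N))"

primrec ideal_power :: "('r, 'u) ring_scheme \<Rightarrow> 'r set \<Rightarrow> nat \<Rightarrow> 'r set"
  where
    "ideal_power R I 0 = carrier R"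
  | "ideal_power R I (Suc n) = ideal_prod R (ideal_power R I n) I"

definition ap_object ::
    "('k, 'u) ring_scheme \<Rightarrow> nat \<Rightarrow> ('k, 'r, 'v) module_scheme
      \<Rightarrow> ((nat \<Rightarrow> 'k) \<Rightarrow> 'r) \<Rightarrow> ('r \<Rightarrow> (nat \<Rightarrow> 'k)) \<Rightarrow> bool"
  where "ap_object K p R f g \<longleftrightarrow>
    assoc_algebra K R \<and>
    f \<in> algebra_hom K (pow_algebra K p) R \<and>
    g \<in> algebra_hom K R (pow_algebra K p) \<and>
    (\<forall>x \<in> carrier (pow_algebra K p). g (f x) = x) \<and>
    artinian R \<and>
    (\<exists>n. ideal_power R (a_kernel R (pow_algebra K p) g) n = {\<zero>\<^bsub>R\<^esub>})"


section \<open>The modules of matrices\<close>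

text \<open>The following definitions are needed both for \<open>R\<close> with its structure map \<open>f\<close> and for \<open>k\<^sup>p\<close>
  itself, whose structure map is the identity; hence the parameters \<open>S\<close> and \<open>f\<close>.\<close>

definition peirce ::
    "('k, 'u) ring_scheme \<Rightarrow> nat \<Rightarrow> ('k, 's) module \<Rightarrow> ((nat \<Rightarrow> 'k) \<Rightarrow> 's)
      \<Rightarrow> nat \<Rightarrow> nat \<Rightarrow> ('k, 's) module"
  where "peirce K p S f i j =
    S \<lparr> carrier := {f (std_idem K p i) \<otimes>\<^bsub>S\<^esub> s \<otimes>\<^bsub>S\<^esub> f (std_idem K p j) | s. s \<in> carrier S} \<rparr>"

text \<open>A left \<open>A\<close>-module together with its underlying \<open>K\<close>-action written on the right.\<close>

definition base_bimodule ::
    "('k, 'a) module \<Rightarrow> ('a, 'b) module \<Rightarrow> ('a, 'k, 'b) bimodule"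
  where "base_bimodule A N =
    module.extend N (bimodule.fields (\<lambda>x c. (c \<odot>\<^bsub>A\<^esub> \<one>\<^bsub>A\<^esub>) \<odot>\<^bsub>N\<^esub> x))"

definition mat_entry ::
    "('k, 'u) ring_scheme \<Rightarrow> ('k, 'a) module \<Rightarrow> nat \<Rightarrow> ('k, 's) module
      \<Rightarrow> ((nat \<Rightarrow> 'k) \<Rightarrow> 's) \<Rightarrow> (nat \<Rightarrow> ('a, 'b) module) \<Rightarrow> nat \<Rightarrow> nat
      \<Rightarrow> ('a, ('b \<times> 's \<Rightarrow>\<^sub>0 int) set) module"
  where "mat_entry K A p S f N i j = tensor K (base_bimodule A (N i)) (peirce K p S f i j)"

definition mat_entry_map ::
    "('k, 'u) ring_scheme \<Rightarrow> ('k, 'a) module \<Rightarrow> nat \<Rightarrow> ('k, 's) module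
      \<Rightarrow> ((nat \<Rightarrow> 'k) \<Rightarrow> 's) \<Rightarrow> (nat \<Rightarrow> ('a, 'b) module) \<Rightarrow> nat \<Rightarrow> nat
      \<Rightarrow> ('c \<Rightarrow> 'b) \<Rightarrow> ('t \<Rightarrow> 's) \<Rightarrow> ('c \<times> 't \<Rightarrow>\<^sub>0 int) set \<Rightarrow> ('b \<times> 's \<Rightarrow>\<^sub>0 int) set"
  where "mat_entry_map K A p S f N i j =
    tensor_map K (base_bimodule A (N i)) (peirce K p S f i j)"

text \<open>The bimodule \<open>(N\<^sub>i \<otimes>\<^sub>K S\<^sub>i\<^sub>j)\<close>, an element of the direct sum being the family of its components.
  The \<open>(i, l)\<close> component of \<open>x s\<close> is the sum over \<open>j\<close> of \<open>x\<^sub>i\<^sub>j s\<^sub>j\<^sub>l\<close>, where \<open>s\<^sub>j\<^sub>l = e\<^sub>j s e\<^sub>l\<close>.\<close>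

definition mat_module ::
    "('k, 'u) ring_scheme \<Rightarrow> ('k, 'a) module \<Rightarrow> nat \<Rightarrow> ('k, 's) module
      \<Rightarrow> ((nat \<Rightarrow> 'k) \<Rightarrow> 's) \<Rightarrow> (nat \<Rightarrow> ('a, 'b) module)
      \<Rightarrow> ('a, 's, nat \<times> nat \<Rightarrow> ('b \<times> 's \<Rightarrow>\<^sub>0 int) set) bimodule"
  where "mat_module K A p S f N =
    \<lparr> carrier = (\<Pi>\<^sub>E (i, j) \<in> {1..p} \<times> {1..p}. carrier (mat_entry K A p S f N i j)),
      monoid.mult = undefined, one = undefined,
      ring.zero = (\<lambda>(i, j) \<in> {1..p} \<times> {1..p}. \<zero>\<^bsub>mat_entry K A p S f N i j\<^esub>),
      add = (\<lambda>x y. \<lambda>(i, j) \<in> {1..p} \<times> {1..p}. x (i, j) \<oplus>\<^bsub>mat_entry K A p S f N i j\<^esub> y (i, j)),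
      smult = (\<lambda>a x. \<lambda>(i, j) \<in> {1..p} \<times> {1..p}. a \<odot>\<^bsub>mat_entry K A p S f N i j\<^esub> x (i, j)),
      rsmult = (\<lambda>x s. \<lambda>(i, l) \<in> {1..p} \<times> {1..p}.
        \<Oplus>\<^bsub>mat_entry K A p S f N i l\<^esub>j \<in> {1..p}.
          mat_entry_map K A p S f N i l id
            (\<lambda>t. t \<otimes>\<^bsub>S\<^esub> (f (std_idem K p j) \<otimes>\<^bsub>S\<^esub> s \<otimes>\<^bsub>S\<^esub> f (std_idem K p l))) (x (i, j))) \<rparr>"

text \<open>The natural map \<open>(N\<^sub>i \<otimes>\<^sub>K R\<^sub>i\<^sub>j) \<rightarrow> (N\<^sub>i \<otimes>\<^sub>K (k\<^sup>p)\<^sub>i\<^sub>j)\<close> induced by \<open>g : R \<rightarrow> k\<^sup>p\<close>.\<close>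

definition mat_reduction ::
    "('k, 'u) ring_scheme \<Rightarrow> ('k, 'a) module \<Rightarrow> nat \<Rightarrow> ('r \<Rightarrow> (nat \<Rightarrow> 'k))
      \<Rightarrow> (nat \<Rightarrow> ('a, 'b) module) \<Rightarrow> (nat \<times> nat \<Rightarrow> ('b \<times> 'r \<Rightarrow>\<^sub>0 int) set)
      \<Rightarrow> (nat \<times> nat \<Rightarrow> ('b \<times> (nat \<Rightarrow> 'k) \<Rightarrow>\<^sub>0 int) set)"
  where "mat_reduction K A p g N x = (\<lambda>(i, j) \<in> {1..p} \<times> {1..p}.
    mat_entry_map K A p (pow_algebra K p) id N i j id g (x (i, j)))"


section \<open>Liftings of families of modules\<close>

text \<open>The \<open>i\<close>-th factor of \<open>k\<^sup>p\<close> as a left \<open>R\<close>-module via \<open>g\<close>.\<close>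

definition simple_module ::
    "('k, 'u) ring_scheme \<Rightarrow> ('r \<Rightarrow> (nat \<Rightarrow> 'k)) \<Rightarrow> nat \<Rightarrow> ('r, 'k) module"
  where "simple_module K g i =
    \<lparr> carrier = carrier K, monoid.mult = monoid.mult K, one = \<one>\<^bsub>K\<^esub>, ring.zero = \<zero>\<^bsub>K\<^esub>, add = add K,
      smult = (\<lambda>r c. g r i \<otimes>\<^bsub>K\<^esub> c) \<rparr>"

definition family_lifting ::
    "('k, 'u) ring_scheme \<Rightarrow> ('k, 'a) module \<Rightarrow> nat \<Rightarrow> ('k, 'r) module
      \<Rightarrow> ((nat \<Rightarrow> 'k) \<Rightarrow> 'r) \<Rightarrow> ('r \<Rightarrow> (nat \<Rightarrow> 'k)) \<Rightarrow> (nat \<Rightarrow> ('a, 'b) module)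
      \<Rightarrow> ('a, 'r, 'c) bimodule \<Rightarrow> (nat \<Rightarrow> ('c \<times> 'k \<Rightarrow>\<^sub>0 int) set \<Rightarrow> 'b) \<Rightarrow> bool"
  where "family_lifting K A p R f g M M\<^sub>R \<eta> \<longleftrightarrow>
    is_bimodule K A R M\<^sub>R \<and>
    (\<forall>i \<in> {1..p}. \<eta> i \<in> left_module_iso A (tensor R M\<^sub>R (simple_module K g i)) (M i)) \<and>
    (\<exists>\<theta>. \<theta> \<in> right_module_iso R M\<^sub>R (mat_module K A p R f M))"


section \<open>Resolutions and liftings of complexes\<close>

definition free_module :: "('a, 'u) ring_scheme \<Rightarrow> ('a, 'b, 'v) module_scheme \<Rightarrow> bool"
  where "free_module A L \<longleftrightarrow> left_module A L \<and>
    (\<exists>B \<subseteq> carrier L. \<forall>x \<in> carrier L.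
      \<exists>!c. c \<in> B \<rightarrow>\<^sub>E carrier A \<and> finite {b \<in> B. c b \<noteq> \<zero>\<^bsub>A\<^esub>} \<and>
        x = (\<Oplus>\<^bsub>L\<^esub>b \<in> {b \<in> B. c b \<noteq> \<zero>\<^bsub>A\<^esub>}. c b \<odot>\<^bsub>L\<^esub> b))"

definition free_resolution ::
    "('a, 'u) ring_scheme \<Rightarrow> (nat \<Rightarrow> ('a, 'l) module) \<Rightarrow> (nat \<Rightarrow> 'l \<Rightarrow> 'l) \<Rightarrow> ('l \<Rightarrow> 'b)
      \<Rightarrow> ('a, 'b) module \<Rightarrow> bool"
  where "free_resolution A L d \<epsilon> M \<longleftrightarrow>
    (\<forall>m. free_module A (L m)) \<and>
    (\<forall>m. d m \<in> left_module_hom A (L (Suc m)) (L m)) \<and>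
    \<epsilon> \<in> left_module_hom A (L 0) M \<and>
    \<epsilon> ` carrier (L 0) = carrier M \<and>
    a_kernel (L 0) M \<epsilon> = d 0 ` carrier (L 1) \<and>
    (\<forall>m. a_kernel (L (Suc m)) (L m) (d m) = d (Suc m) ` carrier (L (Suc (Suc m))))"

definition base_differential ::
    "('k, 'u) ring_scheme \<Rightarrow> ('k, 'a) module \<Rightarrow> nat \<Rightarrow> (nat \<Rightarrow> nat \<Rightarrow> ('a, 'l) module)
      \<Rightarrow> (nat \<Rightarrow> nat \<Rightarrow> 'l \<Rightarrow> 'l) \<Rightarrow> nat
      \<Rightarrow> (nat \<times> nat \<Rightarrow> ('l \<times> (nat \<Rightarrow> 'k) \<Rightarrow>\<^sub>0 int) set)
      \<Rightarrow> (nat \<times> nat \<Rightarrow> ('l \<times> (nat \<Rightarrow> 'k) \<Rightarrow>\<^sub>0 int) set)"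
  where "base_differential K A p L d m x = (\<lambda>(i, j) \<in> {1..p} \<times> {1..p}.
    mat_entry_map K A p (pow_algebra K p) id (L m) i j
      (d m i) (\<lambda>y. std_idem K p i \<otimes>\<^bsub>pow_algebra K p\<^esub> y) (x (i, j)))"

text \<open>The objects of a lifting of the complex are prescribed, so a lifting is given by its
  differentials \<open>D\<close>.\<close>

definition complex_lifting ::
    "('k, 'u) ring_scheme \<Rightarrow> ('k, 'a) module \<Rightarrow> nat \<Rightarrow> ('k, 'r) module
      \<Rightarrow> ((nat \<Rightarrow> 'k) \<Rightarrow> 'r) \<Rightarrow> ('r \<Rightarrow> (nat \<Rightarrow> 'k))
      \<Rightarrow> (nat \<Rightarrow> nat \<Rightarrow> ('a, 'l) module) \<Rightarrow> (nat \<Rightarrow> nat \<Rightarrow> 'l \<Rightarrow> 'l)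
      \<Rightarrow> (nat \<Rightarrow> (nat \<times> nat \<Rightarrow> ('l \<times> 'r \<Rightarrow>\<^sub>0 int) set) \<Rightarrow> (nat \<times> nat \<Rightarrow> ('l \<times> 'r \<Rightarrow>\<^sub>0 int) set))
      \<Rightarrow> bool"
  where "complex_lifting K A p R f g L d D \<longleftrightarrow>
    (\<forall>m. D m \<in> left_module_hom A (mat_module K A p R f (L (Suc m))) (mat_module K A p R f (L m))
             \<inter> right_module_hom R (mat_module K A p R f (L (Suc m))) (mat_module K A p R f (L m))) \<and>
    (\<forall>m. \<forall>x \<in> carrier (mat_module K A p R f (L (Suc (Suc m)))).
      D m (D (Suc m) x) = \<zero>\<^bsub>mat_module K A p R f (L m)\<^esub>) \<and>
    (\<forall>m. \<forall>x \<in> carrier (mat_module K A p R f (L (Suc m))).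
      mat_reduction K A p g (L m) (D m x) =
      base_differential K A p L d m (mat_reduction K A p g (L (Suc m)) x))"


section \<open>Cohomology\<close>

definition quot_bimodule :: "('a, 'r, 'b) bimodule \<Rightarrow> 'b set \<Rightarrow> ('a, 'r, 'b set) bimodule"
  where "quot_bimodule M U =
    \<lparr> carrier = a_rcosets\<^bsub>M\<^esub> U, monoid.mult = undefined, one = undefined, ring.zero = U, add = set_add M,
      smult = (\<lambda>a W. \<Union>x\<in>W. U +>\<^bsub>M\<^esub> (a \<odot>\<^bsub>M\<^esub> x)),
      rsmult = (\<lambda>W r. \<Union>x\<in>W. U +>\<^bsub>M\<^esub> rsmult M x r) \<rparr>"

fun cohomology ::
    "(nat \<Rightarrow> ('a, 'r, 'b) bimodule) \<Rightarrow> (nat \<Rightarrow> 'b \<Rightarrow> 'b) \<Rightarrow> nat \<Rightarrow> ('a, 'r, 'b set) bimodule"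
  where
    "cohomology F D 0 = quot_bimodule (F 0) (D 0 ` carrier (F 1))"
  | "cohomology F D (Suc m) =
      quot_bimodule (F (Suc m) \<lparr> carrier := a_kernel (F (Suc m)) (F m) (D m) \<rparr>)
        (D (Suc m) ` carrier (F (Suc (Suc m))))"

text \<open>The map \<open>(N\<^sub>i \<otimes>\<^sub>K (k\<^sup>p)\<^sub>i\<^sub>j) \<rightarrow> N\<^sub>i\<close>: projection to the \<open>(i, i)\<close> component followed by the
  identification \<open>N\<^sub>i \<otimes>\<^sub>K (k\<^sup>p)\<^sub>i\<^sub>i = N\<^sub>i \<otimes>\<^sub>K k = N\<^sub>i\<close>.\<close>

definition diagonal_entry ::
    "('k, 'a) module \<Rightarrow> (nat \<Rightarrow> ('a, 'b) module) \<Rightarrow> nat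
      \<Rightarrow> (nat \<times> nat \<Rightarrow> ('b \<times> (nat \<Rightarrow> 'k) \<Rightarrow>\<^sub>0 int) set) \<Rightarrow> 'b"
  where "diagonal_entry A N i x =
    tensor_lift (N i) (\<lambda>(n, y). (y i \<odot>\<^bsub>A\<^esub> \<one>\<^bsub>A\<^esub>) \<odot>\<^bsub>N i\<^esub> n) (x (i, i))"

text \<open>The map \<open>H\<^sup>0 \<otimes>\<^sub>R k\<^sub>i \<rightarrow> M\<^sub>i\<close> that sends \<open>[x] \<otimes> c\<close> to \<open>c\<close> times the image of \<open>x\<close> under reduction
  to \<open>F\<^sub>0\<close> and the augmentation \<open>\<epsilon>\<^sub>i : L\<^sub>0\<^sub>i \<rightarrow> M\<^sub>i\<close>.\<close>

definition induced_eta ::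
    "('k, 'u) ring_scheme \<Rightarrow> ('k, 'a) module \<Rightarrow> nat \<Rightarrow> ('r \<Rightarrow> (nat \<Rightarrow> 'k))
      \<Rightarrow> (nat \<Rightarrow> ('a, 'l) module) \<Rightarrow> (nat \<Rightarrow> 'l \<Rightarrow> 'b) \<Rightarrow> (nat \<Rightarrow> ('a, 'b) module) \<Rightarrow> nat
      \<Rightarrow> ((nat \<times> nat \<Rightarrow> ('l \<times> 'r \<Rightarrow>\<^sub>0 int) set) set \<times> 'k \<Rightarrow>\<^sub>0 int) set \<Rightarrow> 'b"
  where "induced_eta K A p g L\<^sub>0 \<epsilon> M i =
    tensor_lift (M i) (\<lambda>(W, c). (c \<odot>\<^bsub>A\<^esub> \<one>\<^bsub>A\<^esub>) \<odot>\<^bsub>M i\<^esub>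
      \<epsilon> i (diagonal_entry A L\<^sub>0 i (mat_reduction K A p g L\<^sub>0 (SOME x. x \<in> W))))"

end

theory Submission
  imports Defs
begin

text \<open>Over the field \<open>k\<close> the augmented resolutions \<open>L\<^sub>*\<^sub>i \<rightarrow> M\<^sub>i\<close> have linear contractions \<open>s\<close>, \<open>t\<close> with
  \<open>s t = 0\<close>.  Tensored with \<open>R\<^sub>i\<^sub>j\<close>, they contract the constant lifting, whose differential is
  \<open>d \<otimes> 1\<close>.  An arbitrary lifting \<open>D\<close> has the same reduction as \<open>d \<otimes> 1\<close>, so
  \<open>E = 1 - D s - s D\<close> (in degree \<open>0\<close>: \<open>1 - D s - t \<epsilon>\<close>) is a right \<open>R\<close>-linear map that vanishes modulo
  \<open>I(R)\<close>, hence is nilpotent.  On cycles \<open>1 - E = D s\<close>, which gives exactness; in degree \<open>0\<close> the same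
  argument shows that \<open>t \<otimes> 1\<close> induces a right \<open>R\<close>-isomorphism from \<open>(M\<^sub>i \<otimes> R\<^sub>i\<^sub>j)\<close> onto \<open>H\<^sup>0\<close>.  Finally
  \<open>H\<^sup>0 \<otimes>\<^sub>R k\<^sub>i\<close> consists of the tensors \<open>[l \<otimes> e\<^sub>i] \<otimes> 1\<close> with \<open>l \<in> L\<^sub>0\<^sub>i\<close>, and such a tensor is zero if
  \<open>\<epsilon> l = 0\<close>, since then \<open>l \<otimes> e\<^sub>i\<close> is a boundary modulo \<open>I(R)\<close>.\<close>

section \<open>Additive maps and tensor products\<close>

text \<open>A resolution of \<open>M i\<close> splits over \<open>K\<close> but in general not over
  \<open>A\<close>, so the contractions are only \<open>K\<close>-linear. Every map built from them,
  in particular the error of the perturbation, is right \<open>R\<close>-linear and has no reason to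
  respect \<open>A\<close>. This suffices: a lifting compares its module with the matrices over
  \<open>M\<close> as right modules only, and the \<open>A\<close>-linear maps to the
  \<open>M i\<close> are made from reduction and augmentation, without a contraction.

  Right linearity is what turns vanishing after reduction into nilpotency: if E maps F into F I(R),
  then the n-th power of E maps F into F I(R)^n. The condition s t = 0 is used for injectivity of M
  -> H^0: if t u = D z, then s D z = 0, so z may be replaced by E z without changing D z, and
  iterating gives t u = 0.

  No exactness of tensor products is invoked. Identities between maps pass to tensor products
  because both sides are additive and agree on generators, and the kernel of reduction is computed
  from the splitting \<open>f\<close> of \<open>g\<close>.\<close>

definition additive_hom :: "('a, 'u) ring_scheme \<Rightarrow> ('b, 'v) ring_scheme \<Rightarrow> ('a \<Rightarrow> 'b) set"
  where "additive_hom P Q = {h \<in> carrier P \<rightarrow> carrier Q.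
    \<forall>x \<in> carrier P. \<forall>y \<in> carrier P. h (x \<oplus>\<^bsub>P\<^esub> y) = h x \<oplus>\<^bsub>Q\<^esub> h y}"

lemma additive_homI:
  assumes "\<And>x. x \<in> carrier P \<Longrightarrow> h x \<in> carrier Q"
    and "\<And>x y. x \<in> carrier P \<Longrightarrow> y \<in> carrier P \<Longrightarrow> h (x \<oplus>\<^bsub>P\<^esub> y) = h x \<oplus>\<^bsub>Q\<^esub> h y"
  shows "h \<in> additive_hom P Q"
  using assms by (auto simp: additive_hom_def)

lemma additive_hom_closed: "h \<in> additive_hom P Q \<Longrightarrow> x \<in> carrier P \<Longrightarrow> h x \<in> carrier Q"
  by (auto simp: additive_hom_def)

lemma additive_hom_add:
  "h \<in> additive_hom P Q \<Longrightarrow> x \<in> carrier P \<Longrightarrow> y \<in> carrier P \<Longrightarrow> h (x \<oplus>\<^bsub>P\<^esub> y) = h x \<oplus>\<^bsub>Q\<^esub> h y"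
  by (auto simp: additive_hom_def)

lemma additive_hom_abelian_group_hom:
  assumes "abelian_group P" "abelian_group Q" "h \<in> additive_hom P Q"
  shows "abelian_group_hom P Q h"
  using assms
  by (intro abelian_group_homI) (auto simp: additive_hom_def group_hom_def group_hom_axioms_def hom_def
      abelian_group.a_group)

lemma additive_hom_zero:
  assumes "abelian_group P" "abelian_group Q" "h \<in> additive_hom P Q"
  shows "h \<zero>\<^bsub>P\<^esub> = \<zero>\<^bsub>Q\<^esub>"
  by (rule abelian_group_hom.hom_zero[OF additive_hom_abelian_group_hom[OF assms]])

lemma additive_hom_neg:
  assumes "abelian_group P" "abelian_group Q" "h \<in> additive_hom P Q" "x \<in> carrier P"
  shows "h (\<ominus>\<^bsub>P\<^esub> x) = \<ominus>\<^bsub>Q\<^esub> h x"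
  using abelian_group_hom.hom_a_inv[OF additive_hom_abelian_group_hom[OF assms(1-3)]] assms(4) by simp

lemma additive_hom_minus:
  assumes "abelian_group P" "abelian_group Q" "h \<in> additive_hom P Q" "x \<in> carrier P" "y \<in> carrier P"
  shows "h (x \<ominus>\<^bsub>P\<^esub> y) = h x \<ominus>\<^bsub>Q\<^esub> h y"
  using assms
  by (simp add: a_minus_def additive_hom_add additive_hom_neg[OF assms(1-3)] abelian_group.a_inv_closed)

lemma additive_hom_image_zero:
  "abelian_group P \<Longrightarrow> abelian_group Q \<Longrightarrow> h \<in> additive_hom P Q \<Longrightarrow> \<zero>\<^bsub>Q\<^esub> \<in> h ` carrier P"
  using additive_hom_zero[of P Q h] abelian_groupE(2)[of P] by (metis imageI)

lemma additive_hom_image_add: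
  assumes "abelian_group P" "h \<in> additive_hom P Q" "v \<in> h ` carrier P" "w \<in> h ` carrier P"
  shows "v \<oplus>\<^bsub>Q\<^esub> w \<in> h ` carrier P"
proof -
  obtain x y where "x \<in> carrier P" "v = h x" "y \<in> carrier P" "w = h y" using assms(3,4) by blast
  then show ?thesis
    using additive_hom_add[OF assms(2)] abelian_groupE(1)[OF assms(1)] by (metis imageI)
qed

lemma additive_hom_comp:
  "h \<in> additive_hom P Q \<Longrightarrow> h' \<in> additive_hom Q Q' \<Longrightarrow> (\<lambda>x. h' (h x)) \<in> additive_hom P Q'"
  by (auto simp: additive_hom_def Pi_iff)

lemma additive_hom_id: "(\<lambda>x. x) \<in> additive_hom P P"
  by (auto simp: additive_hom_def)

lemma additive_hom_add_fun:
  assumes "abelian_group Q" "h \<in> additive_hom P Q" "h' \<in> additive_hom P Q"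
  shows "(\<lambda>x. h x \<oplus>\<^bsub>Q\<^esub> h' x) \<in> additive_hom P Q"
proof -
  interpret Q: abelian_group Q by fact
  show ?thesis using assms(2,3) by (auto simp: additive_hom_def Pi_iff Q.a_ac)
qed

lemma additive_hom_neg_fun:
  assumes "abelian_group Q" "h \<in> additive_hom P Q"
  shows "(\<lambda>x. \<ominus>\<^bsub>Q\<^esub> h x) \<in> additive_hom P Q"
proof -
  interpret Q: abelian_group Q by fact
  show ?thesis using assms(2) by (auto simp: additive_hom_def Pi_iff Q.minus_add)
qed

lemma additive_hom_minus_fun:
  assumes "abelian_group Q" "h \<in> additive_hom P Q" "h' \<in> additive_hom P Q"
  shows "(\<lambda>x. h x \<ominus>\<^bsub>Q\<^esub> h' x) \<in> additive_hom P Q"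
  unfolding a_minus_def using assms additive_hom_add_fun additive_hom_neg_fun by blast

lemma additive_hom_finsum_fun:
  assumes "abelian_group Q" "\<And>j. j \<in> J \<Longrightarrow> h j \<in> additive_hom P Q"
  shows "(\<lambda>x. \<Oplus>\<^bsub>Q\<^esub>j\<in>J. h j x) \<in> additive_hom P Q"
proof -
  interpret Q: abelian_group Q by fact
  show ?thesis
  proof (rule additive_homI)
    fix x y assume "x \<in> carrier P" "y \<in> carrier P"
    then have "(\<Oplus>\<^bsub>Q\<^esub>j\<in>J. h j (x \<oplus>\<^bsub>P\<^esub> y)) = (\<Oplus>\<^bsub>Q\<^esub>j\<in>J. h j x \<oplus>\<^bsub>Q\<^esub> h j y)"
      using assms(2) by (intro Q.finsum_cong') (auto simp: additive_hom_def Pi_iff)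
    also have "\<dots> = (\<Oplus>\<^bsub>Q\<^esub>j\<in>J. h j x) \<oplus>\<^bsub>Q\<^esub> (\<Oplus>\<^bsub>Q\<^esub>j\<in>J. h j y)"
      using assms(2) \<open>x \<in> carrier P\<close> \<open>y \<in> carrier P\<close>
      by (intro Q.finsum_addf) (auto simp: additive_hom_def Pi_iff)
    finally show "(\<Oplus>\<^bsub>Q\<^esub>j\<in>J. h j (x \<oplus>\<^bsub>P\<^esub> y)) = (\<Oplus>\<^bsub>Q\<^esub>j\<in>J. h j x) \<oplus>\<^bsub>Q\<^esub> (\<Oplus>\<^bsub>Q\<^esub>j\<in>J. h j y)" .
  qed (use assms(2) in \<open>auto intro!: Q.finsum_closed simp: additive_hom_def Pi_iff\<close>)
qed

text \<open>The curried form of the maps that \<open>tensor_lift\<close> takes. Additivity in each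
  variable and the exchange of scalars match the three families of relations that define the tensor
  product.\<close>

definition balanced_map ::
    "('r, 'u) ring_scheme \<Rightarrow> ('a, 'r, 'b, 'y) bimodule_scheme
      \<Rightarrow> ('r, 'c, 'z) module_scheme \<Rightarrow> ('d, 'v) ring_scheme \<Rightarrow> ('b \<Rightarrow> 'c \<Rightarrow> 'd) \<Rightarrow> bool"
  where "balanced_map R M N P \<phi> \<longleftrightarrow>
    (\<forall>y \<in> carrier N. (\<lambda>x. \<phi> x y) \<in> additive_hom M P) \<and>
    (\<forall>x \<in> carrier M. \<phi> x \<in> additive_hom N P) \<and>
    (\<forall>x \<in> carrier M. \<forall>r \<in> carrier R. \<forall>y \<in> carrier N.
      \<phi> (rsmult M x r) y = \<phi> x (r \<odot>\<^bsub>N\<^esub> y))"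

lemma balanced_mapI:
  assumes "\<And>x y. x \<in> carrier M \<Longrightarrow> y \<in> carrier N \<Longrightarrow> \<phi> x y \<in> carrier P"
    and "\<And>x x' y. x \<in> carrier M \<Longrightarrow> x' \<in> carrier M \<Longrightarrow> y \<in> carrier N \<Longrightarrow>
      \<phi> (x \<oplus>\<^bsub>M\<^esub> x') y = \<phi> x y \<oplus>\<^bsub>P\<^esub> \<phi> x' y"
    and "\<And>x y y'. x \<in> carrier M \<Longrightarrow> y \<in> carrier N \<Longrightarrow> y' \<in> carrier N \<Longrightarrow>
      \<phi> x (y \<oplus>\<^bsub>N\<^esub> y') = \<phi> x y \<oplus>\<^bsub>P\<^esub> \<phi> x y'"
    and "\<And>x r y. x \<in> carrier M \<Longrightarrow> r \<in> carrier R \<Longrightarrow> y \<in> carrier N \<Longrightarrow>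
      \<phi> (rsmult M x r) y = \<phi> x (r \<odot>\<^bsub>N\<^esub> y)"
  shows "balanced_map R M N P \<phi>"
  unfolding balanced_map_def additive_hom_def using assms by blast

lemma balanced_map_closed:
  "balanced_map R M N P \<phi> \<Longrightarrow> x \<in> carrier M \<Longrightarrow> y \<in> carrier N \<Longrightarrow> \<phi> x y \<in> carrier P"
  by (auto simp: balanced_map_def additive_hom_def)

lemma balanced_map_add_left:
  "balanced_map R M N P \<phi> \<Longrightarrow> x \<in> carrier M \<Longrightarrow> x' \<in> carrier M \<Longrightarrow> y \<in> carrier N \<Longrightarrow>
    \<phi> (x \<oplus>\<^bsub>M\<^esub> x') y = \<phi> x y \<oplus>\<^bsub>P\<^esub> \<phi> x' y"
  by (simp add: balanced_map_def additive_hom_def)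

lemma balanced_map_add_right:
  "balanced_map R M N P \<phi> \<Longrightarrow> x \<in> carrier M \<Longrightarrow> y \<in> carrier N \<Longrightarrow> y' \<in> carrier N \<Longrightarrow>
    \<phi> x (y \<oplus>\<^bsub>N\<^esub> y') = \<phi> x y \<oplus>\<^bsub>P\<^esub> \<phi> x y'"
  by (simp add: balanced_map_def additive_hom_def)

lemma balanced_map_smult:
  "balanced_map R M N P \<phi> \<Longrightarrow> x \<in> carrier M \<Longrightarrow> r \<in> carrier R \<Longrightarrow> y \<in> carrier N \<Longrightarrow>
    \<phi> (rsmult M x r) y = \<phi> x (r \<odot>\<^bsub>N\<^esub> y)"
  by (simp add: balanced_map_def)

section \<open>The tensor product as a quotient of a free abelian group\<close>

locale tensor_factors = M: right_module R M + N: left_module R N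
  for R :: "('r, 'u) ring_scheme" and M :: "('a, 'r, 'b, 'y) bimodule_scheme"
    and N :: "('r, 'c, 'z) module_scheme"
begin

abbreviation "G \<equiv> tensor_free M N"
abbreviation "H \<equiv> tensor_relations R M N"
abbreviation "T \<equiv> tensor_group R M N"
abbreviation "pt \<equiv> pure_tensor R M N"

text \<open>The generating set inside \<open>tensor_relations\<close>, named because
  well-definedness is checked on generators and then passed to the generated subgroup.\<close>

definition "relators =
    {frag_of (x \<oplus>\<^bsub>M\<^esub> x', y) - frag_of (x, y) - frag_of (x', y) | x x' y.
        x \<in> carrier M \<and> x' \<in> carrier M \<and> y \<in> carrier N} \<union>
     {frag_of (x, y \<oplus>\<^bsub>N\<^esub> y') - frag_of (x, y) - frag_of (x, y') | x y y'.
        x \<in> carrier M \<and> y \<in> carrier N \<and> y' \<in> carrier N} \<union>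
     {frag_of (rsmult M x r, y) - frag_of (x, r \<odot>\<^bsub>N\<^esub> y) | x r y.
        x \<in> carrier M \<and> r \<in> carrier R \<and> y \<in> carrier N}"

lemma relators_closed: "relators \<subseteq> carrier G"
proof -
  have "carrier G = {z. Poly_Mapping.keys z \<subseteq> carrier M \<times> carrier N}" by auto
  moreover have "Poly_Mapping.keys (frag_of a - frag_of b) \<subseteq> {a, b}"
    "Poly_Mapping.keys (frag_of a - frag_of b - frag_of c) \<subseteq> {a, b, c}" for a b c :: "'b \<times> 'c"
    using keys_diff[of "frag_of a" "frag_of b"] keys_diff[of "frag_of a - frag_of b" "frag_of c"]
    by auto
  ultimately show ?thesis unfolding relators_def
    by (fastforce intro: M.right_closed N.left_closed)
qed

lemma relations_eq: "H = generate G relators"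
  by (simp add: tensor_relations_def relators_def)

sublocale G: comm_group G by (rule abelian_free_Abelian_group)

lemma relations_subgroup: "subgroup H G"
  unfolding relations_eq by (rule G.generate_is_subgroup[OF relators_closed])

lemma relations_normal: "H \<lhd> G"
  using G.normal_iff_subgroup relations_subgroup by blast

lemma tensor_group_simps:
  "carrier T = rcosets\<^bsub>G\<^esub> H" "\<zero>\<^bsub>T\<^esub> = H" "x \<oplus>\<^bsub>T\<^esub> y = x <#>\<^bsub>G\<^esub> y"
  by (simp_all add: tensor_group_def Let_def FactGroup_def)

lemma tensor_abelian_group: "abelian_group T"
proof (rule comm_group_abelian_groupI)
  have "add_monoid T = (G Mod H) \<lparr> one := H \<rparr>"
    by (simp add: tensor_group_def Let_def FactGroup_def)
  moreover have "(G Mod H) \<lparr> one := H \<rparr> = G Mod H" by (simp add: FactGroup_def)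
  ultimately show "comm_group (add_monoid T)"
    using G.abelian_FactGroup[OF relations_subgroup] by simp
qed

sublocale T: abelian_group T by (rule tensor_abelian_group)

abbreviation cls where "cls z \<equiv> H #>\<^bsub>G\<^esub> z"

lemma cls_closed: "z \<in> carrier G \<Longrightarrow> cls z \<in> carrier T"
  unfolding tensor_group_simps by (rule G.rcosetsI) (use relations_subgroup subgroup.subset in auto)

lemma cls_add: "z \<in> carrier G \<Longrightarrow> w \<in> carrier G \<Longrightarrow> cls z \<oplus>\<^bsub>T\<^esub> cls w = cls (z + w)"
  using normal.rcos_sum[OF relations_normal, of z w] by (simp add: tensor_group_simps)

lemma cls_zero: "cls 0 = \<zero>\<^bsub>T\<^esub>"
  using G.coset_mult_one[of H] relations_subgroup subgroup.subset
  by (auto simp: tensor_group_simps)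

lemma cls_minus: "z \<in> carrier G \<Longrightarrow> w \<in> carrier G \<Longrightarrow> cls (z - w) = cls z \<ominus>\<^bsub>T\<^esub> cls w"
proof -
  assume zw: "z \<in> carrier G" "w \<in> carrier G"
  have d: "z - w \<in> carrier G" using zw keys_diff[of z w] by auto
  have "cls (z - w) \<oplus>\<^bsub>T\<^esub> cls w = cls z" using cls_add[OF d zw(2)] by simp
  then show ?thesis using T.minus_equality zw d cls_closed
    by (metis T.add.inv_solve_right T.minus_eq)
qed

lemma cls_eq_zero: "z \<in> H \<Longrightarrow> cls z = \<zero>\<^bsub>T\<^esub>"
  by (simp add: tensor_group_simps G.coset_join3 relations_subgroup subgroup.rcos_const[OF relations_subgroup])

lemma pt_cls: "pt x y = cls (frag_of (x, y))"
  by (simp add: pure_tensor_def)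

lemma pt_closed: "x \<in> carrier M \<Longrightarrow> y \<in> carrier N \<Longrightarrow> pt x y \<in> carrier T"
  unfolding pt_cls by (rule cls_closed) simp

lemma relator_in_relations: "z \<in> relators \<Longrightarrow> z \<in> H"
  unfolding relations_eq by (rule generate.incl)

text \<open>The induction principle for free abelian groups is closed under differences, so this
  first version asks for differences as well; \<open>tensor_induct\<close> replaces them by
  sums.\<close>

lemma cls_induct:
  assumes "z \<in> carrier G"
    and "P \<zero>\<^bsub>T\<^esub>"
    and "\<And>s t. s \<in> carrier T \<Longrightarrow> t \<in> carrier T \<Longrightarrow> P s \<Longrightarrow> P t \<Longrightarrow> P (s \<ominus>\<^bsub>T\<^esub> t)"
    and "\<And>x y. x \<in> carrier M \<Longrightarrow> y \<in> carrier N \<Longrightarrow> P (pt x y)"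
  shows "P (cls z)"
proof -
  have "Poly_Mapping.keys z \<subseteq> carrier M \<times> carrier N" using assms(1) by simp
  then show ?thesis
  proof (rule free_Abelian_group_induct)
    show "P (cls 0)" using assms(2) cls_zero by simp
  next
    fix x y :: "'b \<times> 'c \<Rightarrow>\<^sub>0 int"
    assume "Poly_Mapping.keys x \<subseteq> carrier M \<times> carrier N" "Poly_Mapping.keys y \<subseteq> carrier M \<times> carrier N"
      "P (cls x)" "P (cls y)"
    then show "P (cls (x - y))" using assms(3)[of "cls x" "cls y"] cls_minus[of x y] cls_closed by simp
  next
    fix a assume "a \<in> carrier M \<times> carrier N"
    then show "P (cls (frag_of a))" using assms(4)[of "fst a" "snd a"] by (auto simp: pt_cls)
  qed
qed

lemma cls_relator_add:
  assumes "z \<in> relators" "w \<in> carrier G"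
  shows "cls (z + w) = cls w"
proof -
  have "z \<in> carrier G" using assms(1) relators_closed by blast
  then have "cls (z + w) = cls z \<oplus>\<^bsub>T\<^esub> cls w" by (rule cls_add[OF _ assms(2), symmetric])
  then show ?thesis using cls_eq_zero[OF relator_in_relations[OF assms(1)]] cls_closed[OF assms(2)] by simp
qed

lemma cls_cases:
  assumes "t \<in> carrier T"
  obtains z where "z \<in> carrier G" "t = cls z"
  using assms unfolding tensor_group_simps RCOSETS_def by auto

lemma pt_sum:
  assumes c: "a \<in> carrier M \<times> carrier N" "b \<in> carrier M \<times> carrier N" "c \<in> carrier M \<times> carrier N"
    and r: "frag_of a - frag_of b - frag_of c \<in> relators"
  shows "cls (frag_of a) = cls (frag_of b) \<oplus>\<^bsub>T\<^esub> cls (frag_of c)"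
proof -
  have f: "frag_of b \<in> carrier G" "frag_of c \<in> carrier G" using c by auto
  have bc: "frag_of b + frag_of c \<in> carrier G" using G.m_closed[OF f] by simp
  have "cls (frag_of a) = cls ((frag_of a - frag_of b - frag_of c) + (frag_of b + frag_of c))" by simp
  also have "\<dots> = cls (frag_of b) \<oplus>\<^bsub>T\<^esub> cls (frag_of c)"
    by (simp only: cls_relator_add[OF r bc] cls_add[OF f])
  finally show ?thesis .
qed

lemma pt_add_left:
  assumes "x \<in> carrier M" "x' \<in> carrier M" "y \<in> carrier N"
  shows "pt (x \<oplus>\<^bsub>M\<^esub> x') y = pt x y \<oplus>\<^bsub>T\<^esub> pt x' y"
  unfolding pt_cls by (rule pt_sum) (use assms in \<open>auto simp: relators_def\<close>)

lemma pt_add_right: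
  assumes "x \<in> carrier M" "y \<in> carrier N" "y' \<in> carrier N"
  shows "pt x (y \<oplus>\<^bsub>N\<^esub> y') = pt x y \<oplus>\<^bsub>T\<^esub> pt x y'"
  unfolding pt_cls by (rule pt_sum) (use assms in \<open>auto simp: relators_def\<close>)

lemma pt_smult:
  assumes "x \<in> carrier M" "r \<in> carrier R" "y \<in> carrier N"
  shows "pt (rsmult M x r) y = pt x (r \<odot>\<^bsub>N\<^esub> y)"
proof -
  let ?a = "frag_of (rsmult M x r, y)" and ?b = "frag_of (x, r \<odot>\<^bsub>N\<^esub> y)"
  have c: "?a \<in> carrier G" "?b \<in> carrier G"
    using assms by (auto intro: M.right_closed N.left_closed)
  have r: "?a - ?b \<in> relators" unfolding relators_def using assms by blast
  have "cls ?a = cls ((?a - ?b) + ?b)" by simp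
  also have "\<dots> = cls ?b" by (rule cls_relator_add[OF r c(2)])
  finally show ?thesis by (simp add: pt_cls)
qed

lemma pt_balanced: "balanced_map R M N T pt"
  by (intro balanced_mapI pt_closed pt_add_left pt_add_right pt_smult)

text \<open>Differences disappear when the claim is strengthened to an element together with its
  negative. The negative of a pure tensor is again pure, being (-x) tensor y, so no extra hypothesis
  is needed for it.\<close>

lemma tensor_induct [consumes 1, case_names zero add pure]:
  assumes t: "t \<in> carrier T"
    and zero: "P \<zero>\<^bsub>T\<^esub>"
    and add: "\<And>s t. s \<in> carrier T \<Longrightarrow> t \<in> carrier T \<Longrightarrow> P s \<Longrightarrow> P t \<Longrightarrow> P (s \<oplus>\<^bsub>T\<^esub> t)"
    and pure: "\<And>x y. x \<in> carrier M \<Longrightarrow> y \<in> carrier N \<Longrightarrow> P (pt x y)"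
  shows "P t"
proof -
  have zero_neg: "\<ominus>\<^bsub>T\<^esub> \<zero>\<^bsub>T\<^esub> = \<zero>\<^bsub>T\<^esub>"
    by (metis T.a_inv_closed T.zero_closed T.l_zero T.r_neg)
  have "P t \<and> P (\<ominus>\<^bsub>T\<^esub> t)"
  proof (rule cls_cases[OF t], simp only:, rule cls_induct)
    fix s t assume "s \<in> carrier T" "t \<in> carrier T" "P s \<and> P (\<ominus>\<^bsub>T\<^esub> s)" "P t \<and> P (\<ominus>\<^bsub>T\<^esub> t)"
    then show "P (s \<ominus>\<^bsub>T\<^esub> t) \<and> P (\<ominus>\<^bsub>T\<^esub> (s \<ominus>\<^bsub>T\<^esub> t))"
      using add[of s "\<ominus>\<^bsub>T\<^esub> t"] add[of "\<ominus>\<^bsub>T\<^esub> s" t] by (simp add: T.minus_eq T.minus_add)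
  next
    fix x y assume xy: "x \<in> carrier M" "y \<in> carrier N"
    have "\<ominus>\<^bsub>T\<^esub> pt x y = pt (\<ominus>\<^bsub>M\<^esub> x) y"
      using additive_hom_neg[of M T "\<lambda>x. pt x y" x] pt_balanced xy M.abelian_group_axioms
        tensor_abelian_group by (simp add: balanced_map_def)
    then show "P (pt x y) \<and> P (\<ominus>\<^bsub>T\<^esub> pt x y)" using pure xy by simp
  next
    show "P \<zero>\<^bsub>T\<^esub> \<and> P (\<ominus>\<^bsub>T\<^esub> \<zero>\<^bsub>T\<^esub>)" by (simp only: zero_neg zero)
  qed
  then show ?thesis by simp
qed

text \<open>The standard device for tensor products below: module laws and naturality statements are
  read as equalities of additive maps and tested on pure tensors.\<close>

lemma additive_hom_eqI:
  assumes "abelian_group P" "h \<in> additive_hom T P" "h' \<in> additive_hom T P"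
    and "\<And>x y. x \<in> carrier M \<Longrightarrow> y \<in> carrier N \<Longrightarrow> h (pt x y) = h' (pt x y)"
    and "t \<in> carrier T"
  shows "h t = h' t"
  using assms(5)
proof (induction rule: tensor_induct)
  case zero
  show ?case by (simp only: additive_hom_zero[OF tensor_abelian_group assms(1)] assms(2,3))
next
  case (add s t)
  then show ?case
    by (simp only: additive_hom_add[OF assms(2) add(1,2)] additive_hom_add[OF assms(3) add(1,2)])
qed (use assms in auto)

section \<open>The universal property of the tensor product\<close>

context
  fixes P :: "('d, 'v) ring_scheme" and \<phi> :: "'b \<Rightarrow> 'c \<Rightarrow> 'd"
  assumes P: "abelian_group P" and bal: "balanced_map R M N P \<phi>"
begin

text \<open>The sum inside \<open>tensor_lift\<close> for one chosen representative. It is a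
  homomorphism on the free group, and it remains to see that it kills the relations.\<close>

private definition ext :: "('b \<times> 'c \<Rightarrow>\<^sub>0 int) \<Rightarrow> 'd" where "ext z =
  (\<Oplus>\<^bsub>P\<^esub>t \<in> Poly_Mapping.keys z. add_pow P (Poly_Mapping.lookup z t) (case t of (x, y) \<Rightarrow> \<phi> x y))"

private lemma \<phi>_closed: "x \<in> carrier M \<Longrightarrow> y \<in> carrier N \<Longrightarrow> \<phi> x y \<in> carrier P"
  by (rule balanced_map_closed[OF bal])

interpretation P: abelian_group P by (rule P)

private lemma pow_zero: "add_pow P (0 :: int) a = \<zero>\<^bsub>P\<^esub>"
  by (simp add: add_pow_def int_pow_def nat_pow_def)

text \<open>Positions outside the support contribute multiples by 0, so two elements of the free
  group can be summed over one common index set. This is what makes additivity of \<open>ext\<close>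
  visible.\<close>

private lemma ext_superset:
  assumes "finite S" "Poly_Mapping.keys z \<subseteq> S" "S \<subseteq> carrier M \<times> carrier N"
  shows "ext z = (\<Oplus>\<^bsub>P\<^esub>t \<in> S. add_pow P (Poly_Mapping.lookup z t) (case t of (x, y) \<Rightarrow> \<phi> x y))"
  unfolding ext_def
  using assms \<phi>_closed
  by (intro P.add.finprod_mono_neutral_cong_left) (auto simp: in_keys_iff pow_zero dest: subsetD intro!: P.add.int_pow_closed)

private lemma ext_closed: "z \<in> carrier G \<Longrightarrow> ext z \<in> carrier P"
  unfolding ext_def using \<phi>_closed by (intro P.finsum_closed) (auto intro!: P.add.int_pow_closed)

private lemma ext_add:
  assumes "z \<in> carrier G" "w \<in> carrier G"
  shows "ext (z + w) = ext z \<oplus>\<^bsub>P\<^esub> ext w"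
proof -
  let ?S = "Poly_Mapping.keys z \<union> Poly_Mapping.keys w"
  have S: "finite ?S" "?S \<subseteq> carrier M \<times> carrier N" using assms by auto
  have "ext (z + w) = (\<Oplus>\<^bsub>P\<^esub>t \<in> ?S. add_pow P (Poly_Mapping.lookup z t) (case t of (x, y) \<Rightarrow> \<phi> x y)
      \<oplus>\<^bsub>P\<^esub> add_pow P (Poly_Mapping.lookup w t) (case t of (x, y) \<Rightarrow> \<phi> x y))"
    using S keys_add[of z w] \<phi>_closed
    by (subst ext_superset[OF S(1)], simp, simp, intro P.finsum_cong')
      (auto simp: lookup_add P.add.int_pow_mult intro!: P.add.int_pow_closed P.a_closed)
  also have "\<dots> = ext z \<oplus>\<^bsub>P\<^esub> ext w"
    using S \<phi>_closed by (subst (1 2) ext_superset[OF S(1)], simp, simp, simp, simp, intro P.finsum_addf)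
      (auto intro!: P.add.int_pow_closed)
  finally show ?thesis .
qed

private lemma ext_hom: "ext \<in> hom G (add_monoid P)"
  by (rule homI) (use ext_closed ext_add in auto)

private lemma ext_frag_of: "x \<in> carrier M \<Longrightarrow> y \<in> carrier N \<Longrightarrow> ext (frag_of (x, y)) = \<phi> x y"
  using \<phi>_closed by (simp add: ext_def P.finsum_singleton[of "(x, y)" "{(x, y)}"])

private lemma ext_minus:
  "z \<in> carrier G \<Longrightarrow> w \<in> carrier G \<Longrightarrow> ext (z - w) = ext z \<ominus>\<^bsub>P\<^esub> ext w"
proof -
  assume zw: "z \<in> carrier G" "w \<in> carrier G"
  have d: "z - w \<in> carrier G" using zw keys_diff[of z w] by auto
  have "ext (z - w) \<oplus>\<^bsub>P\<^esub> ext w = ext z" using ext_add[OF d zw(2)] by simp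
  then show ?thesis using zw d ext_closed by (metis P.add.inv_solve_right P.minus_eq)
qed

private lemma relators_cases:
  assumes "z \<in> relators"
  obtains (left) x x' y where "z = frag_of (x \<oplus>\<^bsub>M\<^esub> x', y) - frag_of (x, y) - frag_of (x', y)"
      "x \<in> carrier M" "x' \<in> carrier M" "y \<in> carrier N"
  | (right) x y y' where "z = frag_of (x, y \<oplus>\<^bsub>N\<^esub> y') - frag_of (x, y) - frag_of (x, y')"
      "x \<in> carrier M" "y \<in> carrier N" "y' \<in> carrier N"
  | (scalar) x r y where "z = frag_of (rsmult M x r, y) - frag_of (x, r \<odot>\<^bsub>N\<^esub> y)"
      "x \<in> carrier M" "r \<in> carrier R" "y \<in> carrier N"
  using assms unfolding relators_def
  by (elim UnE CollectE exE conjE)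
    (rule left, assumption+ | rule right, assumption+ | rule scalar, assumption+)+

text \<open>A kernel is a subgroup, so only the generators have to be examined; each of the three
  kinds of relator is killed by one of the three properties of a balanced map.\<close>

private lemma ext_relations: "z \<in> H \<Longrightarrow> ext z = \<zero>\<^bsub>P\<^esub>"
proof -
  interpret h: group_hom G "add_monoid P" ext
    by (unfold_locales) (use ext_hom in auto)
  have "relators \<subseteq> kernel G (add_monoid P) ext"
  proof
    fix z assume z: "z \<in> relators"
    have zG: "z \<in> carrier G" using z relators_closed by blast
    have f: "frag_of (x, y) \<in> carrier G" if "x \<in> carrier M" "y \<in> carrier N" for x y
      using that by simp
    have fd: "frag_of (x, y) - frag_of (x', y') \<in> carrier G"
      if "x \<in> carrier M" "y \<in> carrier N" "x' \<in> carrier M" "y' \<in> carrier N" for x y x' y'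
      using that keys_diff[of "frag_of (x, y)" "frag_of (x', y')"] by auto
    have add3: "a \<oplus>\<^bsub>P\<^esub> b \<ominus>\<^bsub>P\<^esub> a \<ominus>\<^bsub>P\<^esub> b = \<zero>\<^bsub>P\<^esub>" if "a \<in> carrier P" "b \<in> carrier P" for a b
      using that by (simp add: P.minus_eq P.a_assoc P.a_comm[of a b] P.r_neg)
    from z have "ext z = \<zero>\<^bsub>P\<^esub>"
    proof (cases rule: relators_cases)
      case (left x x' y)
      have xx: "x \<oplus>\<^bsub>M\<^esub> x' \<in> carrier M" by (rule M.a_closed[OF left(2,3)])
      have "ext z = \<phi> (x \<oplus>\<^bsub>M\<^esub> x') y \<ominus>\<^bsub>P\<^esub> \<phi> x y \<ominus>\<^bsub>P\<^esub> \<phi> x' y"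
        unfolding left(1) ext_minus[OF fd[OF xx left(4,2,4)] f[OF left(3,4)]]
          ext_minus[OF f[OF xx left(4)] f[OF left(2,4)]]
          ext_frag_of[OF xx left(4)] ext_frag_of[OF left(2,4)] ext_frag_of[OF left(3,4)] ..
      then show ?thesis
        unfolding balanced_map_add_left[OF bal left(2-4)]
          add3[OF \<phi>_closed[OF left(2,4)] \<phi>_closed[OF left(3,4)]] .
    next
      case (right x y y')
      have yy: "y \<oplus>\<^bsub>N\<^esub> y' \<in> carrier N" by (rule N.a_closed[OF right(3,4)])
      have "ext z = \<phi> x (y \<oplus>\<^bsub>N\<^esub> y') \<ominus>\<^bsub>P\<^esub> \<phi> x y \<ominus>\<^bsub>P\<^esub> \<phi> x y'"
        unfolding right(1) ext_minus[OF fd[OF right(2) yy right(2,3)] f[OF right(2,4)]]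
          ext_minus[OF f[OF right(2) yy] f[OF right(2,3)]]
          ext_frag_of[OF right(2) yy] ext_frag_of[OF right(2,3)] ext_frag_of[OF right(2,4)] ..
      then show ?thesis
        unfolding balanced_map_add_right[OF bal right(2-4)]
          add3[OF \<phi>_closed[OF right(2,3)] \<phi>_closed[OF right(2,4)]] .
    next
      case (scalar x r y)
      note cl = M.right_closed[OF scalar(3,2)] N.left_closed[OF scalar(3,4)]
      have "ext z = \<phi> (rsmult M x r) y \<ominus>\<^bsub>P\<^esub> \<phi> x (r \<odot>\<^bsub>N\<^esub> y)"
        unfolding scalar(1) ext_minus[OF f[OF cl(1) scalar(4)] f[OF scalar(2) cl(2)]]
          ext_frag_of[OF cl(1) scalar(4)] ext_frag_of[OF scalar(2) cl(2)] ..
      then show ?thesis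
        unfolding balanced_map_smult[OF bal scalar(2-4)] P.minus_eq
          P.r_neg[OF \<phi>_closed[OF scalar(2) cl(2)]] .
    qed
    then show "z \<in> kernel G (add_monoid P) ext" using zG by (simp add: kernel_def)
  qed
  then have "H \<subseteq> kernel G (add_monoid P) ext"
    unfolding relations_eq by (rule G.generate_subgroup_incl[OF _ h.subgroup_kernel])
  then show "z \<in> H \<Longrightarrow> ext z = \<zero>\<^bsub>P\<^esub>" by (auto simp: kernel_def)
qed

private abbreviation "lft \<equiv> tensor_lift P (\<lambda>(x, y). \<phi> x y)"

text \<open>Any two members of a coset differ by a relation, on which \<open>ext\<close> vanishes;
  hence the definite description in \<open>tensor_lift\<close> has exactly one candidate.\<close>

private lemma lift_cls:
  assumes "z \<in> carrier G"
  shows "lft (cls z) = ext z"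
proof -
  have HG: "H \<subseteq> carrier G" using relations_subgroup subgroup.subset by blast
  have "ext w = ext z" if "w \<in> cls z" for w
  proof -
    have "\<exists>h \<in> H. w = h + z" using that by (simp add: r_coset_def)
    then obtain h where h: "h \<in> H" "w = h + z" by blast
    have "h \<in> carrier G" using h(1) HG by blast
    show ?thesis
      unfolding h(2) ext_add[OF \<open>h \<in> carrier G\<close> assms] ext_relations[OF h(1)] P.l_zero[OF ext_closed[OF assms]] ..
  qed
  moreover have "z \<in> cls z" using G.rcos_self[OF assms relations_subgroup] .
  ultimately have "(THE v. \<exists>w \<in> cls z. v = ext w) = ext z" by (intro the_equality) blast+
  then show ?thesis unfolding tensor_lift_def ext_def .
qed

lemma lift_additive: "tensor_lift P (\<lambda>(x, y). \<phi> x y) \<in> additive_hom T P"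
proof (rule additive_homI)
  fix s t assume s: "s \<in> carrier T" and t: "t \<in> carrier T"
  obtain z where z: "z \<in> carrier G" "s = cls z" by (rule cls_cases[OF s])
  obtain w where w: "w \<in> carrier G" "t = cls w" by (rule cls_cases[OF t])
  have zw: "z + w \<in> carrier G" using G.m_closed[OF z(1) w(1)] by simp
  show "lft (s \<oplus>\<^bsub>T\<^esub> t) = lft s \<oplus>\<^bsub>P\<^esub> lft t"
    unfolding z(2) w(2) cls_add[OF z(1) w(1)] lift_cls[OF zw] lift_cls[OF z(1)] lift_cls[OF w(1)]
    by (rule ext_add[OF z(1) w(1)])
next
  fix s assume s: "s \<in> carrier T"
  obtain z where z: "z \<in> carrier G" "s = cls z" by (rule cls_cases[OF s])
  show "lft s \<in> carrier P"
    unfolding z(2) lift_cls[OF z(1)] by (rule ext_closed[OF z(1)])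
qed

lemma lift_pt:
  "x \<in> carrier M \<Longrightarrow> y \<in> carrier N \<Longrightarrow> tensor_lift P (\<lambda>(x, y). \<phi> x y) (pt x y) = \<phi> x y"
  using lift_cls[of "frag_of (x, y)"] ext_frag_of[of x y] by (simp add: pt_cls)

end

end

section \<open>Modules over noncommutative rings and induced maps of tensor products\<close>

text \<open>Records for the same group may differ in fields that carry no information, such as
  \<open>mult\<close> and \<open>one\<close> of a module; only carrier, zero and addition are
  compared.\<close>

lemma abelian_group_cong:
  assumes "abelian_group P" "carrier Q = carrier P" "\<zero>\<^bsub>Q\<^esub> = \<zero>\<^bsub>P\<^esub>" "add Q = add P"
  shows "abelian_group Q"
proof -
  interpret P: abelian_group P by fact
  show ?thesis
  proof (rule abelian_groupI)
    fix x assume "x \<in> carrier Q"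
    then show "\<exists>y \<in> carrier Q. y \<oplus>\<^bsub>Q\<^esub> x = \<zero>\<^bsub>Q\<^esub>"
      using assms(2-4) P.l_neg P.a_inv_closed by auto
  qed (use assms(2-4) in \<open>auto simp: P.a_ac\<close>)
qed

lemma additive_hom_cong:
  "carrier P = carrier P' \<Longrightarrow> add P = add P' \<Longrightarrow> carrier Q = carrier Q' \<Longrightarrow> add Q = add Q' \<Longrightarrow>
    additive_hom P Q = additive_hom P' Q'"
  by (simp add: additive_hom_def)

lemma left_module_abelian_group: "left_module A M \<Longrightarrow> abelian_group M"
  by (simp add: left_module_def)

lemma right_module_abelian_group: "right_module A M \<Longrightarrow> abelian_group M"
  by (simp add: right_module_def)

lemma left_module_hom_additive: "h \<in> left_module_hom A M N \<Longrightarrow> h \<in> additive_hom M N"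
  by (simp add: left_module_hom_def additive_hom_def)

lemma right_module_hom_additive: "h \<in> right_module_hom A M N \<Longrightarrow> h \<in> additive_hom M N"
  by (simp add: right_module_hom_def additive_hom_def)

lemma left_module_hom_smult:
  "h \<in> left_module_hom A M N \<Longrightarrow> a \<in> carrier A \<Longrightarrow> x \<in> carrier M \<Longrightarrow>
    h (a \<odot>\<^bsub>M\<^esub> x) = a \<odot>\<^bsub>N\<^esub> h x"
  by (simp add: left_module_hom_def)

lemma right_module_hom_smult:
  "h \<in> right_module_hom A M N \<Longrightarrow> a \<in> carrier A \<Longrightarrow> x \<in> carrier M \<Longrightarrow>
    h (rsmult M x a) = rsmult N (h x) a"
  by (simp add: right_module_hom_def)

lemma left_module_homI:
  "h \<in> additive_hom M N \<Longrightarrow>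
    (\<And>a x. a \<in> carrier A \<Longrightarrow> x \<in> carrier M \<Longrightarrow> h (a \<odot>\<^bsub>M\<^esub> x) = a \<odot>\<^bsub>N\<^esub> h x) \<Longrightarrow>
    h \<in> left_module_hom A M N"
  by (simp add: left_module_hom_def additive_hom_def)

lemma right_module_homI:
  "h \<in> additive_hom M N \<Longrightarrow>
    (\<And>a x. a \<in> carrier A \<Longrightarrow> x \<in> carrier M \<Longrightarrow> h (rsmult M x a) = rsmult N (h x) a) \<Longrightarrow>
    h \<in> right_module_hom A M N"
  by (simp add: right_module_hom_def additive_hom_def)

lemma left_module_id_hom: "id \<in> left_module_hom A M M"
  by (simp add: left_module_hom_def)

lemma right_module_id_hom: "id \<in> right_module_hom A M M"
  by (simp add: right_module_hom_def)

lemma left_module_smult_additive: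
  "left_module A M \<Longrightarrow> a \<in> carrier A \<Longrightarrow> (\<lambda>x. a \<odot>\<^bsub>M\<^esub> x) \<in> additive_hom M M"
  by (simp add: additive_hom_def left_module.left_closed left_module.left_add)

lemma right_module_smult_additive:
  "right_module A M \<Longrightarrow> a \<in> carrier A \<Longrightarrow> (\<lambda>x. rsmult M x a) \<in> additive_hom M M"
  by (simp add: additive_hom_def right_module.right_closed right_module.right_add)

lemma left_moduleI:
  assumes "ring A" "abelian_group M"
    and "\<And>a. a \<in> carrier A \<Longrightarrow> (\<lambda>x. a \<odot>\<^bsub>M\<^esub> x) \<in> additive_hom M M"
    and "\<And>a b x. a \<in> carrier A \<Longrightarrow> b \<in> carrier A \<Longrightarrow> x \<in> carrier M \<Longrightarrow>
      (a \<oplus>\<^bsub>A\<^esub> b) \<odot>\<^bsub>M\<^esub> x = a \<odot>\<^bsub>M\<^esub> x \<oplus>\<^bsub>M\<^esub> b \<odot>\<^bsub>M\<^esub> x"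
    and "\<And>a b x. a \<in> carrier A \<Longrightarrow> b \<in> carrier A \<Longrightarrow> x \<in> carrier M \<Longrightarrow>
      (a \<otimes>\<^bsub>A\<^esub> b) \<odot>\<^bsub>M\<^esub> x = a \<odot>\<^bsub>M\<^esub> (b \<odot>\<^bsub>M\<^esub> x)"
    and "\<And>x. x \<in> carrier M \<Longrightarrow> \<one>\<^bsub>A\<^esub> \<odot>\<^bsub>M\<^esub> x = x"
  shows "left_module A M"
proof -
  have "\<And>a x. a \<in> carrier A \<Longrightarrow> x \<in> carrier M \<Longrightarrow> a \<odot>\<^bsub>M\<^esub> x \<in> carrier M"
    "\<And>a x y. a \<in> carrier A \<Longrightarrow> x \<in> carrier M \<Longrightarrow> y \<in> carrier M \<Longrightarrow>
      a \<odot>\<^bsub>M\<^esub> (x \<oplus>\<^bsub>M\<^esub> y) = a \<odot>\<^bsub>M\<^esub> x \<oplus>\<^bsub>M\<^esub> a \<odot>\<^bsub>M\<^esub> y"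
    using assms(3) by (auto simp: additive_hom_def)
  then show ?thesis
    using assms by (intro left_module.intro left_module_axioms.intro) auto
qed

lemma right_moduleI:
  assumes "ring R" "abelian_group M"
    and "\<And>r. r \<in> carrier R \<Longrightarrow> (\<lambda>x. rsmult M x r) \<in> additive_hom M M"
    and "\<And>r s x. r \<in> carrier R \<Longrightarrow> s \<in> carrier R \<Longrightarrow> x \<in> carrier M \<Longrightarrow>
      rsmult M x (r \<oplus>\<^bsub>R\<^esub> s) = rsmult M x r \<oplus>\<^bsub>M\<^esub> rsmult M x s"
    and "\<And>r s x. r \<in> carrier R \<Longrightarrow> s \<in> carrier R \<Longrightarrow> x \<in> carrier M \<Longrightarrow>
      rsmult M x (r \<otimes>\<^bsub>R\<^esub> s) = rsmult M (rsmult M x r) s"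
    and "\<And>x. x \<in> carrier M \<Longrightarrow> rsmult M x \<one>\<^bsub>R\<^esub> = x"
  shows "right_module R M"
proof -
  have "\<And>a x. a \<in> carrier R \<Longrightarrow> x \<in> carrier M \<Longrightarrow> rsmult M x a \<in> carrier M"
    "\<And>a x y. a \<in> carrier R \<Longrightarrow> x \<in> carrier M \<Longrightarrow> y \<in> carrier M \<Longrightarrow>
      rsmult M (x \<oplus>\<^bsub>M\<^esub> y) a = rsmult M x a \<oplus>\<^bsub>M\<^esub> rsmult M y a"
    using assms(3) by (auto simp: additive_hom_def)
  then show ?thesis
    using assms by (intro right_module.intro right_module_axioms.intro) auto
qed

lemma tensor_simps:
  "carrier (tensor R M N) = carrier (tensor_group R M N)"
  "\<zero>\<^bsub>tensor R M N\<^esub> = \<zero>\<^bsub>tensor_group R M N\<^esub>"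
  "add (tensor R M N) = add (tensor_group R M N)"
  "a \<odot>\<^bsub>tensor R M N\<^esub> t = tensor_lift (tensor_group R M N)
      (\<lambda>(x, y). pure_tensor R M N (a \<odot>\<^bsub>M\<^esub> x) y) t"
  by (simp_all add: tensor_def ring.defs module.defs)

lemma tensor_map_balanced:
  assumes "tensor_factors R M N" "tensor_factors R M' N'"
    and h: "h \<in> right_module_hom R M M'" and h': "h' \<in> left_module_hom R N N'"
  shows "balanced_map R M N (tensor_group R M' N') (\<lambda>x y. pure_tensor R M' N' (h x) (h' y))"
proof -
  interpret T': tensor_factors R M' N' by fact
  note hs = right_module_hom_additive[OF h] left_module_hom_additive[OF h']
  show ?thesis
    by (rule balanced_mapI)
      (simp_all add: T'.pt_closed T'.pt_add_left T'.pt_add_right T'.pt_smult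
        additive_hom_closed[OF hs(1)] additive_hom_closed[OF hs(2)]
        additive_hom_add[OF hs(1)] additive_hom_add[OF hs(2)]
        right_module_hom_smult[OF h] left_module_hom_smult[OF h'])
qed

lemma tensor_map_additive:
  assumes "tensor_factors R M N" "tensor_factors R M' N'"
    and "h \<in> right_module_hom R M M'" and "h' \<in> left_module_hom R N N'"
  shows "tensor_map R M' N' h h' \<in> additive_hom (tensor_group R M N) (tensor_group R M' N')"
  unfolding tensor_map_def
  by (rule tensor_factors.lift_additive[OF assms(1) tensor_factors.tensor_abelian_group[OF assms(2)]
        tensor_map_balanced[OF assms]])

lemma tensor_map_pt:
  assumes "tensor_factors R M N" "tensor_factors R M' N'"
    and "h \<in> right_module_hom R M M'" and "h' \<in> left_module_hom R N N'"
    and "x \<in> carrier M" "y \<in> carrier N"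
  shows "tensor_map R M' N' h h' (pure_tensor R M N x y) = pure_tensor R M' N' (h x) (h' y)"
  unfolding tensor_map_def
  by (rule tensor_factors.lift_pt[OF assms(1) tensor_factors.tensor_abelian_group[OF assms(2)]
        tensor_map_balanced[OF assms(1-4)] assms(5,6)])

locale tensor_bimodule_factors = tensor_factors R M N
  for R :: "('r, 'u) ring_scheme" and M :: "('a, 'r, 'b, 'y) bimodule_scheme"
    and N :: "('r, 'c, 'z) module_scheme" +
  fixes A :: "('a, 'x) ring_scheme"
  assumes left: "left_module A M"
    and smult_commute: "\<And>a r x. a \<in> carrier A \<Longrightarrow> r \<in> carrier R \<Longrightarrow> x \<in> carrier M \<Longrightarrow>
      a \<odot>\<^bsub>M\<^esub> rsmult M x r = rsmult M (a \<odot>\<^bsub>M\<^esub> x) r"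
begin

lemma smult_hom: "a \<in> carrier A \<Longrightarrow> (\<lambda>x. a \<odot>\<^bsub>M\<^esub> x) \<in> right_module_hom R M M"
  by (rule right_module_homI[OF left_module_smult_additive[OF left]]) (simp_all add: smult_commute)

text \<open>Multiplication by a is the tensor map of multiplication by a with the identity, so the
  general facts on tensor maps cover the left action.\<close>

lemma smult_tensor_map: "a \<odot>\<^bsub>tensor R M N\<^esub> t = tensor_map R M N (\<lambda>x. a \<odot>\<^bsub>M\<^esub> x) id t"
  by (simp add: tensor_simps tensor_map_def)

lemma tensor_smult_additive:
  "a \<in> carrier A \<Longrightarrow> (\<lambda>t. a \<odot>\<^bsub>tensor R M N\<^esub> t) \<in> additive_hom T T"
  unfolding smult_tensor_map
  using tensor_map_additive[OF tensor_factors_axioms tensor_factors_axioms smult_hom left_module_id_hom]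
  by simp

lemma tensor_smult_pt:
  "a \<in> carrier A \<Longrightarrow> x \<in> carrier M \<Longrightarrow> y \<in> carrier N \<Longrightarrow>
    a \<odot>\<^bsub>tensor R M N\<^esub> pt x y = pt (a \<odot>\<^bsub>M\<^esub> x) y"
  unfolding smult_tensor_map
  using tensor_map_pt[OF tensor_factors_axioms tensor_factors_axioms smult_hom left_module_id_hom, of a x y]
  by simp

text \<open>For fixed scalars both sides of each module law are additive in t, so each law reduces
  to pure tensors, where it is the same law in \<open>M\<close>.\<close>

lemma tensor_left_module: "left_module A (tensor R M N)"
proof (rule left_moduleI)
  interpret L: left_module A M by (rule left)
  show "ring A" ..
  show "abelian_group (tensor R M N)"
    by (rule abelian_group_cong[OF tensor_abelian_group]) (simp_all add: tensor_simps)
  show "(\<lambda>t. a \<odot>\<^bsub>tensor R M N\<^esub> t) \<in> additive_hom (tensor R M N) (tensor R M N)" if "a \<in> carrier A" for a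
    using tensor_smult_additive[OF that]
    by (simp add: additive_hom_cong[OF tensor_simps(1) tensor_simps(3) tensor_simps(1) tensor_simps(3)])
  fix t assume "t \<in> carrier (tensor R M N)"
  then have t: "t \<in> carrier T" by (simp add: tensor_simps)
  show "\<one>\<^bsub>A\<^esub> \<odot>\<^bsub>tensor R M N\<^esub> t = t"
    by (rule additive_hom_eqI[OF tensor_abelian_group tensor_smult_additive additive_hom_id _ t])
      (simp_all add: tensor_smult_pt L.left_one)
  fix a b assume ab: "a \<in> carrier A" "b \<in> carrier A"
  show "(a \<oplus>\<^bsub>A\<^esub> b) \<odot>\<^bsub>tensor R M N\<^esub> t = a \<odot>\<^bsub>tensor R M N\<^esub> t \<oplus>\<^bsub>tensor R M N\<^esub> b \<odot>\<^bsub>tensor R M N\<^esub> t"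
    unfolding tensor_simps(3)
    by (rule additive_hom_eqI[OF tensor_abelian_group tensor_smult_additive
          additive_hom_add_fun[OF tensor_abelian_group tensor_smult_additive tensor_smult_additive] _ t])
      (use ab in \<open>simp_all add: tensor_smult_pt L.left_add_scalar pt_add_left L.left_closed\<close>)
  show "(a \<otimes>\<^bsub>A\<^esub> b) \<odot>\<^bsub>tensor R M N\<^esub> t = a \<odot>\<^bsub>tensor R M N\<^esub> (b \<odot>\<^bsub>tensor R M N\<^esub> t)"
    by (rule additive_hom_eqI[OF tensor_abelian_group tensor_smult_additive
          additive_hom_comp[OF tensor_smult_additive tensor_smult_additive] _ t])
      (use ab in \<open>simp_all add: tensor_smult_pt L.left_assoc L.left_closed\<close>)
qed

end

section \<open>Left modules over an algebra as right modules over the base ring\<close>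

lemma base_bimodule_simps:
  "carrier (base_bimodule A N) = carrier N" "add (base_bimodule A N) = add N"
  "\<zero>\<^bsub>base_bimodule A N\<^esub> = \<zero>\<^bsub>N\<^esub>" "a \<odot>\<^bsub>base_bimodule A N\<^esub> x = a \<odot>\<^bsub>N\<^esub> x"
  "rsmult (base_bimodule A N) x c = (c \<odot>\<^bsub>A\<^esub> \<one>\<^bsub>A\<^esub>) \<odot>\<^bsub>N\<^esub> x"
  by (simp_all add: base_bimodule_def module.defs bimodule.defs)

locale algebra_left_module = A: assoc_algebra K A + N: left_module A N
  for K :: "('k, 'u) ring_scheme" and A :: "('k, 'a) module" and N :: "('a, 'b) module"
begin

lemma base_abelian_group: "abelian_group (base_bimodule A N)"
  by (rule abelian_group_cong[OF left_module_abelian_group[OF N.left_module_axioms]])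
    (simp_all add: base_bimodule_simps)

lemma base_left_module: "left_module A (base_bimodule A N)"
  by (rule left_moduleI[OF A.ring_axioms base_abelian_group])
    (simp_all add: base_bimodule_simps additive_hom_def N.left_closed N.left_add N.left_add_scalar
      N.left_assoc N.left_one)

lemma scalar_closed: "c \<in> carrier K \<Longrightarrow> c \<odot>\<^bsub>A\<^esub> \<one>\<^bsub>A\<^esub> \<in> carrier A"
  by simp

lemma scalar_mult:
  assumes "c \<in> carrier K" "c' \<in> carrier K"
  shows "(c \<otimes>\<^bsub>K\<^esub> c') \<odot>\<^bsub>A\<^esub> \<one>\<^bsub>A\<^esub> = (c \<odot>\<^bsub>A\<^esub> \<one>\<^bsub>A\<^esub>) \<otimes>\<^bsub>A\<^esub> (c' \<odot>\<^bsub>A\<^esub> \<one>\<^bsub>A\<^esub>)"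
  using assms by (simp add: A.smult_mult_left A.smult_assoc1)

text \<open>Scalars pass through products on either side, so their images in \<open>A\<close> are
  central. This is the source of all compatibilities between the \<open>A\<close>-action and the
  \<open>K\<close>-action.\<close>

lemma scalar_commute:
  assumes "c \<in> carrier K" "a \<in> carrier A"
  shows "(c \<odot>\<^bsub>A\<^esub> \<one>\<^bsub>A\<^esub>) \<otimes>\<^bsub>A\<^esub> a = a \<otimes>\<^bsub>A\<^esub> (c \<odot>\<^bsub>A\<^esub> \<one>\<^bsub>A\<^esub>)"
  using assms by (simp add: A.smult_mult_left A.smult_mult_right)

lemma base_commute:
  assumes "a \<in> carrier A" "c \<in> carrier K" "x \<in> carrier N"
  shows "a \<odot>\<^bsub>N\<^esub> ((c \<odot>\<^bsub>A\<^esub> \<one>\<^bsub>A\<^esub>) \<odot>\<^bsub>N\<^esub> x) = (c \<odot>\<^bsub>A\<^esub> \<one>\<^bsub>A\<^esub>) \<odot>\<^bsub>N\<^esub> (a \<odot>\<^bsub>N\<^esub> x)"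
  using assms scalar_commute by (simp flip: N.left_assoc)

text \<open>Writing a left action on the right reverses products; associativity survives because the
  actions of two scalars commute, which is the instance of \<open>base_commute\<close>
  below.\<close>

lemma base_right_module: "right_module K (base_bimodule A N)"
proof (rule right_moduleI)
  show "ring K" by (rule A.R.ring_axioms)
  fix r s x assume rs: "r \<in> carrier K" "s \<in> carrier K" and x: "x \<in> carrier (base_bimodule A N)"
  show "rsmult (base_bimodule A N) x (r \<otimes>\<^bsub>K\<^esub> s)
      = rsmult (base_bimodule A N) (rsmult (base_bimodule A N) x r) s"
    using rs x base_commute[of "r \<odot>\<^bsub>A\<^esub> \<one>\<^bsub>A\<^esub>" s x]
    by (simp add: base_bimodule_simps scalar_mult[OF rs] N.left_assoc)
qed (auto simp: base_bimodule_simps additive_hom_def N.left_closed N.left_add A.smult_l_distr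
      N.left_add_scalar N.left_one base_abelian_group)

end

section \<open>Peirce decompositions\<close>

lemma pow_algebra_simps:
  "carrier (pow_algebra K p) = {1..p} \<rightarrow>\<^sub>E carrier K"
  "x \<otimes>\<^bsub>pow_algebra K p\<^esub> y = (\<lambda>i\<in>{1..p}. x i \<otimes>\<^bsub>K\<^esub> y i)"
  "\<one>\<^bsub>pow_algebra K p\<^esub> = (\<lambda>i\<in>{1..p}. \<one>\<^bsub>K\<^esub>)"
  "\<zero>\<^bsub>pow_algebra K p\<^esub> = (\<lambda>i\<in>{1..p}. \<zero>\<^bsub>K\<^esub>)"
  "x \<oplus>\<^bsub>pow_algebra K p\<^esub> y = (\<lambda>i\<in>{1..p}. x i \<oplus>\<^bsub>K\<^esub> y i)"
  "c \<odot>\<^bsub>pow_algebra K p\<^esub> x = (\<lambda>i\<in>{1..p}. c \<otimes>\<^bsub>K\<^esub> x i)"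
  by (simp_all add: pow_algebra_def)

lemma pow_algebra_entry_closed:
  "x \<in> carrier (pow_algebra K p) \<Longrightarrow> i \<in> {1..p} \<Longrightarrow> x i \<in> carrier K"
  by (auto simp: pow_algebra_simps)

lemma pow_algebra_entry:
  assumes "i \<in> {1..p}"
  shows "(x \<otimes>\<^bsub>pow_algebra K p\<^esub> y) i = x i \<otimes>\<^bsub>K\<^esub> y i"
    "\<one>\<^bsub>pow_algebra K p\<^esub> i = \<one>\<^bsub>K\<^esub>" "\<zero>\<^bsub>pow_algebra K p\<^esub> i = \<zero>\<^bsub>K\<^esub>"
    "(x \<oplus>\<^bsub>pow_algebra K p\<^esub> y) i = x i \<oplus>\<^bsub>K\<^esub> y i"
    "(c \<odot>\<^bsub>pow_algebra K p\<^esub> x) i = c \<otimes>\<^bsub>K\<^esub> x i"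
  using assms by (auto simp: pow_algebra_simps)

lemma pow_algebra_eqI:
  assumes "x \<in> carrier (pow_algebra K p)" "y \<in> carrier (pow_algebra K p)"
    and "\<And>i. i \<in> {1..p} \<Longrightarrow> x i = y i"
  shows "x = y"
  using assms unfolding pow_algebra_simps by (rule PiE_ext)

lemma pow_algebra_closed:
  assumes "ring K"
  shows "x \<in> carrier (pow_algebra K p) \<Longrightarrow> y \<in> carrier (pow_algebra K p) \<Longrightarrow>
      x \<otimes>\<^bsub>pow_algebra K p\<^esub> y \<in> carrier (pow_algebra K p)"
    "\<one>\<^bsub>pow_algebra K p\<^esub> \<in> carrier (pow_algebra K p)" "\<zero>\<^bsub>pow_algebra K p\<^esub> \<in> carrier (pow_algebra K p)"
    "x \<in> carrier (pow_algebra K p) \<Longrightarrow> y \<in> carrier (pow_algebra K p) \<Longrightarrow>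
      x \<oplus>\<^bsub>pow_algebra K p\<^esub> y \<in> carrier (pow_algebra K p)"
    "c \<in> carrier K \<Longrightarrow> x \<in> carrier (pow_algebra K p) \<Longrightarrow>
      c \<odot>\<^bsub>pow_algebra K p\<^esub> x \<in> carrier (pow_algebra K p)"
  unfolding pow_algebra_simps restrict_PiE_iff
  using ring.ring_simprules(1,2,5,6)[OF assms] PiE_mem[of _ "{1..p}" "\<lambda>_. carrier K"] by simp_all

lemma pow_algebra_assoc_algebra:
  assumes "cring K"
  shows "assoc_algebra K (pow_algebra K p)"
proof -
  interpret K: cring K by fact
  note cl = pow_algebra_closed[OF K.ring_axioms] and en = pow_algebra_entry pow_algebra_entry_closed
  have ab: "abelian_group (pow_algebra K p)"
  proof (rule abelian_groupI)
    fix x assume x: "x \<in> carrier (pow_algebra K p)"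
    show "\<exists>y \<in> carrier (pow_algebra K p). y \<oplus>\<^bsub>pow_algebra K p\<^esub> x = \<zero>\<^bsub>pow_algebra K p\<^esub>"
    proof
      let ?y = "\<lambda>i\<in>{1..p}. \<ominus>\<^bsub>K\<^esub> x i"
      have xi: "x i \<in> carrier K" if "i \<in> {1..p}" for i
        by (rule pow_algebra_entry_closed[OF x that])
      show "?y \<oplus>\<^bsub>pow_algebra K p\<^esub> x = \<zero>\<^bsub>pow_algebra K p\<^esub>"
        unfolding pow_algebra_simps by (rule restrict_ext) (simp only: restrict_apply if_True K.l_neg[OF xi])
      show "?y \<in> carrier (pow_algebra K p)" using xi by (simp add: pow_algebra_simps)
    qed
  qed ((rule cl; assumption) | (rule pow_algebra_eqI[where K = K and p = p]; simp add: cl en K.a_ac))+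
  have mon: "Group.monoid (pow_algebra K p)"
    by (rule monoidI; ((rule cl; assumption) | (rule pow_algebra_eqI[where K = K and p = p]; simp add: cl en K.m_assoc)))
  have ring: "ring (pow_algebra K p)"
    by (rule ringI[OF ab mon]; (rule pow_algebra_eqI[where K = K and p = p]; simp add: cl en K.l_distr K.r_distr))
  have mod: "module K (pow_algebra K p)"
    by (rule moduleI[OF assms ab]; ((rule cl; assumption) |
        (rule pow_algebra_eqI[where K = K and p = p]; simp add: cl en K.l_distr K.r_distr K.m_assoc)))
  show ?thesis
    by (rule assoc_algebra.intro[OF mod ring], rule assoc_algebra_axioms.intro;
        (rule pow_algebra_eqI[where K = K and p = p]; simp add: cl en K.m_assoc K.m_lcomm))
qed

lemma std_idem_closed: "ring K \<Longrightarrow> std_idem K p i \<in> carrier (pow_algebra K p)"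
  by (auto simp: std_idem_def pow_algebra_simps ring.ring_simprules)

lemma std_idem_mult:
  "ring K \<Longrightarrow> std_idem K p i \<otimes>\<^bsub>pow_algebra K p\<^esub> std_idem K p j =
    (if i = j then std_idem K p i else \<zero>\<^bsub>pow_algebra K p\<^esub>)"
  by (auto simp: std_idem_def pow_algebra_simps ring.ring_simprules intro!: restrict_ext)

locale pointed_algebra = S: assoc_algebra K S
  for K :: "('k, 'u) ring_scheme" and S :: "('k, 's) module" +
  fixes p :: nat and f :: "(nat \<Rightarrow> 'k) \<Rightarrow> 's"
  assumes f_hom: "f \<in> algebra_hom K (pow_algebra K p) S"
begin

sublocale pow: assoc_algebra K "pow_algebra K p"
  by (rule pow_algebra_assoc_algebra[OF S.R.cring_axioms])

definition e where "e i = f (std_idem K p i)"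

lemma f_ring_hom: "f \<in> ring_hom (pow_algebra K p) S"
  using f_hom by (simp add: algebra_hom_def)

lemma f_additive: "f \<in> additive_hom (pow_algebra K p) S"
  using f_ring_hom by (auto simp: additive_hom_def ring_hom_def)

lemma f_zero: "f \<zero>\<^bsub>pow_algebra K p\<^esub> = \<zero>\<^bsub>S\<^esub>"
  by (rule additive_hom_zero[OF pow.abelian_group_axioms S.abelian_group_axioms f_additive])

lemma e_closed [simp, intro]: "e i \<in> carrier S"
  unfolding e_def using f_ring_hom std_idem_closed[OF S.R.ring_axioms] by (rule ring_hom_closed)

lemma e_mult: "e i \<otimes>\<^bsub>S\<^esub> e j = (if i = j then e i else \<zero>\<^bsub>S\<^esub>)"
  unfolding e_def
  by (simp flip: ring_hom_mult[OF f_ring_hom] add: std_idem_closed[OF S.R.ring_axioms]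
      std_idem_mult[OF S.R.ring_axioms] f_zero)

lemma e_idem: "e i \<otimes>\<^bsub>S\<^esub> e i = e i" by (simp add: e_mult)

lemma e_idem_left: "s \<in> carrier S \<Longrightarrow> e i \<otimes>\<^bsub>S\<^esub> (e i \<otimes>\<^bsub>S\<^esub> s) = e i \<otimes>\<^bsub>S\<^esub> s"
  by (simp add: S.m_assoc[symmetric] e_idem)

lemma e_idem_right: "s \<in> carrier S \<Longrightarrow> s \<otimes>\<^bsub>S\<^esub> e i \<otimes>\<^bsub>S\<^esub> e i = s \<otimes>\<^bsub>S\<^esub> e i"
  by (simp add: S.m_assoc e_idem)

text \<open>The sum is compared with the image under \<open>f\<close> of an indicator function: by
  induction on q, the first q idempotents add up to the image of the indicator of {1..q}, and for q
  = p that indicator is the unit of the power algebra.\<close>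

lemma e_sum: "(\<Oplus>\<^bsub>S\<^esub>i\<in>{1..p}. e i) = \<one>\<^bsub>S\<^esub>"
proof -
  let ?u = "\<lambda>q. \<lambda>i\<in>{1..p}. if i \<le> q then \<one>\<^bsub>K\<^esub> else \<zero>\<^bsub>K\<^esub>"
  have u: "?u q \<in> carrier (pow_algebra K p)" for q by (auto simp: pow_algebra_simps)
  have "q \<le> p \<Longrightarrow> (\<Oplus>\<^bsub>S\<^esub>i\<in>{1..q}. e i) = f (?u q)" for q
  proof (induction q)
    case 0
    have "?u 0 = \<zero>\<^bsub>pow_algebra K p\<^esub>" by (auto simp: pow_algebra_simps)
    then show ?case using f_zero by simp
  next
    case (Suc q)
    have "(\<Oplus>\<^bsub>S\<^esub>i\<in>{1..Suc q}. e i) = e (Suc q) \<oplus>\<^bsub>S\<^esub> (\<Oplus>\<^bsub>S\<^esub>i\<in>{1..q}. e i)"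
      by (simp add: atLeastAtMostSuc_conv)
    also have "\<dots> = f (std_idem K p (Suc q) \<oplus>\<^bsub>pow_algebra K p\<^esub> ?u q)"
      unfolding Suc.IH[OF Suc_leD[OF Suc.prems]] unfolding e_def
      using additive_hom_add[OF f_additive std_idem_closed[OF S.R.ring_axioms] u, of "Suc q" q] by (simp only:)
    also have "std_idem K p (Suc q) \<oplus>\<^bsub>pow_algebra K p\<^esub> ?u q = ?u (Suc q)"
      by (auto simp: pow_algebra_simps std_idem_def intro!: restrict_ext)
    finally show ?case .
  qed
  moreover have "?u p = \<one>\<^bsub>pow_algebra K p\<^esub>" by (auto simp: pow_algebra_simps intro!: restrict_ext)
  ultimately show ?thesis using ring_hom_one[OF f_ring_hom] by simp
qed

abbreviation pc where "pc i j \<equiv> peirce K p S f i j"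

lemma peirce_simps:
  "add (pc i j) = add S" "\<zero>\<^bsub>pc i j\<^esub> = \<zero>\<^bsub>S\<^esub>" "smult (pc i j) = smult S"
  by (simp_all add: peirce_def)

lemma peirce_compress: "s \<in> carrier S \<Longrightarrow> e i \<otimes>\<^bsub>S\<^esub> s \<otimes>\<^bsub>S\<^esub> e j \<in> carrier (pc i j)"
  by (auto simp: peirce_def e_def)

text \<open>Idempotency turns the existential description of a corner into fixed-point equations,
  which are preserved by sums, negatives and scalars without any choice of witnesses.\<close>

lemma peirce_carrier: "carrier (pc i j) = {s \<in> carrier S. e i \<otimes>\<^bsub>S\<^esub> s = s \<and> s \<otimes>\<^bsub>S\<^esub> e j = s}"
proof (rule Set.set_eqI, rule iffI)
  fix s assume "s \<in> carrier (pc i j)"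
  then obtain t where t: "t \<in> carrier S" "s = e i \<otimes>\<^bsub>S\<^esub> t \<otimes>\<^bsub>S\<^esub> e j" by (auto simp: peirce_def e_def)
  then show "s \<in> {s \<in> carrier S. e i \<otimes>\<^bsub>S\<^esub> s = s \<and> s \<otimes>\<^bsub>S\<^esub> e j = s}"
    by (simp add: S.m_assoc e_idem e_idem_left)
next
  fix s assume s: "s \<in> {s \<in> carrier S. e i \<otimes>\<^bsub>S\<^esub> s = s \<and> s \<otimes>\<^bsub>S\<^esub> e j = s}"
  then show "s \<in> carrier (pc i j)" using peirce_compress[of s i j] by simp
qed

lemma peirce_left_module: "left_module K (pc i j)"
proof -
  have ab: "abelian_group (pc i j)"
  proof (rule abelian_groupI)
    fix x assume "x \<in> carrier (pc i j)"
    then show "\<exists>y \<in> carrier (pc i j). y \<oplus>\<^bsub>pc i j\<^esub> x = \<zero>\<^bsub>pc i j\<^esub>"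
      by (intro bexI[of _ "\<ominus>\<^bsub>S\<^esub> x"]) (auto simp: peirce_carrier peirce_simps S.l_neg S.r_minus S.l_minus)
  qed (auto simp: peirce_carrier peirce_simps S.r_distr S.l_distr S.a_ac)
  show ?thesis
    by (rule left_moduleI[OF S.R.ring_axioms ab])
      (auto simp: additive_hom_def peirce_carrier peirce_simps S.smult_mult_left S.smult_mult_right
        S.smult_l_distr S.smult_r_distr S.smult_assoc1)
qed

lemma sum_compress:
  assumes "s \<in> carrier S"
  shows "(\<Oplus>\<^bsub>S\<^esub>i\<in>{1..p}. s \<otimes>\<^bsub>S\<^esub> e i) = s"
  using assms e_sum S.finsum_rdistr[of "{1..p}" s e] by simp

end

section \<open>Modules of matrices\<close>

locale matrix_bimodule = pointed_algebra K S p f + A: assoc_algebra K A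
  for K :: "('k, 'u) ring_scheme" and A :: "('k, 'a) module" and p :: nat
    and S :: "('k, 's) module" and f :: "(nat \<Rightarrow> 'k) \<Rightarrow> 's"
    and N :: "nat \<Rightarrow> ('a, 'b) module" +
  assumes N_left_module: "i \<in> {1..p} \<Longrightarrow> left_module A (N i)"
begin

abbreviation "I \<equiv> {1..p}"
abbreviation "B i \<equiv> base_bimodule A (N i)"
abbreviation "E i j \<equiv> mat_entry K A p S f N i j"
abbreviation "pe i j \<equiv> pure_tensor K (B i) (pc i j)"
abbreviation "MM \<equiv> mat_module K A p S f N"

lemma N_algebra_left_module: "i \<in> I \<Longrightarrow> algebra_left_module K A (N i)"
  by (simp add: algebra_left_module_def A.assoc_algebra_axioms N_left_module)

lemma entry_tensor_factors: "i \<in> I \<Longrightarrow> tensor_factors K (B i) (pc i j)"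
  by (simp add: tensor_factors_def peirce_left_module
      algebra_left_module.base_right_module[OF N_algebra_left_module])

lemma entry_tensor_bimodule_factors: "i \<in> I \<Longrightarrow> tensor_bimodule_factors K (B i) (pc i j) A"
  unfolding tensor_bimodule_factors_def tensor_bimodule_factors_axioms_def
  using entry_tensor_factors algebra_left_module.base_left_module[OF N_algebra_left_module]
    algebra_left_module.base_commute[OF N_algebra_left_module]
  by (simp add: base_bimodule_simps)

lemma entry_simps:
  "carrier (tensor_group K (B i) (pc i j)) = carrier (E i j)"
  "\<zero>\<^bsub>tensor_group K (B i) (pc i j)\<^esub> = \<zero>\<^bsub>E i j\<^esub>"
  "add (tensor_group K (B i) (pc i j)) = add (E i j)"
  by (simp_all add: mat_entry_def tensor_simps)

lemma entry_left_module: "i \<in> I \<Longrightarrow> left_module A (E i j)"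
  unfolding mat_entry_def
  by (rule tensor_bimodule_factors.tensor_left_module[OF entry_tensor_bimodule_factors])

lemma entry_abelian_group: "i \<in> I \<Longrightarrow> abelian_group (E i j)"
  by (rule left_module_abelian_group[OF entry_left_module])

lemma pe_closed: "i \<in> I \<Longrightarrow> n \<in> carrier (N i) \<Longrightarrow> s \<in> carrier (pc i j) \<Longrightarrow> pe i j n s \<in> carrier (E i j)"
  using tensor_factors.pt_closed[OF entry_tensor_factors] by (simp add: entry_simps base_bimodule_simps)

lemma pe_add_left:
  "i \<in> I \<Longrightarrow> n \<in> carrier (N i) \<Longrightarrow> n' \<in> carrier (N i) \<Longrightarrow> s \<in> carrier (pc i j) \<Longrightarrow>
    pe i j (n \<oplus>\<^bsub>N i\<^esub> n') s = pe i j n s \<oplus>\<^bsub>E i j\<^esub> pe i j n' s"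
  using tensor_factors.pt_add_left[OF entry_tensor_factors, of i n n' s j]
  by (simp add: entry_simps base_bimodule_simps)

lemma pe_add_right:
  "i \<in> I \<Longrightarrow> n \<in> carrier (N i) \<Longrightarrow> s \<in> carrier (pc i j) \<Longrightarrow> s' \<in> carrier (pc i j) \<Longrightarrow>
    pe i j n (s \<oplus>\<^bsub>S\<^esub> s') = pe i j n s \<oplus>\<^bsub>E i j\<^esub> pe i j n s'"
  using tensor_factors.pt_add_right[OF entry_tensor_factors, of i n s j s']
  by (simp add: entry_simps base_bimodule_simps peirce_simps)

lemma pe_scalar:
  "i \<in> I \<Longrightarrow> n \<in> carrier (N i) \<Longrightarrow> c \<in> carrier K \<Longrightarrow> s \<in> carrier (pc i j) \<Longrightarrow>
    pe i j ((c \<odot>\<^bsub>A\<^esub> \<one>\<^bsub>A\<^esub>) \<odot>\<^bsub>N i\<^esub> n) s = pe i j n (c \<odot>\<^bsub>S\<^esub> s)"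
  using tensor_factors.pt_smult[OF entry_tensor_factors, of i n c s j]
  by (simp add: base_bimodule_simps peirce_simps)

lemma entry_induct [consumes 2, case_names zero add pure]:
  assumes "i \<in> I" "t \<in> carrier (E i j)" "P \<zero>\<^bsub>E i j\<^esub>"
    and "\<And>s t. s \<in> carrier (E i j) \<Longrightarrow> t \<in> carrier (E i j) \<Longrightarrow> P s \<Longrightarrow> P t \<Longrightarrow> P (s \<oplus>\<^bsub>E i j\<^esub> t)"
    and "\<And>n s. n \<in> carrier (N i) \<Longrightarrow> s \<in> carrier (pc i j) \<Longrightarrow> P (pe i j n s)"
  shows "P t"
  using tensor_factors.tensor_induct[OF entry_tensor_factors[OF assms(1), of j], of t P] assms(2-)
  by (simp add: entry_simps base_bimodule_simps)

lemma pe_additive_right: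
  "i \<in> I \<Longrightarrow> n \<in> carrier (N i) \<Longrightarrow> pe i j n \<in> additive_hom (pc i j) (E i j)"
  by (rule additive_homI) (simp_all add: pe_closed pe_add_right peirce_simps)

lemma pe_zero_right: "i \<in> I \<Longrightarrow> n \<in> carrier (N i) \<Longrightarrow> pe i j n \<zero>\<^bsub>S\<^esub> = \<zero>\<^bsub>E i j\<^esub>"
  using additive_hom_zero[OF left_module_abelian_group[OF peirce_left_module] entry_abelian_group
      pe_additive_right] by (simp add: peirce_simps)

lemma MM_simps:
  "carrier MM = (\<Pi>\<^sub>E (i, j) \<in> I \<times> I. carrier (E i j))"
  "\<zero>\<^bsub>MM\<^esub> = (\<lambda>(i, j) \<in> I \<times> I. \<zero>\<^bsub>E i j\<^esub>)"
  "x \<oplus>\<^bsub>MM\<^esub> y = (\<lambda>(i, j) \<in> I \<times> I. x (i, j) \<oplus>\<^bsub>E i j\<^esub> y (i, j))"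
  "a \<odot>\<^bsub>MM\<^esub> x = (\<lambda>(i, j) \<in> I \<times> I. a \<odot>\<^bsub>E i j\<^esub> x (i, j))"
  by (simp_all add: mat_module_def)

lemma MM_entry: "x \<in> carrier MM \<Longrightarrow> i \<in> I \<Longrightarrow> j \<in> I \<Longrightarrow> x (i, j) \<in> carrier (E i j)"
  by (force simp: MM_simps PiE_def Pi_def)

lemma MM_memI:
  "(\<And>i j. i \<in> I \<Longrightarrow> j \<in> I \<Longrightarrow> x i j \<in> carrier (E i j)) \<Longrightarrow> (\<lambda>(i, j) \<in> I \<times> I. x i j) \<in> carrier MM"
  by (auto simp: MM_simps)

lemma MM_eqI:
  assumes "x \<in> carrier MM" "y \<in> carrier MM" "\<And>i j. i \<in> I \<Longrightarrow> j \<in> I \<Longrightarrow> x (i, j) = y (i, j)"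
  shows "x = y"
  using assms unfolding MM_simps by (intro PiE_ext) auto

lemma MM_add_entry: "i \<in> I \<Longrightarrow> j \<in> I \<Longrightarrow> (x \<oplus>\<^bsub>MM\<^esub> y) (i, j) = x (i, j) \<oplus>\<^bsub>E i j\<^esub> y (i, j)"
  by (simp add: MM_simps)

lemma MM_zero_entry: "i \<in> I \<Longrightarrow> j \<in> I \<Longrightarrow> \<zero>\<^bsub>MM\<^esub> (i, j) = \<zero>\<^bsub>E i j\<^esub>"
  by (simp add: MM_simps)

lemma MM_add_closed: "x \<in> carrier MM \<Longrightarrow> y \<in> carrier MM \<Longrightarrow> x \<oplus>\<^bsub>MM\<^esub> y \<in> carrier MM"
  unfolding MM_simps(3)
  by (rule MM_memI) (simp add: MM_entry abelian_groupE(1)[OF entry_abelian_group])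

lemma MM_zero_closed: "\<zero>\<^bsub>MM\<^esub> \<in> carrier MM"
  unfolding MM_simps(2)
  by (rule MM_memI) (simp add: abelian_groupE(2)[OF entry_abelian_group])

lemma MM_abelian_group: "abelian_group MM"
proof (rule abelian_groupI)
  fix x assume x: "x \<in> carrier MM"
  let ?y = "\<lambda>(i, j) \<in> I \<times> I. \<ominus>\<^bsub>E i j\<^esub> x (i, j)"
  have y: "?y \<in> carrier MM"
    by (rule MM_memI) (simp add: MM_entry[OF x] abelian_group.a_inv_closed[OF entry_abelian_group])
  have "?y \<oplus>\<^bsub>MM\<^esub> x = \<zero>\<^bsub>MM\<^esub>"
    by (rule MM_eqI[OF MM_add_closed[OF y x] MM_zero_closed])
      (simp add: MM_add_entry MM_zero_entry MM_entry[OF x] abelian_group.l_neg[OF entry_abelian_group])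
  then show "\<exists>y \<in> carrier MM. y \<oplus>\<^bsub>MM\<^esub> x = \<zero>\<^bsub>MM\<^esub>" using y by blast
next
  fix x y z assume xyz: "x \<in> carrier MM" "y \<in> carrier MM" "z \<in> carrier MM"
  show "x \<oplus>\<^bsub>MM\<^esub> y \<oplus>\<^bsub>MM\<^esub> z = x \<oplus>\<^bsub>MM\<^esub> (y \<oplus>\<^bsub>MM\<^esub> z)"
    by (rule MM_eqI) (use xyz in \<open>simp_all add: MM_add_closed MM_add_entry MM_entry
        abelian_groupE(3)[OF entry_abelian_group]\<close>)
next
  fix x y assume xy: "x \<in> carrier MM" "y \<in> carrier MM"
  show "x \<oplus>\<^bsub>MM\<^esub> y = y \<oplus>\<^bsub>MM\<^esub> x"
    by (rule MM_eqI) (use xy in \<open>simp_all add: MM_add_closed MM_add_entry MM_entry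
        abelian_groupE(4)[OF entry_abelian_group]\<close>)
next
  fix x assume x: "x \<in> carrier MM"
  show "\<zero>\<^bsub>MM\<^esub> \<oplus>\<^bsub>MM\<^esub> x = x"
    by (rule MM_eqI) (use x in \<open>simp_all add: MM_add_closed MM_zero_closed MM_add_entry MM_zero_entry
        MM_entry abelian_groupE(5)[OF entry_abelian_group]\<close>)
qed (simp_all add: MM_add_closed MM_zero_closed)

sublocale MM: abelian_group MM by (rule MM_abelian_group)

text \<open>The element \<open>(n \<otimes> e\<^sub>i s e\<^sub>j)\<^sub>j\<close> of the \<open>i\<close>-th row.  In contrast to single entries, rows are mapped to
  rows by right multiplication, and they still generate the module additively.\<close>

definition row where
  "row i n s = (\<lambda>(k, j) \<in> I \<times> I. if k = i then pe i j n (e i \<otimes>\<^bsub>S\<^esub> s \<otimes>\<^bsub>S\<^esub> e j) else \<zero>\<^bsub>E k j\<^esub>)"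

lemma row_entry:
  "k \<in> I \<Longrightarrow> j \<in> I \<Longrightarrow> row i n s (k, j) =
    (if k = i then pe i j n (e i \<otimes>\<^bsub>S\<^esub> s \<otimes>\<^bsub>S\<^esub> e j) else \<zero>\<^bsub>E k j\<^esub>)"
  by (simp add: row_def)

lemma row_closed: "i \<in> I \<Longrightarrow> n \<in> carrier (N i) \<Longrightarrow> s \<in> carrier S \<Longrightarrow> row i n s \<in> carrier MM"
  unfolding row_def
  by (rule MM_memI) (auto intro: pe_closed peirce_compress abelian_groupE(2)[OF entry_abelian_group])

lemma row_add_left:
  assumes "i \<in> I" "n \<in> carrier (N i)" "n' \<in> carrier (N i)" "s \<in> carrier S"
  shows "row i (n \<oplus>\<^bsub>N i\<^esub> n') s = row i n s \<oplus>\<^bsub>MM\<^esub> row i n' s"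
proof -
  have c: "n \<oplus>\<^bsub>N i\<^esub> n' \<in> carrier (N i)"
    using assms by (simp add: abelian_groupE(1)[OF left_module_abelian_group[OF N_left_module]])
  show ?thesis
    by (rule MM_eqI) (use assms c in \<open>auto simp: row_closed MM_add_entry row_entry pe_add_left
        peirce_compress abelian_groupE(2,5)[OF entry_abelian_group]\<close>)
qed

lemma row_add_right:
  assumes "i \<in> I" "n \<in> carrier (N i)" "s \<in> carrier S" "s' \<in> carrier S"
  shows "row i n (s \<oplus>\<^bsub>S\<^esub> s') = row i n s \<oplus>\<^bsub>MM\<^esub> row i n s'"
  by (rule MM_eqI) (use assms in \<open>auto simp: row_closed MM_add_entry row_entry pe_add_right[symmetric]
        S.r_distr S.l_distr peirce_compress abelian_groupE(2,5)[OF entry_abelian_group]\<close>)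

lemma row_scalar:
  assumes "i \<in> I" "n \<in> carrier (N i)" "c \<in> carrier K" "s \<in> carrier S"
  shows "row i ((c \<odot>\<^bsub>A\<^esub> \<one>\<^bsub>A\<^esub>) \<odot>\<^bsub>N i\<^esub> n) s = row i n (c \<odot>\<^bsub>S\<^esub> s)"
proof -
  have c: "(c \<odot>\<^bsub>A\<^esub> \<one>\<^bsub>A\<^esub>) \<odot>\<^bsub>N i\<^esub> n \<in> carrier (N i)"
    using assms by (simp add: left_module.left_closed[OF N_left_module])
  show ?thesis
    by (rule MM_eqI) (use assms c in \<open>auto simp: row_closed row_entry pe_scalar peirce_compress
        S.smult_mult_left S.smult_mult_right\<close>)
qed

lemma row_e: "i \<in> I \<Longrightarrow> s \<in> carrier S \<Longrightarrow> row i n (e i \<otimes>\<^bsub>S\<^esub> s) = row i n s"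
  by (simp only: row_def e_idem_left)

lemma row_additive_left: "i \<in> I \<Longrightarrow> s \<in> carrier S \<Longrightarrow> (\<lambda>n. row i n s) \<in> additive_hom (N i) MM"
  by (rule additive_homI) (simp_all add: row_closed row_add_left)

lemma row_additive_right: "i \<in> I \<Longrightarrow> n \<in> carrier (N i) \<Longrightarrow> row i n \<in> additive_hom S MM"
  by (rule additive_homI) (simp_all add: row_closed row_add_right)

text \<open>Single entries serve only to derive the induction over rows: additivity in one entry is
  easy to express with them.\<close>

definition single where
  "single i j t = (\<lambda>(k, l) \<in> I \<times> I. if k = i \<and> l = j then t else \<zero>\<^bsub>E k l\<^esub>)"

lemma single_closed: "i \<in> I \<Longrightarrow> t \<in> carrier (E i j) \<Longrightarrow> single i j t \<in> carrier MM"
  unfolding single_def by (rule MM_memI) (auto intro: abelian_groupE(2)[OF entry_abelian_group])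

lemma single_entry:
  "k \<in> I \<Longrightarrow> l \<in> I \<Longrightarrow> single i j t (k, l) = (if k = i \<and> l = j then t else \<zero>\<^bsub>E k l\<^esub>)"
  by (simp add: single_def)

text \<open>If s lies in the corner (i, j), then s e_l = s e_j e_l is 0 for l different from j, so
  the row of s has no other nonzero entry.\<close>

lemma single_pe:
  assumes "i \<in> I" "n \<in> carrier (N i)" "s \<in> carrier (pc i j)"
  shows "single i j (pe i j n s) = row i n s"
proof -
  have s: "s \<in> carrier S" "e i \<otimes>\<^bsub>S\<^esub> s = s" "s \<otimes>\<^bsub>S\<^esub> e j = s" using assms by (auto simp: peirce_carrier)
  have "s \<otimes>\<^bsub>S\<^esub> e l = (if l = j then s else \<zero>\<^bsub>S\<^esub>)" for l
  proof -
    have "s \<otimes>\<^bsub>S\<^esub> e j \<otimes>\<^bsub>S\<^esub> e l = s \<otimes>\<^bsub>S\<^esub> (e j \<otimes>\<^bsub>S\<^esub> e l)" using s(1) by (intro S.m_assoc) auto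
    then show ?thesis unfolding s(3) using s(1,3) by (auto simp: e_mult)
  qed
  then show ?thesis
    by (intro MM_eqI) (use assms s(1) in \<open>simp_all add: single_closed pe_closed row_closed single_entry
        row_entry s(2) pe_zero_right\<close>)
qed

text \<open>A matrix is the sum of its entries, an entry is a sum of pure tensors, and a matrix with
  one pure entry is a row by \<open>single_pe\<close>. Rows therefore generate additively.\<close>

lemma MM_induct [consumes 1, case_names zero add row]:
  assumes x: "x \<in> carrier MM"
    and zero: "P \<zero>\<^bsub>MM\<^esub>"
    and add: "\<And>x y. x \<in> carrier MM \<Longrightarrow> y \<in> carrier MM \<Longrightarrow> P x \<Longrightarrow> P y \<Longrightarrow> P (x \<oplus>\<^bsub>MM\<^esub> y)"
    and row: "\<And>i n s. i \<in> I \<Longrightarrow> n \<in> carrier (N i) \<Longrightarrow> s \<in> carrier S \<Longrightarrow> P (row i n s)"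
  shows "P x"
proof -
  have single: "P (single i j t)" if "i \<in> I" "t \<in> carrier (E i j)" for i j t
    using that
  proof (induction rule: entry_induct)
    case zero
    have "single i j \<zero>\<^bsub>E i j\<^esub> = \<zero>\<^bsub>MM\<^esub>"
      by (rule MM_eqI) (use that(1) in \<open>simp_all add: single_closed MM_zero_closed single_entry MM_zero_entry
          abelian_groupE(2)[OF entry_abelian_group]\<close>)
    then show ?case using \<open>P \<zero>\<^bsub>MM\<^esub>\<close> by simp
  next
    case (add s t)
    have "single i j (s \<oplus>\<^bsub>E i j\<^esub> t) = single i j s \<oplus>\<^bsub>MM\<^esub> single i j t"
      by (rule MM_eqI) (use that(1) add(1,2) in \<open>simp_all add: single_closed MM_add_closed single_entry
          MM_add_entry abelian_groupE(1,2,5)[OF entry_abelian_group]\<close>)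
    then show ?case using add that(1) \<open>\<And>x y. _ \<Longrightarrow> _ \<Longrightarrow> P x \<Longrightarrow> P y \<Longrightarrow> _\<close> single_closed by simp
  next
    case (pure n s)
    then show ?case using that(1) row single_pe by (auto simp: peirce_carrier)
  qed
  \<comment> \<open>The induction runs over a finite set of positions outside which the matrix
    vanishes.\<close>
  have "P x" if "finite F" "F \<subseteq> I \<times> I" "x \<in> carrier MM"
    "\<And>i j. (i, j) \<in> I \<times> I - F \<Longrightarrow> x (i, j) = \<zero>\<^bsub>E i j\<^esub>" for F x
    using that
  proof (induction F arbitrary: x rule: finite_induct)
    case empty
    have "x = \<zero>\<^bsub>MM\<^esub>" by (rule MM_eqI) (use empty in \<open>auto simp: MM_zero_entry\<close>)
    then show ?case using zero by simp
  next
    case (insert q F)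
    obtain k l where q: "q = (k, l)" by (cases q)
    have kl: "k \<in> I" "l \<in> I" using insert.prems(1) q by auto
    \<comment> \<open>The matrix with the entry at q erased; it vanishes outside the smaller set and
      differs from x by a single entry.\<close>
    define x' where "x' = (\<lambda>(i, j) \<in> I \<times> I. if (i, j) = q then \<zero>\<^bsub>E i j\<^esub> else x (i, j))"
    have x'_entry: "x' (i, j) = (if (i, j) = q then \<zero>\<^bsub>E i j\<^esub> else x (i, j))"
      if "i \<in> I" "j \<in> I" for i j
      using that by (simp add: x'_def)
    have x': "x' \<in> carrier MM"
      unfolding x'_def by (rule MM_memI) (auto simp: MM_entry[OF insert.prems(2)] intro: abelian_groupE(2)[OF entry_abelian_group])
    have "P x'"
      using insert.prems x' by (intro insert.IH) (auto simp: x'_entry)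
    moreover have "P (single k l (x (k, l)))"
      by (rule single[OF kl(1) MM_entry[OF insert.prems(2) kl]])
    moreover have "x = single k l (x (k, l)) \<oplus>\<^bsub>MM\<^esub> x'"
      by (rule MM_eqI[OF insert.prems(2)])
        (use x' kl q in \<open>simp_all add: MM_add_closed single_closed MM_entry[OF insert.prems(2)] MM_add_entry
          single_entry x'_entry abelian_monoid.r_zero[OF abelian_group.axioms(1)[OF entry_abelian_group]] abelian_groupE(5)[OF entry_abelian_group]\<close>)
    ultimately show ?case
      using add[OF single_closed[OF kl(1) MM_entry[OF insert.prems(2) kl]] x'] by simp
  qed
  from this[of "I \<times> I"] x show ?thesis by simp
qed

text \<open>The counterpart of \<open>additive_hom_eqI\<close> for matrices: every identity between
  additive maps on a module of matrices is tested on rows.\<close>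

lemma row_eqI:
  assumes "abelian_group P" "h \<in> additive_hom MM P" "h' \<in> additive_hom MM P"
    and "\<And>i n s. i \<in> I \<Longrightarrow> n \<in> carrier (N i) \<Longrightarrow> s \<in> carrier S \<Longrightarrow> h (row i n s) = h' (row i n s)"
    and "x \<in> carrier MM"
  shows "h x = h' x"
  using assms(5)
proof (induction rule: MM_induct)
  case zero
  show ?case by (simp only: additive_hom_zero[OF MM_abelian_group assms(1)] assms(2,3))
next
  case (add x y)
  then show ?case
    by (simp only: additive_hom_add[OF assms(2) add(1,2)] additive_hom_add[OF assms(3) add(1,2)])
qed (rule assms(4))

end

lemma additive_hom_finsum:
  assumes P: "abelian_group P" and Q: "abelian_group Q" and h: "h \<in> additive_hom P Q"
    and fin: "finite J" and x: "\<And>j. j \<in> J \<Longrightarrow> x j \<in> carrier P"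
  shows "h (\<Oplus>\<^bsub>P\<^esub>j\<in>J. x j) = (\<Oplus>\<^bsub>Q\<^esub>j\<in>J. h (x j))"
proof -
  interpret P: abelian_group P by (rule P)
  interpret Q: abelian_group Q by (rule Q)
  show ?thesis
    using fin x
  proof (induction J rule: finite_induct)
    case empty
    then show ?case using additive_hom_zero[OF P Q h] by simp
  next
    case (insert j J)
    then have "x j \<in> carrier P" "x \<in> J \<rightarrow> carrier P" "(\<lambda>j. h (x j)) \<in> J \<rightarrow> carrier Q" "h (x j) \<in> carrier Q"
      using additive_hom_closed[OF h] by auto
    then show ?case
      using insert by (simp add: P.finsum_insert Q.finsum_insert additive_hom_add[OF h] P.finsum_closed)
  qed
qed

context matrix_bimodule
begin

lemma MM_homI:
  assumes "\<And>i j. i \<in> I \<Longrightarrow> j \<in> I \<Longrightarrow> (\<lambda>x. h x i j) \<in> additive_hom P (E i j)"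
  shows "(\<lambda>x. \<lambda>(i, j) \<in> I \<times> I. h x i j) \<in> additive_hom P MM"
proof (rule additive_homI)
  fix x assume x: "x \<in> carrier P"
  show "(\<lambda>(i, j) \<in> I \<times> I. h x i j) \<in> carrier MM"
    by (rule MM_memI) (rule additive_hom_closed[OF assms x])
  fix y assume y: "y \<in> carrier P"
  show "(\<lambda>(i, j) \<in> I \<times> I. h (x \<oplus>\<^bsub>P\<^esub> y) i j)
      = (\<lambda>(i, j) \<in> I \<times> I. h x i j) \<oplus>\<^bsub>MM\<^esub> (\<lambda>(i, j) \<in> I \<times> I. h y i j)"
    unfolding MM_simps by (rule restrict_ext) (use additive_hom_add[OF assms x y] in auto)
qed

lemma MM_proj: "i \<in> I \<Longrightarrow> j \<in> I \<Longrightarrow> (\<lambda>x. x (i, j)) \<in> additive_hom MM (E i j)"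
  by (rule additive_homI) (simp_all add: MM_entry MM_add_entry)

lemma entry_hom_eq:
  "additive_hom (tensor_group K (B i) (pc i j)) P = additive_hom (E i j) P"
  "additive_hom P (tensor_group K (B i) (pc i j)) = additive_hom P (E i j)"
  by (simp_all add: additive_hom_def entry_simps)

lemma peirce_right_mult_hom:
  assumes "s \<in> carrier S"
  shows "(\<lambda>t. t \<otimes>\<^bsub>S\<^esub> (e j \<otimes>\<^bsub>S\<^esub> s \<otimes>\<^bsub>S\<^esub> e l)) \<in> left_module_hom K (pc i j) (pc i l)"
  using assms
  by (auto simp: left_module_hom_def peirce_carrier peirce_simps S.l_distr S.smult_mult_left
      S.m_assoc[symmetric] e_idem_right)

abbreviation "right_mult i l s j \<equiv> mat_entry_map K A p S f N i l id
  (\<lambda>t. t \<otimes>\<^bsub>S\<^esub> (f (std_idem K p j) \<otimes>\<^bsub>S\<^esub> s \<otimes>\<^bsub>S\<^esub> f (std_idem K p l)))"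

lemma right_mult_additive:
  "i \<in> I \<Longrightarrow> s \<in> carrier S \<Longrightarrow> right_mult i l s j \<in> additive_hom (E i j) (E i l)"
  using tensor_map_additive[OF entry_tensor_factors entry_tensor_factors right_module_id_hom
      peirce_right_mult_hom, of i s l j]
  by (simp add: mat_entry_map_def entry_hom_eq e_def)

lemma right_mult_pe:
  "i \<in> I \<Longrightarrow> s \<in> carrier S \<Longrightarrow> n \<in> carrier (N i) \<Longrightarrow> t \<in> carrier (pc i j) \<Longrightarrow>
    right_mult i l s j (pe i j n t) = pe i l n (t \<otimes>\<^bsub>S\<^esub> (e j \<otimes>\<^bsub>S\<^esub> s \<otimes>\<^bsub>S\<^esub> e l))"
  using tensor_map_pt[OF entry_tensor_factors entry_tensor_factors right_module_id_hom
      peirce_right_mult_hom, of i s n t j l]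
  by (simp add: mat_entry_map_def base_bimodule_simps e_def)

lemma rsmult_MM:
  "rsmult MM x s = (\<lambda>(i, l) \<in> I \<times> I. \<Oplus>\<^bsub>E i l\<^esub>j \<in> I. right_mult i l s j (x (i, j)))"
  by (simp add: mat_module_def)

lemma rsmult_additive: "s \<in> carrier S \<Longrightarrow> (\<lambda>x. rsmult MM x s) \<in> additive_hom MM MM"
  unfolding rsmult_MM
  by (intro MM_homI additive_hom_finsum_fun entry_abelian_group)
    (assumption, rule additive_hom_comp[OF MM_proj right_mult_additive])

lemma rsmult_closed: "x \<in> carrier MM \<Longrightarrow> s \<in> carrier S \<Longrightarrow> rsmult MM x s \<in> carrier MM"
  by (rule additive_hom_closed[OF rsmult_additive])

text \<open>The entry at (i, l) is the sum over j of n tensor e_i r e_j s e_l, and the e_j add up to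
  1. The matrix formula for the right action thus becomes (n tensor r) s = n tensor r s, the only
  form in which it is used afterwards.\<close>

lemma rsmult_row:
  assumes "i \<in> I" "n \<in> carrier (N i)" "r \<in> carrier S" "s \<in> carrier S"
  shows "rsmult MM (row i n r) s = row i n (r \<otimes>\<^bsub>S\<^esub> s)"
proof (rule MM_eqI)
  fix k l assume kl: "k \<in> I" "l \<in> I"
  interpret E: abelian_group "E k l" by (rule entry_abelian_group[OF kl(1)])
  have eq: "rsmult MM (row i n r) s (k, l) = (\<Oplus>\<^bsub>E k l\<^esub>j\<in>I. right_mult k l s j (row i n r (k, j)))"
    using kl by (simp add: rsmult_MM)
  show "rsmult MM (row i n r) s (k, l) = row i n (r \<otimes>\<^bsub>S\<^esub> s) (k, l)"
  proof (cases "k = i")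
    case True
    \<comment> \<open>Additive in t, so the sum over j can be moved inside and evaluated in the
      ring.\<close>
    define h where "h t = pe i l n (e i \<otimes>\<^bsub>S\<^esub> t \<otimes>\<^bsub>S\<^esub> e l)" for t
    have h: "h \<in> additive_hom S (E i l)"
      unfolding h_def using assms
      by (intro additive_homI) (simp_all add: pe_closed peirce_compress S.l_distr S.r_distr pe_add_right)
    have hc: "h t \<in> carrier (E i l)" if "t \<in> carrier S" for t
      using additive_hom_closed[OF h that] .
    have "right_mult i l s j (row i n r (i, j)) = h (r \<otimes>\<^bsub>S\<^esub> e j \<otimes>\<^bsub>S\<^esub> s)" if "j \<in> I" for j
    proof -
      have "right_mult i l s j (row i n r (i, j))
          = pe i l n ((e i \<otimes>\<^bsub>S\<^esub> r \<otimes>\<^bsub>S\<^esub> e j) \<otimes>\<^bsub>S\<^esub> (e j \<otimes>\<^bsub>S\<^esub> s \<otimes>\<^bsub>S\<^esub> e l))"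
        using assms that by (simp only: row_entry right_mult_pe peirce_compress simp_thms if_True)
      also have "(e i \<otimes>\<^bsub>S\<^esub> r \<otimes>\<^bsub>S\<^esub> e j) \<otimes>\<^bsub>S\<^esub> (e j \<otimes>\<^bsub>S\<^esub> s \<otimes>\<^bsub>S\<^esub> e l)
          = e i \<otimes>\<^bsub>S\<^esub> (r \<otimes>\<^bsub>S\<^esub> e j \<otimes>\<^bsub>S\<^esub> s) \<otimes>\<^bsub>S\<^esub> e l"
        using assms by (simp add: S.m_assoc e_idem_left)
      finally show ?thesis by (simp only: h_def)
    qed
    then have "(\<Oplus>\<^bsub>E i l\<^esub>j\<in>I. right_mult i l s j (row i n r (i, j)))
        = (\<Oplus>\<^bsub>E i l\<^esub>j\<in>I. h (r \<otimes>\<^bsub>S\<^esub> e j \<otimes>\<^bsub>S\<^esub> s))"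
      using assms hc by (intro E.finsum_cong'[unfolded True]) auto
    also have "\<dots> = h (\<Oplus>\<^bsub>S\<^esub>j\<in>I. r \<otimes>\<^bsub>S\<^esub> e j \<otimes>\<^bsub>S\<^esub> s)"
      using assms by (intro additive_hom_finsum[OF S.abelian_group_axioms entry_abelian_group h, symmetric]) auto
    also have "(\<Oplus>\<^bsub>S\<^esub>j\<in>I. r \<otimes>\<^bsub>S\<^esub> e j \<otimes>\<^bsub>S\<^esub> s) = (\<Oplus>\<^bsub>S\<^esub>j\<in>I. r \<otimes>\<^bsub>S\<^esub> e j) \<otimes>\<^bsub>S\<^esub> s"
      using assms by (intro S.finsum_ldistr[symmetric]) auto
    also have "\<dots> = r \<otimes>\<^bsub>S\<^esub> s" by (simp only: sum_compress[OF assms(3)])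
    finally have "rsmult MM (row i n r) s (k, l) = h (r \<otimes>\<^bsub>S\<^esub> s)"
      by (simp only: eq[unfolded True] True)
    then show ?thesis using kl True by (simp only: row_entry h_def simp_thms if_True)
  next
    case False
    have "right_mult k l s j (row i n r (k, j)) = \<zero>\<^bsub>E k l\<^esub>" if "j \<in> I" for j
      using additive_hom_zero[OF entry_abelian_group[OF kl(1)] entry_abelian_group[OF kl(1)]
          right_mult_additive[OF kl(1) assms(4)]] kl that False by (simp add: row_entry)
    then have "(\<Oplus>\<^bsub>E k l\<^esub>j\<in>I. right_mult k l s j (row i n r (k, j))) = (\<Oplus>\<^bsub>E k l\<^esub>j\<in>I. \<zero>\<^bsub>E k l\<^esub>)"
      by (intro E.finsum_cong') auto
    then show ?thesis using eq kl False by (simp add: row_entry)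
  qed
qed (use assms in \<open>simp_all add: rsmult_closed row_closed\<close>)

lemma MM_smult_additive: "a \<in> carrier A \<Longrightarrow> (\<lambda>x. a \<odot>\<^bsub>MM\<^esub> x) \<in> additive_hom MM MM"
  unfolding MM_simps
  by (intro MM_homI) (rule additive_hom_comp[OF MM_proj left_module_smult_additive[OF entry_left_module]])

lemma smult_pe:
  "i \<in> I \<Longrightarrow> a \<in> carrier A \<Longrightarrow> n \<in> carrier (N i) \<Longrightarrow> s \<in> carrier (pc i j) \<Longrightarrow>
    a \<odot>\<^bsub>E i j\<^esub> pe i j n s = pe i j (a \<odot>\<^bsub>N i\<^esub> n) s"
  using tensor_bimodule_factors.tensor_smult_pt[OF entry_tensor_bimodule_factors, of i a n s j]
  by (simp add: mat_entry_def base_bimodule_simps)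

lemma smult_row:
  assumes "i \<in> I" "n \<in> carrier (N i)" "r \<in> carrier S" "a \<in> carrier A"
  shows "a \<odot>\<^bsub>MM\<^esub> row i n r = row i (a \<odot>\<^bsub>N i\<^esub> n) r"
proof (rule MM_eqI)
  fix k l assume kl: "k \<in> I" "l \<in> I"
  have "a \<odot>\<^bsub>E k l\<^esub> \<zero>\<^bsub>E k l\<^esub> = \<zero>\<^bsub>E k l\<^esub>"
    by (rule additive_hom_zero[OF entry_abelian_group[OF kl(1)] entry_abelian_group[OF kl(1)]
        left_module_smult_additive[OF entry_left_module[OF kl(1)] assms(4)]])
  then show "(a \<odot>\<^bsub>MM\<^esub> row i n r) (k, l) = row i (a \<odot>\<^bsub>N i\<^esub> n) r (k, l)"
    using assms kl by (simp add: MM_simps row_entry smult_pe peirce_compress)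
qed (use assms in \<open>simp_all add: additive_hom_closed[OF MM_smult_additive] row_closed
      left_module.left_closed[OF N_left_module]\<close>)

lemma MM_left_module: "left_module A MM"
proof (rule left_moduleI[OF A.ring_axioms MM_abelian_group MM_smult_additive])
  fix x assume x: "x \<in> carrier MM"
  show "\<one>\<^bsub>A\<^esub> \<odot>\<^bsub>MM\<^esub> x = x"
    by (rule row_eqI[OF MM_abelian_group MM_smult_additive additive_hom_id _ x])
      (simp_all add: smult_row left_module.left_one[OF N_left_module])
  fix a b assume ab: "a \<in> carrier A" "b \<in> carrier A"
  show "(a \<oplus>\<^bsub>A\<^esub> b) \<odot>\<^bsub>MM\<^esub> x = a \<odot>\<^bsub>MM\<^esub> x \<oplus>\<^bsub>MM\<^esub> b \<odot>\<^bsub>MM\<^esub> x"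
    by (rule row_eqI[OF MM_abelian_group MM_smult_additive
          additive_hom_add_fun[OF MM_abelian_group MM_smult_additive MM_smult_additive] _ x])
      (use ab in \<open>simp_all add: smult_row row_add_left left_module.left_add_scalar[OF N_left_module]
        left_module.left_closed[OF N_left_module]\<close>)
  show "(a \<otimes>\<^bsub>A\<^esub> b) \<odot>\<^bsub>MM\<^esub> x = a \<odot>\<^bsub>MM\<^esub> (b \<odot>\<^bsub>MM\<^esub> x)"
    by (rule row_eqI[OF MM_abelian_group MM_smult_additive
          additive_hom_comp[OF MM_smult_additive MM_smult_additive] _ x])
      (use ab in \<open>simp_all add: smult_row left_module.left_assoc[OF N_left_module]
        left_module.left_closed[OF N_left_module]\<close>)
qed

text \<open>On rows the laws of the right action become associativity, distributivity and the unit
  law of \<open>S\<close> in the second tensor factor.\<close>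

lemma MM_right_module: "right_module S MM"
proof (rule right_moduleI[OF S.ring_axioms MM_abelian_group rsmult_additive])
  fix x assume x: "x \<in> carrier MM"
  show "rsmult MM x \<one>\<^bsub>S\<^esub> = x"
    by (rule row_eqI[OF MM_abelian_group rsmult_additive additive_hom_id _ x]) (simp_all add: rsmult_row)
  fix r s assume rs: "r \<in> carrier S" "s \<in> carrier S"
  show "rsmult MM x (r \<oplus>\<^bsub>S\<^esub> s) = rsmult MM x r \<oplus>\<^bsub>MM\<^esub> rsmult MM x s"
    by (rule row_eqI[OF MM_abelian_group rsmult_additive
          additive_hom_add_fun[OF MM_abelian_group rsmult_additive rsmult_additive] _ x])
      (use rs in \<open>simp_all add: rsmult_row row_add_right S.r_distr\<close>)
  show "rsmult MM x (r \<otimes>\<^bsub>S\<^esub> s) = rsmult MM (rsmult MM x r) s"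
    by (rule row_eqI[OF MM_abelian_group rsmult_additive
          additive_hom_comp[OF rsmult_additive rsmult_additive] _ x])
      (use rs in \<open>simp_all add: rsmult_row S.m_assoc\<close>)
qed

lemma MM_is_bimodule: "is_bimodule K A S MM"
  unfolding is_bimodule_def
proof (intro conjI ballI MM_left_module MM_right_module)
  fix a r x assume a: "a \<in> carrier A" and r: "r \<in> carrier S" and x: "x \<in> carrier MM"
  show "a \<odot>\<^bsub>MM\<^esub> rsmult MM x r = rsmult MM (a \<odot>\<^bsub>MM\<^esub> x) r"
    by (rule row_eqI[OF MM_abelian_group additive_hom_comp[OF rsmult_additive MM_smult_additive]
          additive_hom_comp[OF MM_smult_additive rsmult_additive] _ x])
      (use a r in \<open>simp_all add: rsmult_row smult_row left_module.left_closed[OF N_left_module]\<close>)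
next
  fix c x assume c: "c \<in> carrier K" and x: "x \<in> carrier MM"
  show "(c \<odot>\<^bsub>A\<^esub> \<one>\<^bsub>A\<^esub>) \<odot>\<^bsub>MM\<^esub> x = rsmult MM x (c \<odot>\<^bsub>S\<^esub> \<one>\<^bsub>S\<^esub>)"
    by (rule row_eqI[OF MM_abelian_group MM_smult_additive rsmult_additive _ x])
      (use c in \<open>simp_all add: rsmult_row smult_row row_scalar S.smult_mult_right\<close>)
qed

end

section \<open>Entrywise maps between modules of matrices\<close>

text \<open>The second map may depend on the position, so that reduction, the map induced by
  \<open>f\<close>, the maps h tensor 1 and the base differential are all instances.\<close>

definition mat_map where
  "mat_map K A p S' f' N' h u x = (\<lambda>(i, j) \<in> {1..p} \<times> {1..p}.
    mat_entry_map K A p S' f' N' i j (h i) (u i j) (x (i, j)))"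

locale matrix_bimodule_map = X: matrix_bimodule K A p S f N + Y: matrix_bimodule K A p S' f' N'
  for K :: "('k, 'u) ring_scheme" and A :: "('k, 'a) module" and p :: nat
    and S :: "('k, 's) module" and f :: "(nat \<Rightarrow> 'k) \<Rightarrow> 's" and N :: "nat \<Rightarrow> ('a, 'b) module"
    and S' :: "('k, 't) module" and f' :: "(nat \<Rightarrow> 'k) \<Rightarrow> 't" and N' :: "nat \<Rightarrow> ('a, 'c) module" +
  fixes h :: "nat \<Rightarrow> 'b \<Rightarrow> 'c" and u :: "nat \<Rightarrow> nat \<Rightarrow> 's \<Rightarrow> 't"
  assumes h_hom: "i \<in> {1..p} \<Longrightarrow>
      h i \<in> right_module_hom K (base_bimodule A (N i)) (base_bimodule A (N' i))"
    and u_hom: "i \<in> {1..p} \<Longrightarrow> j \<in> {1..p} \<Longrightarrow>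
      u i j \<in> left_module_hom K (peirce K p S f i j) (peirce K p S' f' i j)"
begin

abbreviation "map_MM \<equiv> mat_map K A p S' f' N' h u"
abbreviation "map_entry i j \<equiv> mat_entry_map K A p S' f' N' i j (h i) (u i j)"

lemma map_entry_additive:
  assumes "i \<in> X.I" "j \<in> X.I"
  shows "map_entry i j \<in> additive_hom (X.E i j) (Y.E i j)"
  using tensor_map_additive[OF X.entry_tensor_factors[OF assms(1)] Y.entry_tensor_factors[OF assms(1)]
      h_hom[OF assms(1)] u_hom[OF assms]]
  by (simp add: mat_entry_map_def X.entry_hom_eq Y.entry_hom_eq)

lemma map_entry_pe:
  assumes "i \<in> X.I" "j \<in> X.I" "n \<in> carrier (N i)" "s \<in> carrier (X.pc i j)"
  shows "map_entry i j (X.pe i j n s) = Y.pe i j (h i n) (u i j s)"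
  using tensor_map_pt[OF X.entry_tensor_factors[OF assms(1)] Y.entry_tensor_factors[OF assms(1)]
      h_hom[OF assms(1)] u_hom[OF assms(1,2)], of n s] assms(3,4)
  by (simp add: mat_entry_map_def base_bimodule_simps)

lemma map_additive: "map_MM \<in> additive_hom X.MM Y.MM"
  unfolding mat_map_def[abs_def]
  by (intro Y.MM_homI) (rule additive_hom_comp[OF X.MM_proj map_entry_additive])

lemma h_closed: "i \<in> X.I \<Longrightarrow> n \<in> carrier (N i) \<Longrightarrow> h i n \<in> carrier (N' i)"
  using additive_hom_closed[OF right_module_hom_additive[OF h_hom], of i n] by (simp add: base_bimodule_simps)

text \<open>The ring element s' is a separate variable because the maps \<open>u i j\<close> need
  not come from one ring homomorphism; for the base differential they are left multiplications by an
  idempotent. Only the effect on the corners of row i matters.\<close>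

lemma map_row:
  assumes "i \<in> X.I" "n \<in> carrier (N i)" "s \<in> carrier S" "s' \<in> carrier S'"
    and "\<And>j. j \<in> X.I \<Longrightarrow> u i j (X.e i \<otimes>\<^bsub>S\<^esub> s \<otimes>\<^bsub>S\<^esub> X.e j) = Y.e i \<otimes>\<^bsub>S'\<^esub> s' \<otimes>\<^bsub>S'\<^esub> Y.e j"
  shows "map_MM (X.row i n s) = Y.row i (h i n) s'"
proof (rule Y.MM_eqI)
  fix k l assume kl: "k \<in> X.I" "l \<in> X.I"
  have "map_entry k l \<zero>\<^bsub>X.E k l\<^esub> = \<zero>\<^bsub>Y.E k l\<^esub>"
    using additive_hom_zero[OF X.entry_abelian_group Y.entry_abelian_group map_entry_additive] kl by blast
  then show "map_MM (X.row i n s) (k, l) = Y.row i (h i n) s' (k, l)"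
    using assms kl by (simp add: mat_map_def X.row_entry Y.row_entry map_entry_pe X.peirce_compress)
qed (use assms in \<open>simp_all add: additive_hom_closed[OF map_additive] X.row_closed Y.row_closed h_closed\<close>)

end

section \<open>Linear sections\<close>

definition subspace :: "('k, 'u) ring_scheme \<Rightarrow> ('a, 'k, 'b, 'y) bimodule_scheme \<Rightarrow> 'b set \<Rightarrow> bool"
  where "subspace K V U \<longleftrightarrow> U \<subseteq> carrier V \<and> \<zero>\<^bsub>V\<^esub> \<in> U \<and>
    (\<forall>x \<in> U. \<forall>y \<in> U. x \<oplus>\<^bsub>V\<^esub> y \<in> U) \<and> (\<forall>x \<in> U. \<forall>c \<in> carrier K. rsmult V x c \<in> U)"

text \<open>All conditions are imposed at values of \<open>h\<close>, since a section matters only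
  there. The image of \<open>h\<close> need not be turned into a module of its own, and \<sigma> is
  arbitrary elsewhere.\<close>

definition linear_section_of where
  "linear_section_of K V W h \<sigma> \<longleftrightarrow>
    (\<forall>x \<in> carrier V. \<sigma> (h x) \<in> carrier V \<and> h (\<sigma> (h x)) = h x) \<and>
    (\<forall>x \<in> carrier V. \<forall>y \<in> carrier V. \<sigma> (h x \<oplus>\<^bsub>W\<^esub> h y) = \<sigma> (h x) \<oplus>\<^bsub>V\<^esub> \<sigma> (h y)) \<and>
    (\<forall>x \<in> carrier V. \<forall>c \<in> carrier K. \<sigma> (rsmult W (h x) c) = rsmult V (\<sigma> (h x)) c)"

text \<open>By Zorn's lemma there is a subspace that is maximal among those meeting the kernel of
  \<open>h\<close> in zero. It is a complement of the kernel, so \<open>h\<close> maps it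
  bijectively onto the image, and \<sigma> inverts this bijection.\<close>

lemma linear_section_exists:
  assumes K: "field K" and V: "right_module K V" and W: "right_module K W"
    and h: "h \<in> right_module_hom K V W"
  shows "\<exists>\<sigma>. linear_section_of K V W h \<sigma>"
proof -
  interpret K: field K by fact
  note Vab = right_module_abelian_group[OF V] and Wab = right_module_abelian_group[OF W]
  interpret Va: abelian_group V by (rule Vab)
  interpret Wa: abelian_group W by (rule Wab)
  interpret V: right_module K V by fact
  interpret W: right_module K W by fact
  note hadd = right_module_hom_additive[OF h]
  note h_closed = additive_hom_closed[OF hadd] and h_add = additive_hom_add[OF hadd]
    and h_neg = additive_hom_neg[OF Vab Wab hadd]
    and h_smult = right_module_hom_smult[OF h]
  have smult_zero: "rsmult V x \<zero>\<^bsub>K\<^esub> = \<zero>\<^bsub>V\<^esub>" if "x \<in> carrier V" for x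
  proof -
    have "(\<lambda>c. rsmult V x c) \<in> additive_hom K V"
      using that by (intro additive_homI) (simp_all add: V.right_closed V.right_add_scalar)
    from additive_hom_zero[OF K.abelian_group_axioms Vab this] show ?thesis .
  qed
  have smult_neg: "rsmult V x (\<ominus>\<^bsub>K\<^esub> \<one>\<^bsub>K\<^esub>) = \<ominus>\<^bsub>V\<^esub> x" if "x \<in> carrier V" for x
  proof -
    have "(\<lambda>c. rsmult V x c) \<in> additive_hom K V"
      using that by (intro additive_homI) (simp_all add: V.right_closed V.right_add_scalar)
    from additive_hom_neg[OF K.abelian_group_axioms Vab this, of "\<one>\<^bsub>K\<^esub>"] show ?thesis
      using that by (simp add: V.right_one)
  qed
  define \<A> where "\<A> = {U. subspace K V U \<and> (\<forall>x \<in> U. h x = \<zero>\<^bsub>W\<^esub> \<longrightarrow> x = \<zero>\<^bsub>V\<^esub>)}"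
  have "\<exists>U \<in> \<A>. \<forall>U' \<in> \<A>. U \<subseteq> U' \<longrightarrow> U' = U"
  proof (rule subset_Zorn_nonempty)
    have "{\<zero>\<^bsub>V\<^esub>} \<in> \<A>"
      using right_module_smult_additive[OF V] additive_hom_zero[OF Vab Vab]
      by (auto simp: \<A>_def subspace_def)
    then show "\<A> \<noteq> {}" by blast
  next
    fix \<C> assume ne: "\<C> \<noteq> {}" and ch: "subset.chain \<A> \<C>"
    have CA: "\<C> \<subseteq> \<A>" using ch by (auto simp: subset_chain_def)
    have common: "\<exists>U \<in> \<C>. x \<in> U \<and> y \<in> U" if "x \<in> \<Union>\<C>" "y \<in> \<Union>\<C>" for x y
    proof -
      obtain U U' where "x \<in> U" "U \<in> \<C>" "y \<in> U'" "U' \<in> \<C>" using \<open>x \<in> \<Union>\<C>\<close> \<open>y \<in> \<Union>\<C>\<close> by blast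
      moreover have "U \<subseteq> U' \<or> U' \<subseteq> U" using ch calculation by (auto simp: subset_chain_def)
      ultimately show ?thesis by blast
    qed
    have sub: "subspace K V U" "\<And>x. x \<in> U \<Longrightarrow> h x = \<zero>\<^bsub>W\<^esub> \<Longrightarrow> x = \<zero>\<^bsub>V\<^esub>" if "U \<in> \<C>" for U
      using CA that by (auto simp: \<A>_def)
    have "subspace K V (\<Union>\<C>)"
      unfolding subspace_def
    proof (intro conjI ballI)
      show "\<Union>\<C> \<subseteq> carrier V"
      proof (rule Union_least)
        fix U assume "U \<in> \<C>"
        from sub(1)[OF this] show "U \<subseteq> carrier V" by (simp add: subspace_def)
      qed
      show "\<zero>\<^bsub>V\<^esub> \<in> \<Union>\<C>" using ne sub(1) by (auto simp: subspace_def)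
      fix x assume x: "x \<in> \<Union>\<C>"
      show "x \<oplus>\<^bsub>V\<^esub> y \<in> \<Union>\<C>" if "y \<in> \<Union>\<C>" for y
        using common[OF x that] sub(1) unfolding subspace_def by blast
      show "rsmult V x c \<in> \<Union>\<C>" if "c \<in> carrier K" for c
        using x sub(1) that unfolding subspace_def by blast
    qed
    then show "\<Union>\<C> \<in> \<A>" unfolding \<A>_def using sub(2) by blast
  qed
  then obtain U where UA: "U \<in> \<A>" and max: "\<And>U'. U' \<in> \<A> \<Longrightarrow> U \<subseteq> U' \<Longrightarrow> U' = U"
    by (elim bexE) metis
  from UA have U: "subspace K V U" "\<And>x. x \<in> U \<Longrightarrow> h x = \<zero>\<^bsub>W\<^esub> \<Longrightarrow> x = \<zero>\<^bsub>V\<^esub>"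
    by (simp_all add: \<A>_def)
  have UV: "x \<in> carrier V" if "x \<in> U" for x using U(1) that by (auto simp: subspace_def)
  have U0: "\<zero>\<^bsub>V\<^esub> \<in> U" and Uadd: "\<And>x y. x \<in> U \<Longrightarrow> y \<in> U \<Longrightarrow> x \<oplus>\<^bsub>V\<^esub> y \<in> U"
    and Usmult: "\<And>x c. x \<in> U \<Longrightarrow> c \<in> carrier K \<Longrightarrow> rsmult V x c \<in> U"
    using U(1) by (auto simp: subspace_def)
  have Uneg: "\<ominus>\<^bsub>V\<^esub> x \<in> U" if "x \<in> U" for x
    using Usmult[OF that, of "\<ominus>\<^bsub>K\<^esub> \<one>\<^bsub>K\<^esub>"] smult_neg[OF UV[OF that]] by simp
  \<comment> \<open>If h v were not attained on U, the subspace U + v K would still meet the kernel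
    trivially, contrary to maximality.\<close>
  have surj: "\<exists>u \<in> U. h u = h v" if v: "v \<in> carrier V" for v
  proof (rule ccontr)
    assume no: "\<not> (\<exists>u \<in> U. h u = h v)"
    let ?U' = "{u \<oplus>\<^bsub>V\<^esub> rsmult V v c | u c. u \<in> U \<and> c \<in> carrier K}"
    have "subspace K V ?U'"
      unfolding subspace_def
    proof (intro conjI ballI)
      show "?U' \<subseteq> carrier V" using UV v V.right_closed by auto
      show "\<zero>\<^bsub>V\<^esub> \<in> ?U'" using U0 smult_zero[OF v] by (intro CollectI exI[of _ "\<zero>\<^bsub>V\<^esub>"] exI[of _ "\<zero>\<^bsub>K\<^esub>"]) auto
      fix x assume "x \<in> ?U'"
      then obtain u c where x: "x = u \<oplus>\<^bsub>V\<^esub> rsmult V v c" "u \<in> U" "c \<in> carrier K" by blast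
      show "x \<oplus>\<^bsub>V\<^esub> y \<in> ?U'" if yU: "y \<in> ?U'" for y
      proof -
        obtain u' c' where y: "y = u' \<oplus>\<^bsub>V\<^esub> rsmult V v c'" "u' \<in> U" "c' \<in> carrier K" using yU by blast
        have "x \<oplus>\<^bsub>V\<^esub> y = (u \<oplus>\<^bsub>V\<^esub> u') \<oplus>\<^bsub>V\<^esub> rsmult V v (c \<oplus>\<^bsub>K\<^esub> c')"
          using x y UV v by (simp add: V.right_add_scalar V.right_closed Va.a_ac)
        then show ?thesis using x y Uadd by blast
      qed
      show "rsmult V x c' \<in> ?U'" if "c' \<in> carrier K" for c'
      proof -
        have "rsmult V x c' = rsmult V u c' \<oplus>\<^bsub>V\<^esub> rsmult V v (c \<otimes>\<^bsub>K\<^esub> c')"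
          using x that UV v by (simp add: V.right_add V.right_closed V.right_assoc)
        then show ?thesis using x that Usmult by blast
      qed
    qed
    moreover have "x = \<zero>\<^bsub>V\<^esub>" if x: "x \<in> ?U'" and hx: "h x = \<zero>\<^bsub>W\<^esub>" for x
    proof -
      obtain u c where xu: "x = u \<oplus>\<^bsub>V\<^esub> rsmult V v c" "u \<in> U" "c \<in> carrier K" using x by blast
      show ?thesis
      proof (cases "c = \<zero>\<^bsub>K\<^esub>")
        case True
        then show ?thesis using xu hx U(2) smult_zero[OF v] UV by simp
      next
        case False
        \<comment> \<open>A kernel element u + v c with c nonzero can be divided by c; then v agrees
          with an element of U modulo the kernel, which the choice of v excludes.\<close>
        define d where "d = inv\<^bsub>K\<^esub> c"
        have d: "d \<in> carrier K" "c \<otimes>\<^bsub>K\<^esub> d = \<one>\<^bsub>K\<^esub>"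
          using False xu(3) K.field_Units unfolding d_def by (auto intro: K.Units_r_inv)
        have "rsmult V x d = rsmult V u d \<oplus>\<^bsub>V\<^esub> v"
          using xu d UV v by (simp add: V.right_add V.right_closed V.right_assoc[symmetric] V.right_one)
        moreover have ud: "rsmult V u d \<in> U" by (rule Usmult[OF xu(2) d(1)])
        ultimately have eq: "v = \<ominus>\<^bsub>V\<^esub> rsmult V u d \<oplus>\<^bsub>V\<^esub> rsmult V x d"
          using UV[OF ud] v by (simp add: Va.r_neg1)
        have xV: "x \<in> carrier V" using xu UV v by (simp add: V.right_closed)
        have "rsmult W (h x) d = \<zero>\<^bsub>W\<^esub>"
          unfolding hx by (rule additive_hom_zero[OF Wab Wab right_module_smult_additive[OF W d(1)]])
        then have h0: "h (rsmult V x d) = \<zero>\<^bsub>W\<^esub>"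
          by (simp only: h_smult[OF d(1) xV])
        have "h v = h (\<ominus>\<^bsub>V\<^esub> rsmult V u d \<oplus>\<^bsub>V\<^esub> rsmult V x d)"
          using eq by (rule arg_cong)
        also have "\<dots> = h (\<ominus>\<^bsub>V\<^esub> rsmult V u d)"
          using h_add[OF UV[OF Uneg[OF ud]] V.right_closed[OF d(1) xV]] h0
            h_closed[OF UV[OF Uneg[OF ud]]] by simp
        finally have "\<exists>u \<in> U. h u = h v" using Uneg[OF ud] by (intro bexI[of _ "\<ominus>\<^bsub>V\<^esub> rsmult V u d"]) simp_all
        then show ?thesis using no by (rule notE[rotated])
      qed
    qed
    ultimately have "?U' \<in> \<A>" by (simp add: \<A>_def)
    moreover have "U \<subseteq> ?U'"
    proof
      fix u assume "u \<in> U"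
      then show "u \<in> ?U'" using smult_zero[OF v] UV
        by (intro CollectI exI[of _ u] exI[of _ "\<zero>\<^bsub>K\<^esub>"]) auto
    qed
    ultimately have "?U' = U" by (rule max)
    moreover have "v \<in> ?U'" using U0 v V.right_one
      by (intro CollectI exI[of _ "\<zero>\<^bsub>V\<^esub>"] exI[of _ "\<one>\<^bsub>K\<^esub>"]) auto
    ultimately show False using no by blast
  qed
  have inj: "x = y" if "x \<in> U" "y \<in> U" "h x = h y" for x y
  proof -
    have "h (x \<oplus>\<^bsub>V\<^esub> \<ominus>\<^bsub>V\<^esub> y) = \<zero>\<^bsub>W\<^esub>"
      using that UV h_closed by (simp add: h_add h_neg Wa.r_neg)
    then have "x \<oplus>\<^bsub>V\<^esub> \<ominus>\<^bsub>V\<^esub> y = \<zero>\<^bsub>V\<^esub>" using U(2) Uadd Uneg that by blast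
    then show ?thesis using that UV by (metis Va.minus_equality Va.minus_minus Va.a_inv_closed)
  qed
  define \<sigma> where "\<sigma> w = (THE u. u \<in> U \<and> h u = w)" for w
  have \<sigma>_eq: "\<sigma> w = u" if "u \<in> U" "h u = w" for w u
    unfolding \<sigma>_def
  proof (rule the_equality)
    fix u' assume "u' \<in> U \<and> h u' = w"
    then show "u' = u" using inj[of u' u] that by simp
  qed (use that in simp)
  have \<sigma>: "\<sigma> (h x) \<in> U \<and> h (\<sigma> (h x)) = h x" if x: "x \<in> carrier V" for x
  proof -
    obtain u where "u \<in> U" "h u = h x" using surj[OF x] by blast
    then show ?thesis using \<sigma>_eq[of u "h x"] by simp
  qed
  have "linear_section_of K V W h \<sigma>"
    unfolding linear_section_of_def
  proof (intro conjI ballI)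
    fix x assume x: "x \<in> carrier V"
    show "\<sigma> (h x) \<in> carrier V" "h (\<sigma> (h x)) = h x" using \<sigma>[OF x] UV by auto
    show "\<sigma> (h x \<oplus>\<^bsub>W\<^esub> h y) = \<sigma> (h x) \<oplus>\<^bsub>V\<^esub> \<sigma> (h y)" if y: "y \<in> carrier V" for y
      using \<sigma>[OF x] \<sigma>[OF y] UV by (intro \<sigma>_eq) (simp_all add: Uadd h_add)
    show "\<sigma> (rsmult W (h x) c) = rsmult V (\<sigma> (h x)) c" if c: "c \<in> carrier K" for c
      using \<sigma>[OF x] UV c by (intro \<sigma>_eq) (simp_all add: Usmult h_smult)
  qed
  then show ?thesis by blast
qed

section \<open>Reduction modulo the radical\<close>

text \<open>The product \<open>F J\<close>; negatives need no closure rule when \<open>J\<close> is a subgroup.\<close>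

inductive_set mod_ideal for R F J where
  zero: "\<zero>\<^bsub>F\<^esub> \<in> mod_ideal R F J"
| add: "x \<in> mod_ideal R F J \<Longrightarrow> y \<in> mod_ideal R F J \<Longrightarrow> x \<oplus>\<^bsub>F\<^esub> y \<in> mod_ideal R F J"
| incl: "y \<in> carrier F \<Longrightarrow> r \<in> J \<Longrightarrow> r \<in> carrier R \<Longrightarrow> rsmult F y r \<in> mod_ideal R F J"

lemma mod_ideal_closed:
  assumes "right_module R F" "x \<in> mod_ideal R F J"
  shows "x \<in> carrier F"
  using assms(2)
  by induction (auto intro: right_module.right_closed[OF assms(1)]
      abelian_groupE(1,2)[OF right_module_abelian_group[OF assms(1)]])

context
  fixes R :: "('r, 'u) ring_scheme" and F :: "('a, 'r, 'b, 'z) bimodule_scheme"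
    and J :: "'r set" and E :: "'b \<Rightarrow> 'b"
  assumes F: "right_module R F" and E: "E \<in> right_module_hom R F F"
    and EJ: "\<And>x. x \<in> carrier F \<Longrightarrow> E x \<in> mod_ideal R F J"
begin

interpretation F: right_module R F by (rule F)

private lemma pow_hom: "(E ^^ n) \<in> right_module_hom R F F"
proof (induction n)
  case (Suc n)
  have "(\<lambda>x. E ((E ^^ n) x)) \<in> right_module_hom R F F"
    using Suc E by (auto simp: right_module_hom_def Pi_iff)
  then show ?case by (simp add: comp_def)
qed (auto simp: right_module_hom_def)

text \<open>Linearity lets the factor in J be pulled out: E^(n+1) F lies in E^n (F J), which is
  contained in (E^n F) J and so in F J^n J.\<close>

private lemma pow_mod_ideal:
  assumes "J \<subseteq> carrier R" "x \<in> carrier F"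
  shows "(E ^^ n) x \<in> mod_ideal R F (ideal_power R J n)"
  using assms(2)
proof (induction n arbitrary: x)
  case 0
  then show ?case using mod_ideal.incl[of x F "\<one>\<^bsub>R\<^esub>" "carrier R" R] by (simp add: F.right_one)
next
  case (Suc n)
  note En = right_module_hom_additive[OF pow_hom[of n]]
  \<comment> \<open>The inclusion of F J^n J in F J^(n+1); the new factor stands on the right, as in
    \<open>ideal_power\<close>.\<close>
  have step: "rsmult F z r \<in> mod_ideal R F (ideal_power R J (Suc n))"
    if "z \<in> mod_ideal R F (ideal_power R J n)" "r \<in> J" for z r
    using that(1)
  proof induction
    case zero
    have "rsmult F \<zero>\<^bsub>F\<^esub> r = \<zero>\<^bsub>F\<^esub>"
      using additive_hom_zero[OF right_module_abelian_group[OF F] right_module_abelian_group[OF F]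
          right_module_smult_additive[OF F]] that(2) assms(1) by blast
    then show ?case using mod_ideal.zero[of F R] by simp
  next
    case (add x y)
    then show ?case
      using mod_ideal.add[OF add(3,4)] that(2) assms(1) mod_ideal_closed[OF F]
      by (simp add: F.right_add subset_iff)
  next
    case (incl y s)
    have "s \<otimes>\<^bsub>R\<^esub> r \<in> ideal_power R J (Suc n)"
      using incl that(2) by (simp add: ideal_prod.prod)
    then show ?case
      using mod_ideal.incl[of y F "s \<otimes>\<^bsub>R\<^esub> r" _ R] incl that(2) assms(1)
      by (simp add: F.right_assoc subset_iff)
  qed
  \<comment> \<open>For a generator y r of F J the induction hypothesis applies to y, and r comes
    out by linearity of the power of E.\<close>
  have "(E ^^ n) w \<in> mod_ideal R F (ideal_power R J (Suc n))" if "w \<in> mod_ideal R F J" for w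
    using that
  proof induction
    case zero
    have "(E ^^ n) \<zero>\<^bsub>F\<^esub> = \<zero>\<^bsub>F\<^esub>"
      by (rule additive_hom_zero[OF right_module_abelian_group[OF F] right_module_abelian_group[OF F] En])
    then show ?case using mod_ideal.zero[of F R] by simp
  next
    case (add x y)
    then show ?case
      using additive_hom_add[OF En mod_ideal_closed[OF F add(1)] mod_ideal_closed[OF F add(2)]]
      by (simp add: mod_ideal.add)
  next
    case (incl y r)
    then show ?case
      using right_module_hom_smult[OF pow_hom[of n] incl(3,1)] step[OF Suc.IH[OF incl(1)] incl(2)] by simp
  qed
  from this[OF EJ[OF Suc.prems]] show ?case by (simp add: funpow_swap1)
qed

text \<open>The n-th power takes values in F J^n, which is F 0 and hence zero. The exponent is that
  of J, the same for all x.\<close>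

lemma nilpotent_endomorphism:
  assumes "J \<subseteq> carrier R" "ideal_power R J n = {\<zero>\<^bsub>R\<^esub>}" "x \<in> carrier F"
  shows "(E ^^ n) x = \<zero>\<^bsub>F\<^esub>"
proof -
  have "z = \<zero>\<^bsub>F\<^esub>" if "z \<in> mod_ideal R F {\<zero>\<^bsub>R\<^esub>}" for z
    using that
  proof induction
    case (add x y)
    then show ?case using abelian_groupE(2,5)[OF right_module_abelian_group[OF F]] by simp
  next
    case (incl y r)
    have "(\<lambda>r. rsmult F y r) \<in> additive_hom R F"
      using incl(1) by (intro additive_homI) (simp_all add: F.right_closed F.right_add_scalar)
    from additive_hom_zero[OF ring.axioms(1)[OF F.ring_axioms] right_module_abelian_group[OF F] this]
    show ?case using incl(2) by simp
  qed simp
  with pow_mod_ideal[OF assms(1,3), of n] assms(2) show ?thesis by simp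
qed

end

section \<open>Augmented algebras, their radical and the kernel of reduction\<close>

locale augmented_algebra = pointed_algebra K R p f
  for K :: "('k, 'u) ring_scheme" and R :: "('k, 'r) module" and p :: nat
    and f :: "(nat \<Rightarrow> 'k) \<Rightarrow> 'r" +
  fixes g :: "'r \<Rightarrow> (nat \<Rightarrow> 'k)"
  assumes g_hom: "g \<in> algebra_hom K R (pow_algebra K p)"
    and g_f: "x \<in> carrier (pow_algebra K p) \<Longrightarrow> g (f x) = x"
begin

lemma f_closed: "x \<in> carrier (pow_algebra K p) \<Longrightarrow> f x \<in> carrier R"
  by (rule ring_hom_closed[OF f_ring_hom])

lemma f_smult: "c \<in> carrier K \<Longrightarrow> x \<in> carrier (pow_algebra K p) \<Longrightarrow>
    f (c \<odot>\<^bsub>pow_algebra K p\<^esub> x) = c \<odot>\<^bsub>R\<^esub> f x"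
  using f_hom by (simp add: algebra_hom_def)

lemma g_ring_hom: "g \<in> ring_hom R (pow_algebra K p)"
  using g_hom by (simp add: algebra_hom_def)

lemma g_additive: "g \<in> additive_hom R (pow_algebra K p)"
  using g_ring_hom by (auto simp: additive_hom_def ring_hom_def)

lemma g_closed: "r \<in> carrier R \<Longrightarrow> g r \<in> carrier (pow_algebra K p)"
  by (rule ring_hom_closed[OF g_ring_hom])

lemma g_mult: "r \<in> carrier R \<Longrightarrow> s \<in> carrier R \<Longrightarrow> g (r \<otimes>\<^bsub>R\<^esub> s) = g r \<otimes>\<^bsub>pow_algebra K p\<^esub> g s"
  by (rule ring_hom_mult[OF g_ring_hom])

lemma g_smult: "c \<in> carrier K \<Longrightarrow> r \<in> carrier R \<Longrightarrow> g (c \<odot>\<^bsub>R\<^esub> r) = c \<odot>\<^bsub>pow_algebra K p\<^esub> g r"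
  using g_hom by (simp add: algebra_hom_def)

lemma g_e: "g (e i) = std_idem K p i"
  by (simp add: e_def g_f std_idem_closed[OF S.R.ring_axioms])

sublocale base: pointed_algebra K "pow_algebra K p" p id
  by (unfold_locales) (simp add: algebra_hom_def ring_hom_def)

lemma base_e: "base.e i = std_idem K p i"
  by (simp add: base.e_def)

lemma g_compress:
  "s \<in> carrier R \<Longrightarrow> g (e i \<otimes>\<^bsub>R\<^esub> s \<otimes>\<^bsub>R\<^esub> e j)
    = base.e i \<otimes>\<^bsub>pow_algebra K p\<^esub> g s \<otimes>\<^bsub>pow_algebra K p\<^esub> base.e j"
  by (simp add: g_mult g_e base_e)

lemma f_compress:
  assumes "x \<in> carrier (pow_algebra K p)"
  shows "f (base.e i \<otimes>\<^bsub>pow_algebra K p\<^esub> x \<otimes>\<^bsub>pow_algebra K p\<^esub> base.e j) = e i \<otimes>\<^bsub>R\<^esub> f x \<otimes>\<^bsub>R\<^esub> e j"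
  unfolding base_e e_def using assms std_idem_closed[OF S.R.ring_axioms, of p]
  by (simp add: ring_hom_mult[OF f_ring_hom] pow.m_closed)

lemma g_peirce_hom: "g \<in> left_module_hom K (pc i j) (base.pc i j)"
proof (rule left_module_homI[OF additive_homI])
  fix x assume x: "x \<in> carrier (pc i j)"
  then have "x \<in> carrier R" "x = e i \<otimes>\<^bsub>R\<^esub> x \<otimes>\<^bsub>R\<^esub> e j" by (auto simp: peirce_carrier)
  then show "g x \<in> carrier (base.pc i j)"
    using g_compress[of x i j] base.peirce_compress[OF g_closed, of x i j] by simp
qed (auto simp: peirce_carrier peirce_simps base.peirce_simps additive_hom_add[OF g_additive] g_smult)

lemma f_peirce_hom: "f \<in> left_module_hom K (base.pc i j) (pc i j)"
proof (rule left_module_homI[OF additive_homI])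
  fix x assume x: "x \<in> carrier (base.pc i j)"
  then have "x \<in> carrier (pow_algebra K p)"
    "x = base.e i \<otimes>\<^bsub>pow_algebra K p\<^esub> x \<otimes>\<^bsub>pow_algebra K p\<^esub> base.e j" by (auto simp: base.peirce_carrier)
  then show "f x \<in> carrier (pc i j)"
    using f_compress[of x i j] peirce_compress[OF f_closed, of x i j] by simp
qed (auto simp: base.peirce_carrier peirce_simps base.peirce_simps additive_hom_add[OF f_additive] f_smult)

definition "rad = a_kernel R (pow_algebra K p) g"

lemma rad_iff: "r \<in> rad \<longleftrightarrow> r \<in> carrier R \<and> g r = \<zero>\<^bsub>pow_algebra K p\<^esub>"
  by (simp add: rad_def a_kernel_def')

text \<open>Since g f = 1, the augmentation splits and \<open>R\<close> is the sum of the image of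
  \<open>f\<close> and the radical; this is the radical component of r.\<close>

lemma minus_fg_rad: "r \<in> carrier R \<Longrightarrow> r \<ominus>\<^bsub>R\<^esub> f (g r) \<in> rad"
  using additive_hom_minus[OF S.abelian_group_axioms pow.abelian_group_axioms g_additive, of r "f (g r)"]
  by (simp add: rad_iff f_closed g_closed g_f pow.r_neg a_minus_def)

end

text \<open>Inside, the prefix \<open>X\<close> refers to matrices over \<open>R\<close> and
  \<open>Y\<close> to matrices over the power algebra, both with the same modules
  \<open>N\<close>.\<close>

locale reduction = augmented_algebra K R p f g + A: assoc_algebra K A
  for K :: "('k, 'u) ring_scheme" and A :: "('k, 'a) module" and p :: nat
    and R :: "('k, 'r) module" and f :: "(nat \<Rightarrow> 'k) \<Rightarrow> 'r" and g :: "'r \<Rightarrow> (nat \<Rightarrow> 'k)"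
    and N :: "nat \<Rightarrow> ('a, 'b) module" +
  assumes N_module: "i \<in> {1..p} \<Longrightarrow> left_module A (N i)"
begin

sublocale X: matrix_bimodule K A p R f N
  by (intro matrix_bimodule.intro matrix_bimodule_axioms.intro pointed_algebra_axioms
      A.assoc_algebra_axioms N_module)

sublocale Y: matrix_bimodule K A p "pow_algebra K p" id N
  by (intro matrix_bimodule.intro matrix_bimodule_axioms.intro base.pointed_algebra_axioms
      A.assoc_algebra_axioms N_module)

lemma down_map: "matrix_bimodule_map K A p R f N (pow_algebra K p) id N (\<lambda>_. id) (\<lambda>_ _. g)"
  by (intro matrix_bimodule_map.intro matrix_bimodule_map_axioms.intro X.matrix_bimodule_axioms
      Y.matrix_bimodule_axioms right_module_id_hom g_peirce_hom)

text \<open>The structure map \<open>f\<close> induces a map against the direction of reduction; it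
  splits reduction on rows and gives access to its kernel.\<close>

lemma up_map: "matrix_bimodule_map K A p (pow_algebra K p) id N R f N (\<lambda>_. id) (\<lambda>_ _. f)"
  by (intro matrix_bimodule_map.intro matrix_bimodule_map_axioms.intro X.matrix_bimodule_axioms
      Y.matrix_bimodule_axioms right_module_id_hom f_peirce_hom)

abbreviation "lft \<equiv> mat_map K A p R f N (\<lambda>_. id) (\<lambda>_ _. f)"

abbreviation "red \<equiv> mat_reduction K A p g N"

lemma red_eq: "red = mat_map K A p (pow_algebra K p) id N (\<lambda>_. id) (\<lambda>_ _. g)"
  by (simp add: mat_reduction_def mat_map_def fun_eq_iff)

lemma red_additive: "red \<in> additive_hom X.MM Y.MM"
  unfolding red_eq by (rule matrix_bimodule_map.map_additive[OF down_map])

lemma red_row: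
  "i \<in> X.I \<Longrightarrow> n \<in> carrier (N i) \<Longrightarrow> r \<in> carrier R \<Longrightarrow> red (X.row i n r) = Y.row i n (g r)"
  unfolding red_eq using matrix_bimodule_map.map_row[OF down_map, of i n r "g r"] by (simp add: g_compress g_closed)

lemma up_row:
  "i \<in> X.I \<Longrightarrow> n \<in> carrier (N i) \<Longrightarrow> x \<in> carrier (pow_algebra K p) \<Longrightarrow>
    lft (Y.row i n x) = X.row i n (f x)"
  using matrix_bimodule_map.map_row[OF up_map, of i n x "f x"] by (simp add: f_compress f_closed)

text \<open>For every x the difference of x and \<open>lft (red x)\<close> lies in the product of
  the module with the radical, as a check on rows shows. When x reduces to zero, the subtracted term
  vanishes and the difference is x itself.\<close>

lemma red_zero_mod_ideal:
  assumes x: "x \<in> carrier X.MM" and red: "red x = \<zero>\<^bsub>Y.MM\<^esub>"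
  shows "x \<in> mod_ideal R X.MM rad"
proof -
  let ?h = "\<lambda>x. lft (red x)"
  have h: "?h \<in> additive_hom X.MM X.MM"
    by (rule additive_hom_comp[OF red_additive matrix_bimodule_map.map_additive[OF up_map]])
  have h': "(\<lambda>x. x \<ominus>\<^bsub>X.MM\<^esub> ?h x) \<in> additive_hom X.MM X.MM"
    by (rule additive_hom_minus_fun[OF X.MM_abelian_group additive_hom_id h])
  have "x \<ominus>\<^bsub>X.MM\<^esub> ?h x \<in> mod_ideal R X.MM rad"
    using x
  proof (induction rule: X.MM_induct)
    case zero
    show ?case
      by (simp only: additive_hom_zero[OF X.MM_abelian_group X.MM_abelian_group h'] mod_ideal.zero)
  next
    case (add x y)
    then show ?case by (simp only: additive_hom_add[OF h' add(1,2)] mod_ideal.add)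
  next
    case (row i n r)
    have "X.row i n r \<ominus>\<^bsub>X.MM\<^esub> ?h (X.row i n r) = X.row i n (r \<ominus>\<^bsub>R\<^esub> f (g r))"
      using row additive_hom_minus[OF S.abelian_group_axioms X.MM_abelian_group X.row_additive_right]
      by (simp add: red_row up_row f_closed g_closed)
    \<comment> \<open>The radical element is moved out as a right factor of the row with second
      component 1, which exhibits a generator of the product.\<close>
    also have "\<dots> = rsmult X.MM (X.row i n \<one>\<^bsub>R\<^esub>) (r \<ominus>\<^bsub>R\<^esub> f (g r))"
      using row by (simp add: X.rsmult_row f_closed g_closed)
    also have "\<dots> \<in> mod_ideal R X.MM rad"
      using row minus_fg_rad by (intro mod_ideal.incl X.row_closed) (auto simp: f_closed g_closed)
    finally show ?case .
  qed
  moreover have "?h x = \<zero>\<^bsub>X.MM\<^esub>"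
    unfolding red by (rule additive_hom_zero[OF Y.MM_abelian_group X.MM_abelian_group matrix_bimodule_map.map_additive[OF up_map]])
  moreover have "x \<ominus>\<^bsub>X.MM\<^esub> \<zero>\<^bsub>X.MM\<^esub> = x"
    using additive_hom_zero[OF X.MM_abelian_group X.MM_abelian_group
        additive_hom_neg_fun[OF X.MM_abelian_group additive_hom_id]] x by (simp add: a_minus_def)
  ultimately show ?thesis by simp
qed

end

text \<open>Unfolding x = w + E x repeatedly writes x as a sum of elements of U plus a power of E
  applied to x, which is eventually zero. The set C allows the decomposition to hold only on part of
  the module, such as the cycles.\<close>

lemma absorb_nilpotent:
  assumes "U \<subseteq> carrier F" "\<zero>\<^bsub>F\<^esub> \<in> U" "\<And>x y. x \<in> U \<Longrightarrow> y \<in> U \<Longrightarrow> x \<oplus>\<^bsub>F\<^esub> y \<in> U"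
    and E: "\<And>x. x \<in> C \<Longrightarrow> E x \<in> C" "\<And>x. x \<in> C \<Longrightarrow> \<exists>w \<in> U. x = w \<oplus>\<^bsub>F\<^esub> E x"
    and "(E ^^ n) x = \<zero>\<^bsub>F\<^esub>" "x \<in> C"
  shows "x \<in> U"
  using assms(6,7)
proof (induction n arbitrary: x)
  case 0
  then show ?case using assms(2) by simp
next
  case (Suc n)
  have "E x \<in> U" using Suc E(1) by (simp add: funpow_swap1)
  then show ?case using E(2)[OF Suc.prems(2)] assms(3) by metis
qed

text \<open>The isomorphism constructed later starts at the matrices over \<open>M\<close> and ends
  at the zeroth cohomology, whereas a lifting is required to provide one in the opposite
  direction.\<close>

lemma right_module_iso_inverse:
  assumes M: "right_module R M" and N: "right_module R N" and h: "h \<in> right_module_iso R M N"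
  shows "inv_into (carrier M) h \<in> right_module_iso R N M"
proof -
  have hom: "h \<in> right_module_hom R M N" and bij: "bij_betw h (carrier M) (carrier N)"
    using h by (simp_all add: right_module_iso_def)
  let ?k = "inv_into (carrier M) h"
  have k: "?k y \<in> carrier M" "h (?k y) = y" if "y \<in> carrier N" for y
    using bij_betw_inv_into[OF bij] bij_betw_inv_into_right[OF bij that] that by (auto simp: bij_betw_def)
  have k_eq: "?k y = x" if "x \<in> carrier M" "h x = y" for x y
    using bij_betw_inv_into_left[OF bij that(1)] that(2) by simp
  have "?k \<in> right_module_hom R N M"
  proof (rule right_module_homI[OF additive_homI])
    fix y assume y: "y \<in> carrier N"
    show "?k y \<in> carrier M" by (rule k(1)[OF y])
    show "?k (y \<oplus>\<^bsub>N\<^esub> y') = ?k y \<oplus>\<^bsub>M\<^esub> ?k y'" if y': "y' \<in> carrier N" for y'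
      using k[OF y] k[OF y'] additive_hom_add[OF right_module_hom_additive[OF hom]]
        abelian_groupE(1)[OF right_module_abelian_group[OF M]] by (intro k_eq) simp_all
    show "?k (rsmult N y r) = rsmult M (?k y) r" if r: "r \<in> carrier R" for r
      using k[OF y] right_module_hom_smult[OF hom r] right_module.right_closed[OF M r]
      by (intro k_eq) simp_all
  qed
  then show ?thesis using bij_betw_inv_into[OF bij] by (simp add: right_module_iso_def)
qed

section \<open>Quotient bimodules\<close>

locale sub_bimodule =
  fixes K :: "('k, 'u) ring_scheme" and A :: "('k, 'a, 'v) module_scheme"
    and R :: "('k, 'r, 'w) module_scheme" and M :: "('a, 'r, 'b) bimodule" and U :: "'b set"
  assumes M: "is_bimodule K A R M"
    and U: "additive_subgroup U M"
    and U_left: "\<And>a x. a \<in> carrier A \<Longrightarrow> x \<in> U \<Longrightarrow> a \<odot>\<^bsub>M\<^esub> x \<in> U"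
    and U_right: "\<And>r x. r \<in> carrier R \<Longrightarrow> x \<in> U \<Longrightarrow> rsmult M x r \<in> U"
begin

lemma M_left: "left_module A M" and M_right: "right_module R M"
  using M by (simp_all add: is_bimodule_def)

sublocale Mg: abelian_group M by (rule left_module_abelian_group[OF M_left])

sublocale U: abelian_subgroup U M by (rule abelian_subgroupI3[OF U Mg.abelian_group_axioms])

abbreviation "Q \<equiv> quot_bimodule M U"

definition "q x = U +>\<^bsub>M\<^esub> x"

lemma Q_simps:
  "carrier Q = a_rcosets\<^bsub>M\<^esub> U" "\<zero>\<^bsub>Q\<^esub> = U" "add Q = set_add M"
  "a \<odot>\<^bsub>Q\<^esub> W = (\<Union>x\<in>W. q (a \<odot>\<^bsub>M\<^esub> x))" "rsmult Q W r = (\<Union>x\<in>W. q (rsmult M x r))"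
  by (simp_all add: quot_bimodule_def q_def)

lemma q_closed: "x \<in> carrier M \<Longrightarrow> q x \<in> carrier Q"
  unfolding q_def Q_simps by (rule Mg.a_rcosetsI[OF U.a_subset])

lemma Q_cases:
  assumes "W \<in> carrier Q"
  obtains x where "x \<in> carrier M" "W = q x"
  using assms unfolding Q_simps A_RCOSETS_def' q_def a_r_coset_def' by blast

lemma q_add: "x \<in> carrier M \<Longrightarrow> y \<in> carrier M \<Longrightarrow> q (x \<oplus>\<^bsub>M\<^esub> y) = q x \<oplus>\<^bsub>Q\<^esub> q y"
  unfolding q_def Q_simps by (rule U.a_rcos_sum[symmetric])

lemma q_self: "x \<in> carrier M \<Longrightarrow> x \<in> q x"
  unfolding q_def by (rule U.a_rcos_self)

lemma q_zero: "x \<in> U \<Longrightarrow> q x = \<zero>\<^bsub>Q\<^esub>"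
  unfolding q_def Q_simps using Mg.a_coset_join2[OF _ U.a_subgroup] U.a_subset by blast

lemma q_zero_mem: "x \<in> carrier M \<Longrightarrow> q x = \<zero>\<^bsub>Q\<^esub> \<Longrightarrow> x \<in> U"
  using q_self[of x] by (simp add: Q_simps)

lemma Q_abelian_group: "abelian_group Q"
proof -
  have z: "\<zero>\<^bsub>Q\<^esub> = q \<zero>\<^bsub>M\<^esub>" using q_zero[OF U.zero_closed] by simp
  show ?thesis
  proof (rule abelian_groupI)
    fix W assume "W \<in> carrier Q"
    then obtain x where x: "x \<in> carrier M" "W = q x" by (rule Q_cases)
    show "\<zero>\<^bsub>Q\<^esub> \<oplus>\<^bsub>Q\<^esub> W = W" using x by (simp add: z q_add[symmetric])
    show "\<exists>V \<in> carrier Q. V \<oplus>\<^bsub>Q\<^esub> W = \<zero>\<^bsub>Q\<^esub>"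
      using x by (intro bexI[of _ "q (\<ominus>\<^bsub>M\<^esub> x)"]) (simp_all add: z q_add[symmetric] q_closed Mg.l_neg)
    fix V assume "V \<in> carrier Q"
    then obtain y where y: "y \<in> carrier M" "V = q y" by (rule Q_cases)
    show "W \<oplus>\<^bsub>Q\<^esub> V \<in> carrier Q" using x y by (simp add: q_add[symmetric] q_closed)
    show "W \<oplus>\<^bsub>Q\<^esub> V = V \<oplus>\<^bsub>Q\<^esub> W" using x y by (simp add: q_add[symmetric] Mg.a_comm)
    fix T assume "T \<in> carrier Q"
    then obtain t where t: "t \<in> carrier M" "T = q t" by (rule Q_cases)
    show "W \<oplus>\<^bsub>Q\<^esub> V \<oplus>\<^bsub>Q\<^esub> T = W \<oplus>\<^bsub>Q\<^esub> (V \<oplus>\<^bsub>Q\<^esub> T)"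
      using x y t by (simp add: q_add[symmetric] Mg.a_assoc)
  qed (simp add: z q_closed)
qed

lemma q_additive: "q \<in> additive_hom M Q"
  by (rule additive_homI) (simp_all add: q_closed q_add)

lemma q_mem:
  assumes "x \<in> carrier M" "y \<in> q x"
  obtains u where "u \<in> U" "y = u \<oplus>\<^bsub>M\<^esub> x"
  using assms(2) unfolding q_def a_r_coset_def' by blast

text \<open>The actions on a quotient are defined as unions over all representatives. A map that
  preserves \<open>U\<close> sends a coset into one coset, so the union collapses and the action can
  be computed on any representative.\<close>

lemma q_map:
  assumes h: "h \<in> additive_hom M M" "\<And>u. u \<in> U \<Longrightarrow> h u \<in> U" and x: "x \<in> carrier M"
  shows "(\<Union>y\<in>q x. q (h y)) = q (h x)"
proof -
  have "q (h y) = q (h x)" if y: "y \<in> q x" for y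
  proof -
    obtain u where u: "u \<in> U" "y = u \<oplus>\<^bsub>M\<^esub> x" by (rule q_mem[OF x y])
    have hu: "h u \<in> carrier M" by (rule U.a_Hcarr[OF h(2)[OF u(1)]])
    show ?thesis
      unfolding u(2) additive_hom_add[OF h(1) U.a_Hcarr[OF u(1)] x]
        q_add[OF hu additive_hom_closed[OF h(1) x]] q_zero[OF h(2)[OF u(1)]]
      by (rule abelian_groupE(5)[OF Q_abelian_group q_closed[OF additive_hom_closed[OF h(1) x]]])
  qed
  then show ?thesis using q_self[OF x] by blast
qed

lemma q_smult: "a \<in> carrier A \<Longrightarrow> x \<in> carrier M \<Longrightarrow> a \<odot>\<^bsub>Q\<^esub> q x = q (a \<odot>\<^bsub>M\<^esub> x)"
  unfolding Q_simps by (rule q_map[OF left_module_smult_additive[OF M_left] U_left])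

lemma q_rsmult: "r \<in> carrier R \<Longrightarrow> x \<in> carrier M \<Longrightarrow> rsmult Q (q x) r = q (rsmult M x r)"
  unfolding Q_simps by (rule q_map[OF right_module_smult_additive[OF M_right] U_right])

lemma Q_left_module: "left_module A Q"
proof (rule left_moduleI[OF _ Q_abelian_group])
  interpret left_module A M by (rule M_left)
  show "ring A" ..
  fix a assume a: "a \<in> carrier A"
  show "(\<lambda>W. a \<odot>\<^bsub>Q\<^esub> W) \<in> additive_hom Q Q"
    by (rule additive_homI) (auto elim!: Q_cases simp: q_smult a q_closed left_closed left_add q_add[symmetric])
next
  interpret left_module A M by (rule M_left)
  fix W assume "W \<in> carrier Q"
  then obtain x where x: "x \<in> carrier M" "W = q x" by (rule Q_cases)
  show "\<one>\<^bsub>A\<^esub> \<odot>\<^bsub>Q\<^esub> W = W" using x by (simp add: q_smult left_one)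
  fix a b assume ab: "a \<in> carrier A" "b \<in> carrier A"
  show "(a \<oplus>\<^bsub>A\<^esub> b) \<odot>\<^bsub>Q\<^esub> W = a \<odot>\<^bsub>Q\<^esub> W \<oplus>\<^bsub>Q\<^esub> b \<odot>\<^bsub>Q\<^esub> W"
    using x ab by (simp add: q_smult left_add_scalar left_closed q_add)
  show "(a \<otimes>\<^bsub>A\<^esub> b) \<odot>\<^bsub>Q\<^esub> W = a \<odot>\<^bsub>Q\<^esub> (b \<odot>\<^bsub>Q\<^esub> W)"
    using x ab by (simp add: q_smult left_assoc left_closed)
qed

lemma Q_right_module: "right_module R Q"
proof (rule right_moduleI[OF _ Q_abelian_group])
  interpret right_module R M by (rule M_right)
  show "ring R" ..
  fix r assume r: "r \<in> carrier R"
  show "(\<lambda>W. rsmult Q W r) \<in> additive_hom Q Q"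
    by (rule additive_homI) (auto elim!: Q_cases simp: q_rsmult r q_closed right_closed right_add q_add[symmetric])
next
  interpret right_module R M by (rule M_right)
  fix W assume "W \<in> carrier Q"
  then obtain x where x: "x \<in> carrier M" "W = q x" by (rule Q_cases)
  show "rsmult Q W \<one>\<^bsub>R\<^esub> = W" using x by (simp add: q_rsmult right_one)
  fix r s assume rs: "r \<in> carrier R" "s \<in> carrier R"
  show "rsmult Q W (r \<oplus>\<^bsub>R\<^esub> s) = rsmult Q W r \<oplus>\<^bsub>Q\<^esub> rsmult Q W s"
    using x rs by (simp add: q_rsmult right_add_scalar right_closed q_add)
  show "rsmult Q W (r \<otimes>\<^bsub>R\<^esub> s) = rsmult Q (rsmult Q W r) s"
    using x rs by (simp add: q_rsmult right_assoc right_closed)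
qed

lemma Q_is_bimodule:
  assumes A: "assoc_algebra K A" and R: "assoc_algebra K R"
  shows "is_bimodule K A R Q"
  unfolding is_bimodule_def
proof (intro conjI ballI Q_left_module Q_right_module)
  interpret A: assoc_algebra K A by (rule A)
  interpret R: assoc_algebra K R by (rule R)
  fix W assume "W \<in> carrier Q"
  then obtain x where x: "x \<in> carrier M" "W = q x" by (rule Q_cases)
  show "a \<odot>\<^bsub>Q\<^esub> rsmult Q W r = rsmult Q (a \<odot>\<^bsub>Q\<^esub> W) r" if ar: "a \<in> carrier A" "r \<in> carrier R" for a r
    using x ar M left_module.left_closed[OF M_left] right_module.right_closed[OF M_right]
    by (simp add: is_bimodule_def q_smult q_rsmult)
  show "(c \<odot>\<^bsub>A\<^esub> \<one>\<^bsub>A\<^esub>) \<odot>\<^bsub>Q\<^esub> W = rsmult Q W (c \<odot>\<^bsub>R\<^esub> \<one>\<^bsub>R\<^esub>)" if c: "c \<in> carrier K" for c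
    using x c M by (simp add: is_bimodule_def q_smult q_rsmult)
qed

end

lemma linear_section_hom:
  assumes "h \<in> right_module_hom K V W" "linear_section_of K V W h \<sigma>"
  shows "(\<lambda>x. \<sigma> (h x)) \<in> right_module_hom K V V"
  using assms by (simp add: linear_section_of_def right_module_hom_def Pi_iff)

text \<open>Extending a section \<open>\<tau>\<close> of \<open>\<beta>\<close> by one step: subtracting \<open>\<tau> \<circ> \<beta>\<close> lands in the kernel of \<open>\<beta>\<close>,
  hence in the image of \<open>\<alpha>\<close>, where the section \<open>\<sigma>\<close> of \<open>\<alpha>\<close> applies.\<close>

lemma contraction_step:
  assumes V: "right_module K V" and W: "right_module K W" and T: "right_module K T"
    and \<alpha>: "\<alpha> \<in> right_module_hom K V W" and \<beta>: "\<beta> \<in> right_module_hom K W T"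
    and exact: "\<And>y. y \<in> carrier W \<Longrightarrow> \<beta> y = \<zero>\<^bsub>T\<^esub> \<longleftrightarrow> y \<in> \<alpha> ` carrier V"
    and \<sigma>: "linear_section_of K V W \<alpha> \<sigma>" and \<tau>: "linear_section_of K W T \<beta> \<tau>"
  obtains s where "s \<in> right_module_hom K W V"
    "\<And>y. y \<in> carrier W \<Longrightarrow> \<alpha> (s y) \<oplus>\<^bsub>W\<^esub> \<tau> (\<beta> y) = y"
    "\<And>x. x \<in> carrier V \<Longrightarrow> s (\<alpha> x) = \<sigma> (\<alpha> x)"
    "\<And>y. y \<in> carrier W \<Longrightarrow> s (\<tau> (\<beta> y)) = \<zero>\<^bsub>V\<^esub>"
proof -
  note Vab = right_module_abelian_group[OF V] and Wab = right_module_abelian_group[OF W]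
    and Tab = right_module_abelian_group[OF T]
  interpret Vg: abelian_group V by (rule Vab)
  interpret Wg: abelian_group W by (rule Wab)
  interpret Tg: abelian_group T by (rule Tab)
  note \<alpha>a = right_module_hom_additive[OF \<alpha>] and \<beta>a = right_module_hom_additive[OF \<beta>]
  \<comment> \<open>The projection onto the kernel of \<beta> along the image of \<tau>. It kills
    that image, which gives the last property of s.\<close>
  define \<pi> where "\<pi> y = y \<ominus>\<^bsub>W\<^esub> \<tau> (\<beta> y)" for y
  have \<tau>\<beta>: "(\<lambda>y. \<tau> (\<beta> y)) \<in> right_module_hom K W W" by (rule linear_section_hom[OF \<beta> \<tau>])
  have \<tau>\<beta>a: "(\<lambda>y. \<tau> (\<beta> y)) \<in> additive_hom W W" by (rule right_module_hom_additive[OF \<tau>\<beta>])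
  have \<tau>\<beta>c: "\<tau> (\<beta> y) \<in> carrier W" if "y \<in> carrier W" for y using additive_hom_closed[OF \<tau>\<beta>a that] .
  have \<beta>\<tau>: "\<beta> (\<tau> (\<beta> y)) = \<beta> y" if "y \<in> carrier W" for y
    using \<tau> that by (simp add: linear_section_of_def)
  have \<pi>a: "\<pi> \<in> additive_hom W W"
    unfolding \<pi>_def[abs_def] by (rule additive_hom_minus_fun[OF Wab additive_hom_id \<tau>\<beta>a])
  have \<pi>c: "\<pi> y \<in> carrier W" if "y \<in> carrier W" for y using additive_hom_closed[OF \<pi>a that] .
  have \<pi>_smult: "\<pi> (rsmult W y c) = rsmult W (\<pi> y) c" if "y \<in> carrier W" "c \<in> carrier K" for y c
    using additive_hom_minus[OF Wab Wab right_module_smult_additive[OF W that(2)] that(1) \<tau>\<beta>c[OF that(1)]]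
      right_module_hom_smult[OF \<tau>\<beta> that(2,1)] by (simp add: \<pi>_def)
  have \<pi>_im: "\<exists>x \<in> carrier V. \<pi> y = \<alpha> x" if y: "y \<in> carrier W" for y
  proof -
    have "\<beta> (\<pi> y) = \<zero>\<^bsub>T\<^esub>"
      using additive_hom_minus[OF Wab Tab \<beta>a y \<tau>\<beta>c[OF y]] \<beta>\<tau>[OF y] additive_hom_closed[OF \<beta>a y]
      by (simp add: \<pi>_def a_minus_def Tg.r_neg)
    then show ?thesis using exact[OF \<pi>c[OF y]] by blast
  qed
  have \<beta>\<alpha>: "\<beta> (\<alpha> x) = \<zero>\<^bsub>T\<^esub>" if "x \<in> carrier V" for x
    using exact[OF additive_hom_closed[OF \<alpha>a that]] that by blast
  have \<tau>0: "\<tau> \<zero>\<^bsub>T\<^esub> = \<zero>\<^bsub>W\<^esub>"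
    using additive_hom_zero[OF Wab Wab \<tau>\<beta>a] additive_hom_zero[OF Wab Tab \<beta>a] by simp
  have minus0: "y \<ominus>\<^bsub>W\<^esub> \<zero>\<^bsub>W\<^esub> = y" if "y \<in> carrier W" for y
    using additive_hom_zero[OF Wab Wab additive_hom_neg_fun[OF Wab additive_hom_id]] that
    by (simp add: a_minus_def)
  have \<sigma>0: "\<sigma> \<zero>\<^bsub>W\<^esub> = \<zero>\<^bsub>V\<^esub>"
    using additive_hom_zero[OF Vab Vab right_module_hom_additive[OF linear_section_hom[OF \<alpha> \<sigma>]]]
      additive_hom_zero[OF Vab Wab \<alpha>a] by simp
  show ?thesis
  proof (rule that[of "\<lambda>y. \<sigma> (\<pi> y)"])
    show "(\<lambda>y. \<sigma> (\<pi> y)) \<in> right_module_hom K W V"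
    proof (rule right_module_homI[OF additive_homI])
      fix y assume y: "y \<in> carrier W"
      obtain x where x: "x \<in> carrier V" "\<pi> y = \<alpha> x" using \<pi>_im[OF y] by blast
      show "\<sigma> (\<pi> y) \<in> carrier V" using x \<sigma> by (simp add: linear_section_of_def)
      show "\<sigma> (\<pi> (y \<oplus>\<^bsub>W\<^esub> y')) = \<sigma> (\<pi> y) \<oplus>\<^bsub>V\<^esub> \<sigma> (\<pi> y')" if y': "y' \<in> carrier W" for y'
      proof -
        obtain x' where x': "x' \<in> carrier V" "\<pi> y' = \<alpha> x'" using \<pi>_im[OF y'] by blast
        then show ?thesis using x \<sigma> by (simp add: linear_section_of_def additive_hom_add[OF \<pi>a y y'])
      qed
      show "\<sigma> (\<pi> (rsmult W y c)) = rsmult V (\<sigma> (\<pi> y)) c" if c: "c \<in> carrier K" for c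
        using x \<sigma> c by (simp add: linear_section_of_def \<pi>_smult[OF y c])
    qed
  next
    fix y assume y: "y \<in> carrier W"
    obtain x where x: "x \<in> carrier V" "\<pi> y = \<alpha> x" using \<pi>_im[OF y] by blast
    then have "\<alpha> (\<sigma> (\<pi> y)) = \<pi> y" using \<sigma> by (simp add: linear_section_of_def)
    then show "\<alpha> (\<sigma> (\<pi> y)) \<oplus>\<^bsub>W\<^esub> \<tau> (\<beta> y) = y"
      using y \<tau>\<beta>c[OF y] by (simp add: \<pi>_def a_minus_def Wg.a_assoc Wg.l_neg)
    have "\<pi> (\<tau> (\<beta> y)) = \<zero>\<^bsub>W\<^esub>" using \<beta>\<tau>[OF y] \<tau>\<beta>c[OF y] by (simp add: \<pi>_def a_minus_def Wg.r_neg)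
    then show "\<sigma> (\<pi> (\<tau> (\<beta> y))) = \<zero>\<^bsub>V\<^esub>" using \<sigma>0 by simp
  next
    fix x assume x: "x \<in> carrier V"
    have "\<pi> (\<alpha> x) = \<alpha> x"
      unfolding \<pi>_def \<beta>\<alpha>[OF x] \<tau>0 by (rule minus0[OF additive_hom_closed[OF \<alpha>a x]])
    then show "\<sigma> (\<pi> (\<alpha> x)) = \<sigma> (\<alpha> x)" by simp
  qed
qed

lemma algebra_left_moduleI: "assoc_algebra K A \<Longrightarrow> left_module A N \<Longrightarrow> algebra_left_module K A N"
  by (simp add: algebra_left_module_def)

lemma left_module_hom_base:
  assumes "assoc_algebra K A" "h \<in> left_module_hom A M N"
  shows "h \<in> right_module_hom K (base_bimodule A M) (base_bimodule A N)"
proof -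
  interpret A: assoc_algebra K A by fact
  show ?thesis
    using assms(2) by (auto simp: right_module_hom_def left_module_hom_def base_bimodule_simps)
qed

section \<open>Contractions of resolutions and their perturbation\<close>

text \<open>The maps \<open>t\<close> and \<open>s\<close> are typed over \<open>K\<close> through
  \<open>base_bimodule\<close>, since no \<open>A\<close>-linear contraction can be expected. The
  last clause normalises the contraction; it is what keeps D z fixed under the iteration in
  \<open>tR_D_zero\<close>.\<close>

definition contraction where
  "contraction K A M L d \<epsilon> t s \<longleftrightarrow>
    t \<in> right_module_hom K (base_bimodule A M) (base_bimodule A (L 0)) \<and>
    (\<forall>m. s m \<in> right_module_hom K (base_bimodule A (L m)) (base_bimodule A (L (Suc m)))) \<and>
    (\<forall>y \<in> carrier M. \<epsilon> (t y) = y) \<and>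
    (\<forall>x \<in> carrier (L 0). d 0 (s 0 x) \<oplus>\<^bsub>L 0\<^esub> t (\<epsilon> x) = x) \<and>
    (\<forall>m. \<forall>x \<in> carrier (L (Suc m)). d (Suc m) (s (Suc m) x) \<oplus>\<^bsub>L (Suc m)\<^esub> s m (d m x) = x) \<and>
    (\<forall>y \<in> carrier M. s 0 (t y) = \<zero>\<^bsub>L 1\<^esub>)"

text \<open>Sections of the augmentation and of all differentials are chosen independently, and
  \<open>contraction_step\<close> is applied to each pair of consecutive maps. The resulting
  homotopies agree with the chosen sections on the images of the differentials, so the separate
  identities fit together.\<close>

lemma resolution_contraction:
  assumes K: "field K" and A: "assoc_algebra K A" and M: "left_module A M"
    and res: "free_resolution A L d \<epsilon> M"
  shows "\<exists>t s. contraction K A M L d \<epsilon> t s"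
proof -
  interpret A: assoc_algebra K A by (rule A)
  let ?B = "base_bimodule A"
  have L: "left_module A (L m)" for m using res by (simp add: free_resolution_def free_module_def)
  have LR: "right_module K (?B (L m))" for m
    by (rule algebra_left_module.base_right_module[OF algebra_left_moduleI[OF A L]])
  have MR: "right_module K (?B M)"
    by (rule algebra_left_module.base_right_module[OF algebra_left_moduleI[OF A M]])
  have dR: "d m \<in> right_module_hom K (?B (L (Suc m))) (?B (L m))" for m
    using res by (intro left_module_hom_base[OF A]) (simp add: free_resolution_def)
  have \<epsilon>R: "\<epsilon> \<in> right_module_hom K (?B (L 0)) (?B M)"
    using res by (intro left_module_hom_base[OF A]) (simp add: free_resolution_def)
  have surj: "\<exists>x \<in> carrier (?B (L 0)). y = \<epsilon> x" if "y \<in> carrier M" for y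
    using res that by (auto simp: free_resolution_def base_bimodule_simps)
  have ex0: "\<epsilon> y = \<zero>\<^bsub>?B M\<^esub> \<longleftrightarrow> y \<in> d 0 ` carrier (?B (L 1))" if "y \<in> carrier (?B (L 0))" for y
  proof -
    have "a_kernel (L 0) M \<epsilon> = d 0 ` carrier (L 1)" using res by (simp add: free_resolution_def)
    then show ?thesis using that by (auto simp: a_kernel_def' base_bimodule_simps)
  qed
  have exS: "d m y = \<zero>\<^bsub>?B (L m)\<^esub> \<longleftrightarrow> y \<in> d (Suc m) ` carrier (?B (L (Suc (Suc m))))"
    if "y \<in> carrier (?B (L (Suc m)))" for y m
  proof -
    have "a_kernel (L (Suc m)) (L m) (d m) = d (Suc m) ` carrier (L (Suc (Suc m)))"
      using res by (simp add: free_resolution_def)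
    then show ?thesis using that by (auto simp: a_kernel_def' base_bimodule_simps)
  qed
  obtain t where t: "linear_section_of K (?B (L 0)) (?B M) \<epsilon> t"
    using linear_section_exists[OF K LR MR \<epsilon>R] by blast
  have "\<forall>m. \<exists>\<sigma>. linear_section_of K (?B (L (Suc m))) (?B (L m)) (d m) \<sigma>"
    using linear_section_exists[OF K LR LR dR] by blast
  then obtain \<sigma> where \<sigma>: "\<And>m. linear_section_of K (?B (L (Suc m))) (?B (L m)) (d m) (\<sigma> m)" by metis
  obtain s0 where s0: "s0 \<in> right_module_hom K (?B (L 0)) (?B (L (Suc 0)))"
    "\<And>y. y \<in> carrier (?B (L 0)) \<Longrightarrow> d 0 (s0 y) \<oplus>\<^bsub>?B (L 0)\<^esub> t (\<epsilon> y) = y"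
    "\<And>x. x \<in> carrier (?B (L (Suc 0))) \<Longrightarrow> s0 (d 0 x) = \<sigma> 0 (d 0 x)"
    "\<And>y. y \<in> carrier (?B (L 0)) \<Longrightarrow> s0 (t (\<epsilon> y)) = \<zero>\<^bsub>?B (L (Suc 0))\<^esub>"
    by (rule contraction_step[OF LR LR MR dR \<epsilon>R ex0[unfolded One_nat_def] \<sigma> t], assumption, rule that)
  let ?step = "\<lambda>m s. s \<in> right_module_hom K (?B (L (Suc m))) (?B (L (Suc (Suc m)))) \<and>
      (\<forall>y \<in> carrier (?B (L (Suc m))). d (Suc m) (s y) \<oplus>\<^bsub>?B (L (Suc m))\<^esub> \<sigma> m (d m y) = y) \<and>
      (\<forall>x \<in> carrier (?B (L (Suc (Suc m)))). s (d (Suc m) x) = \<sigma> (Suc m) (d (Suc m) x))"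
  have "\<exists>s. ?step m s" for m
    by (rule contraction_step[OF LR LR LR dR dR exS \<sigma> \<sigma>], assumption) blast
  then obtain s' where "\<And>m. ?step m (s' m)" by metis
  then have s': "\<And>m. s' m \<in> right_module_hom K (?B (L (Suc m))) (?B (L (Suc (Suc m))))"
    "\<And>m y. y \<in> carrier (?B (L (Suc m))) \<Longrightarrow>
      d (Suc m) (s' m y) \<oplus>\<^bsub>?B (L (Suc m))\<^esub> \<sigma> m (d m y) = y"
    "\<And>m x. x \<in> carrier (?B (L (Suc (Suc m)))) \<Longrightarrow> s' m (d (Suc m) x) = \<sigma> (Suc m) (d (Suc m) x)"
    by simp_all
  \<comment> \<open>The map \<open>s' k\<close> starts in degree k + 1; degree 0 is separate because
    there the second map is the augmentation.\<close>
  define s where "s m = (case m of 0 \<Rightarrow> s0 | Suc k \<Rightarrow> s' k)" for m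
  \<comment> \<open>This replaces the section in the identity of the next degree by the homotopy
    itself, turning it into d s + s d = 1.\<close>
  have sd: "s m (d m x) = \<sigma> m (d m x)" if "x \<in> carrier (?B (L (Suc m)))" for m x
    using s0(3) s'(3) that by (cases m) (auto simp: s_def)
  have \<epsilon>t: "\<epsilon> (t y) = y" "t y \<in> carrier (?B (L 0))" if "y \<in> carrier M" for y
    using surj[OF that] t by (auto simp: linear_section_of_def)
  have "contraction K A M L d \<epsilon> t s"
    unfolding contraction_def
  proof (intro conjI allI ballI)
    \<comment> \<open>A section is known to be linear only on the image of \<epsilon>, but
      \<epsilon> is onto, so every argument has the form \<epsilon> x.\<close>
    show "t \<in> right_module_hom K (?B M) (?B (L 0))"
    proof (rule right_module_homI[OF additive_homI])
      fix y assume "y \<in> carrier (?B M)"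
      then have y: "y \<in> carrier M" by (simp add: base_bimodule_simps)
      show "t y \<in> carrier (?B (L 0))" by (rule \<epsilon>t(2)[OF y])
      obtain x where x: "x \<in> carrier (?B (L 0))" "y = \<epsilon> x" using surj[OF y] by blast
      show "t (y \<oplus>\<^bsub>?B M\<^esub> y') = t y \<oplus>\<^bsub>?B (L 0)\<^esub> t y'" if "y' \<in> carrier (?B M)" for y'
      proof -
        obtain x' where x': "x' \<in> carrier (?B (L 0))" "y' = \<epsilon> x'"
          using surj[of y'] \<open>y' \<in> carrier (?B M)\<close> by (auto simp: base_bimodule_simps)
        show ?thesis using t x x' unfolding linear_section_of_def by blast
      qed
      show "t (rsmult (?B M) y c) = rsmult (?B (L 0)) (t y) c" if "c \<in> carrier K" for c
        using t x that unfolding linear_section_of_def by blast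
    qed
    show "s m \<in> right_module_hom K (?B (L m)) (?B (L (Suc m)))" for m
      using s0(1) s'(1) by (cases m) (auto simp: s_def)
    show "\<epsilon> (t y) = y" if "y \<in> carrier M" for y by (rule \<epsilon>t(1)[OF that])
    show "d 0 (s 0 x) \<oplus>\<^bsub>L 0\<^esub> t (\<epsilon> x) = x" if "x \<in> carrier (L 0)" for x
      using s0(2)[of x] that by (simp add: s_def base_bimodule_simps)
    show "d (Suc m) (s (Suc m) x) \<oplus>\<^bsub>L (Suc m)\<^esub> s m (d m x) = x" if "x \<in> carrier (L (Suc m))" for m x
      using s'(2)[of x m] sd[of x m] that by (simp add: s_def base_bimodule_simps)
    show "s 0 (t y) = \<zero>\<^bsub>L 1\<^esub>" if "y \<in> carrier M" for y
      using surj[OF that] s0(4) by (auto simp: s_def base_bimodule_simps)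
  qed
  then show ?thesis by blast
qed

section \<open>Maps of matrices induced by linear maps of the coefficient modules\<close>

text \<open>The same family h is extended over \<open>R\<close> and over the power algebra, so that
  its compatibility with reduction can be stated. The maps h are only \<open>K\<close>-linear, to
  admit the contractions.\<close>

locale reduction_map = N: reduction K A p R f g N + N': reduction K A p R f g N'
  for K :: "('k, 'u) ring_scheme" and A :: "('k, 'a) module" and p :: nat
    and R :: "('k, 'r) module" and f :: "(nat \<Rightarrow> 'k) \<Rightarrow> 'r" and g :: "'r \<Rightarrow> (nat \<Rightarrow> 'k)"
    and N :: "nat \<Rightarrow> ('a, 'b) module" and N' :: "nat \<Rightarrow> ('a, 'c) module" +
  fixes h :: "nat \<Rightarrow> 'b \<Rightarrow> 'c"
  assumes h_hom: "i \<in> {1..p} \<Longrightarrow>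
    h i \<in> right_module_hom K (base_bimodule A (N i)) (base_bimodule A (N' i))"
begin

abbreviation "hR \<equiv> mat_map K A p R f N' h (\<lambda>_ _. id)"
abbreviation "hk \<equiv> mat_map K A p (pow_algebra K p) id N' h (\<lambda>_ _. id)"

lemma hR_map: "matrix_bimodule_map K A p R f N R f N' h (\<lambda>_ _. id)"
  by (intro matrix_bimodule_map.intro matrix_bimodule_map_axioms.intro N.X.matrix_bimodule_axioms
      N'.X.matrix_bimodule_axioms left_module_id_hom h_hom)

lemma hk_map: "matrix_bimodule_map K A p (pow_algebra K p) id N (pow_algebra K p) id N' h (\<lambda>_ _. id)"
  by (intro matrix_bimodule_map.intro matrix_bimodule_map_axioms.intro N.Y.matrix_bimodule_axioms
      N'.Y.matrix_bimodule_axioms left_module_id_hom h_hom)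

lemma h_closed: "i \<in> {1..p} \<Longrightarrow> n \<in> carrier (N i) \<Longrightarrow> h i n \<in> carrier (N' i)"
  by (rule matrix_bimodule_map.h_closed[OF hR_map])

lemma hR_additive: "hR \<in> additive_hom N.X.MM N'.X.MM"
  by (rule matrix_bimodule_map.map_additive[OF hR_map])

lemma hk_additive: "hk \<in> additive_hom N.Y.MM N'.Y.MM"
  by (rule matrix_bimodule_map.map_additive[OF hk_map])

lemma hR_row:
  "i \<in> {1..p} \<Longrightarrow> n \<in> carrier (N i) \<Longrightarrow> r \<in> carrier R \<Longrightarrow> hR (N.X.row i n r) = N'.X.row i (h i n) r"
  by (rule matrix_bimodule_map.map_row[OF hR_map]) simp_all

lemma hk_row:
  "i \<in> {1..p} \<Longrightarrow> n \<in> carrier (N i) \<Longrightarrow> x \<in> carrier (pow_algebra K p) \<Longrightarrow>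
    hk (N.Y.row i n x) = N'.Y.row i (h i n) x"
  by (rule matrix_bimodule_map.map_row[OF hk_map]) simp_all

text \<open>The ring acts on the second tensor factor and h on the first, so
  \<open>K\<close>-linearity of h already gives right \<open>R\<close>-linearity.\<close>

lemma hR_hom: "hR \<in> right_module_hom R N.X.MM N'.X.MM"
proof (rule right_module_homI[OF hR_additive])
  fix r x assume r: "r \<in> carrier R" and x: "x \<in> carrier N.X.MM"
  show "hR (rsmult N.X.MM x r) = rsmult N'.X.MM (hR x) r"
    by (rule N.X.row_eqI[OF N'.X.MM_abelian_group additive_hom_comp[OF N.X.rsmult_additive[OF r] hR_additive]
          additive_hom_comp[OF hR_additive N'.X.rsmult_additive[OF r]] _ x])
      (simp only: N.X.rsmult_row N'.X.rsmult_row hR_row h_closed r N.S.m_closed)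
qed

lemma red_hR:
  assumes x: "x \<in> carrier N.X.MM"
  shows "N'.red (hR x) = hk (N.red x)"
  by (rule N.X.row_eqI[OF N'.Y.MM_abelian_group additive_hom_comp[OF hR_additive N'.red_additive]
        additive_hom_comp[OF N.red_additive hk_additive] _ x])
    (simp only: hR_row hk_row N.red_row N'.red_row h_closed N.g_closed)

end

lemma right_module_hom_comp:
  "h \<in> right_module_hom R M N \<Longrightarrow> h' \<in> right_module_hom R N T \<Longrightarrow> (\<lambda>x. h' (h x)) \<in> right_module_hom R M T"
  by (auto simp: right_module_hom_def Pi_iff)

lemma right_module_hom_minus_fun:
  assumes N: "right_module R N" and h: "h \<in> right_module_hom R M N" "h' \<in> right_module_hom R M N"
  shows "(\<lambda>x. h x \<ominus>\<^bsub>N\<^esub> h' x) \<in> right_module_hom R M N"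
proof (rule right_module_homI)
  note ab = right_module_abelian_group[OF N]
  show "(\<lambda>x. h x \<ominus>\<^bsub>N\<^esub> h' x) \<in> additive_hom M N"
    using h by (intro additive_hom_minus_fun ab right_module_hom_additive)
  fix r x assume r: "r \<in> carrier R" and x: "x \<in> carrier M"
  show "h (rsmult M x r) \<ominus>\<^bsub>N\<^esub> h' (rsmult M x r) = rsmult N (h x \<ominus>\<^bsub>N\<^esub> h' x) r"
    using additive_hom_minus[OF ab ab right_module_smult_additive[OF N r], of "h x" "h' x"]
      right_module_hom_smult[OF h(1) r x] right_module_hom_smult[OF h(2) r x]
      additive_hom_closed[OF right_module_hom_additive[OF h(1)] x]
      additive_hom_closed[OF right_module_hom_additive[OF h(2)] x] by simp
qed

lemma (in abelian_group) minus_minus_cancel: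
  assumes "a \<in> carrier G" "b \<in> carrier G" "x \<in> carrier G"
  shows "x = a \<oplus> b \<oplus> (x \<ominus> a \<ominus> b)"
proof -
  have "a \<oplus> b \<oplus> (x \<ominus> a \<ominus> b) = (a \<oplus> \<ominus> a) \<oplus> (b \<oplus> \<ominus> b) \<oplus> x"
    using assms by (simp add: minus_eq a_ac)
  then show ?thesis using assms by (simp add: r_neg)
qed

lemma (in abelian_group) add_minus_cancel:
  assumes "a \<in> carrier G" "x \<in> carrier G"
  shows "a \<oplus> (x \<ominus> a) = x"
  using assms by (simp add: minus_eq a_lcomm[of a x] r_neg)

lemma (in abelian_group) minus_minus_zero:
  assumes "a \<in> carrier G" "b \<in> carrier G"
  shows "(a \<oplus> b) \<ominus> a \<ominus> b = \<zero>"
proof -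
  have "(a \<oplus> b) \<ominus> a \<ominus> b = (a \<oplus> \<ominus> a) \<oplus> (b \<oplus> \<ominus> b)"
    using assms by (simp add: minus_eq a_ac)
  then show ?thesis using assms by (simp add: r_neg)
qed

lemma ap_object_augmented_algebra:
  "ap_object K p R f g \<Longrightarrow> augmented_algebra K R p f g"
  by (simp add: ap_object_def augmented_algebra_def augmented_algebra_axioms_def pointed_algebra_def
      pointed_algebra_axioms_def)

section \<open>The perturbed contraction of a lifting\<close>

locale contracted_lifting = augmented_algebra K R p f g + A: assoc_algebra K A
  for K :: "('k, 'u) ring_scheme" and A :: "('k, 'a) module" and p :: nat
    and R :: "('k, 'r) module" and f :: "(nat \<Rightarrow> 'k) \<Rightarrow> 'r" and g :: "'r \<Rightarrow> (nat \<Rightarrow> 'k)" +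
  fixes M :: "nat \<Rightarrow> ('a, 'm) module" and L :: "nat \<Rightarrow> nat \<Rightarrow> ('a, 'l) module"
    and d :: "nat \<Rightarrow> nat \<Rightarrow> 'l \<Rightarrow> 'l" and \<epsilon> :: "nat \<Rightarrow> 'l \<Rightarrow> 'm"
    and D :: "nat \<Rightarrow> (nat \<times> nat \<Rightarrow> ('l \<times> 'r \<Rightarrow>\<^sub>0 int) set) \<Rightarrow> (nat \<times> nat \<Rightarrow> ('l \<times> 'r \<Rightarrow>\<^sub>0 int) set)"
    and t :: "nat \<Rightarrow> 'm \<Rightarrow> 'l" and s :: "nat \<Rightarrow> nat \<Rightarrow> 'l \<Rightarrow> 'l"
  assumes nilpotent: "\<exists>n. ideal_power R (a_kernel R (pow_algebra K p) g) n = {\<zero>\<^bsub>R\<^esub>}"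
    and M_module: "i \<in> {1..p} \<Longrightarrow> left_module A (M i)"
    and resolution: "i \<in> {1..p} \<Longrightarrow> free_resolution A (\<lambda>m. L m i) (\<lambda>m. d m i) (\<epsilon> i) (M i)"
    and lifting: "complex_lifting K A p R f g L d D"
    and contraction: "i \<in> {1..p} \<Longrightarrow>
      contraction K A (M i) (\<lambda>m. L m i) (\<lambda>m. d m i) (\<epsilon> i) (t i) (\<lambda>m. s m i)"
begin

lemma t_hom: "i \<in> {1..p} \<Longrightarrow>
      t i \<in> right_module_hom K (base_bimodule A (M i)) (base_bimodule A (L 0 i))"
  and s_hom: "i \<in> {1..p} \<Longrightarrow>
      s m i \<in> right_module_hom K (base_bimodule A (L m i)) (base_bimodule A (L (Suc m) i))"
  and \<epsilon>_t: "i \<in> {1..p} \<Longrightarrow> y \<in> carrier (M i) \<Longrightarrow> \<epsilon> i (t i y) = y"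
  and contraction_0: "i \<in> {1..p} \<Longrightarrow> x \<in> carrier (L 0 i) \<Longrightarrow>
      d 0 i (s 0 i x) \<oplus>\<^bsub>L 0 i\<^esub> t i (\<epsilon> i x) = x"
  and contraction_Suc: "i \<in> {1..p} \<Longrightarrow> x \<in> carrier (L (Suc m) i) \<Longrightarrow>
      d (Suc m) i (s (Suc m) i x) \<oplus>\<^bsub>L (Suc m) i\<^esub> s m i (d m i x) = x"
  and s_t: "i \<in> {1..p} \<Longrightarrow> y \<in> carrier (M i) \<Longrightarrow> s 0 i (t i y) = \<zero>\<^bsub>L 1 i\<^esub>"
  using contraction[of i] by (simp_all add: contraction_def)

lemma L_module: "i \<in> {1..p} \<Longrightarrow> left_module A (L m i)"
  using resolution[of i] by (simp add: free_resolution_def free_module_def)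

lemma L_ab: "i \<in> {1..p} \<Longrightarrow> abelian_group (L m i)"
  by (rule left_module_abelian_group[OF L_module])

lemma L_reduction: "reduction K A p R f g (L m)"
  by (intro reduction.intro reduction_axioms.intro augmented_algebra_axioms A.assoc_algebra_axioms L_module)

sublocale L: reduction K A p R f g "L m" for m
  by (rule L_reduction)

sublocale M: reduction K A p R f g M
  by (intro reduction.intro reduction_axioms.intro augmented_algebra_axioms A.assoc_algebra_axioms M_module)

abbreviation "F m \<equiv> mat_module K A p R f (L m)"
abbreviation "Fk m \<equiv> mat_module K A p (pow_algebra K p) id (L m)"
abbreviation "FM \<equiv> mat_module K A p R f M"
abbreviation "Red m \<equiv> mat_reduction K A p g (L m)"

definition "dR m = mat_map K A p R f (L m) (d m) (\<lambda>_ _. id)"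
definition "sR m = mat_map K A p R f (L (Suc m)) (s m) (\<lambda>_ _. id)"
definition "tR = mat_map K A p R f (L 0) t (\<lambda>_ _. id)"
definition "\<epsilon>R = mat_map K A p R f M \<epsilon> (\<lambda>_ _. id)"

lemma d_hom: "i \<in> {1..p} \<Longrightarrow> d m i \<in> left_module_hom A (L (Suc m) i) (L m i)"
  and \<epsilon>_hom: "i \<in> {1..p} \<Longrightarrow> \<epsilon> i \<in> left_module_hom A (L 0 i) (M i)"
  using resolution[of i] by (simp_all add: free_resolution_def)

lemma d_map: "reduction_map K A p R f g (L (Suc m)) (L m) (d m)"
  by (intro reduction_map.intro reduction_map_axioms.intro L.reduction_axioms
      left_module_hom_base[OF A.assoc_algebra_axioms d_hom])

lemma s_map: "reduction_map K A p R f g (L m) (L (Suc m)) (s m)"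
  by (intro reduction_map.intro reduction_map_axioms.intro L.reduction_axioms s_hom)

lemma t_map: "reduction_map K A p R f g M (L 0) t"
  by (intro reduction_map.intro reduction_map_axioms.intro L.reduction_axioms M.reduction_axioms t_hom)

lemma \<epsilon>_map: "reduction_map K A p R f g (L 0) M \<epsilon>"
  by (intro reduction_map.intro reduction_map_axioms.intro L.reduction_axioms M.reduction_axioms
      left_module_hom_base[OF A.assoc_algebra_axioms \<epsilon>_hom])

lemmas dR_hom = reduction_map.hR_hom[OF d_map, folded dR_def]
  and sR_hom = reduction_map.hR_hom[OF s_map, folded sR_def]
  and tR_hom = reduction_map.hR_hom[OF t_map, folded tR_def]
  and \<epsilon>R_hom = reduction_map.hR_hom[OF \<epsilon>_map, folded \<epsilon>R_def]

lemmas dR_additive = right_module_hom_additive[OF dR_hom]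
  and sR_additive = right_module_hom_additive[OF sR_hom]
  and tR_additive = right_module_hom_additive[OF tR_hom]
  and \<epsilon>R_additive = right_module_hom_additive[OF \<epsilon>R_hom]

lemmas dR_closed = additive_hom_closed[OF dR_additive]
  and sR_closed = additive_hom_closed[OF sR_additive]
  and tR_closed = additive_hom_closed[OF tR_additive]
  and \<epsilon>R_closed = additive_hom_closed[OF \<epsilon>R_additive]

lemmas dR_row = reduction_map.hR_row[OF d_map, folded dR_def]
  and sR_row = reduction_map.hR_row[OF s_map, folded sR_def]
  and tR_row = reduction_map.hR_row[OF t_map, folded tR_def]
  and \<epsilon>R_row = reduction_map.hR_row[OF \<epsilon>_map, folded \<epsilon>R_def]

lemmas d_closed = reduction_map.h_closed[OF d_map]
  and s_closed = reduction_map.h_closed[OF s_map]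
  and t_closed = reduction_map.h_closed[OF t_map]
  and \<epsilon>_closed = reduction_map.h_closed[OF \<epsilon>_map]

text \<open>On a row all maps act on the first tensor factor only, so the identity is that of the
  resolution. Here the constant differential \<open>dR\<close> appears, not yet
  \<open>D\<close>.\<close>

lemma dR_sR_tR_\<epsilon>R:
  assumes "x \<in> carrier (F 0)"
  shows "dR 0 (sR 0 x) \<oplus>\<^bsub>F 0\<^esub> tR (\<epsilon>R x) = x"
  by (rule L.X.row_eqI[OF L.X.MM_abelian_group additive_hom_add_fun[OF L.X.MM_abelian_group
          additive_hom_comp[OF sR_additive dR_additive] additive_hom_comp[OF \<epsilon>R_additive tR_additive]]
        additive_hom_id _ assms])
    (simp only: dR_row sR_row tR_row \<epsilon>R_row d_closed s_closed t_closed \<epsilon>_closed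
      L.X.row_add_left[symmetric] contraction_0)

lemma dR_sR_sR_dR:
  assumes "x \<in> carrier (F (Suc m))"
  shows "dR (Suc m) (sR (Suc m) x) \<oplus>\<^bsub>F (Suc m)\<^esub> sR m (dR m x) = x"
  by (rule L.X.row_eqI[OF L.X.MM_abelian_group additive_hom_add_fun[OF L.X.MM_abelian_group
          additive_hom_comp[OF sR_additive dR_additive] additive_hom_comp[OF dR_additive sR_additive]]
        additive_hom_id _ assms])
    (simp only: dR_row sR_row d_closed s_closed L.X.row_add_left[symmetric] contraction_Suc)

lemma \<epsilon>R_tR: "u \<in> carrier FM \<Longrightarrow> \<epsilon>R (tR u) = u"
  by (rule M.X.row_eqI[OF M.X.MM_abelian_group additive_hom_comp[OF tR_additive \<epsilon>R_additive] additive_hom_id])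
    (simp_all only: tR_row \<epsilon>R_row t_closed \<epsilon>_t)

lemma row_zero_left:
  "i \<in> {1..p} \<Longrightarrow> r \<in> carrier R \<Longrightarrow> L.X.row m i \<zero>\<^bsub>L m i\<^esub> r = \<zero>\<^bsub>F m\<^esub>"
  by (rule additive_hom_zero[OF L_ab L.X.MM_abelian_group L.X.row_additive_left])

lemma zero_additive: "abelian_group Q \<Longrightarrow> (\<lambda>_. \<zero>\<^bsub>Q\<^esub>) \<in> additive_hom P Q"
  by (rule additive_homI) (simp_all add: abelian_groupE)

lemma sR_tR: "u \<in> carrier FM \<Longrightarrow> sR 0 (tR u) = \<zero>\<^bsub>F (Suc 0)\<^esub>"
  by (rule M.X.row_eqI[OF L.X.MM_abelian_group additive_hom_comp[OF tR_additive sR_additive]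
        zero_additive[OF L.X.MM_abelian_group]])
    (simp_all only: tR_row sR_row t_closed s_t One_nat_def row_zero_left)

lemma D_left: "D m \<in> left_module_hom A (F (Suc m)) (F m)"
  and D_right: "D m \<in> right_module_hom R (F (Suc m)) (F m)"
  using lifting by (auto simp: complex_lifting_def)

lemmas D_additive = right_module_hom_additive[OF D_right]
lemmas D_closed = additive_hom_closed[OF D_additive]

lemma D_D: "x \<in> carrier (F (Suc (Suc m))) \<Longrightarrow> D m (D (Suc m) x) = \<zero>\<^bsub>F m\<^esub>"
  using lifting by (auto simp: complex_lifting_def)

lemma base_differential_eq:
  "base_differential K A p L d m = mat_map K A p (pow_algebra K p) id (L m) (d m)
    (\<lambda>i _ y. std_idem K p i \<otimes>\<^bsub>pow_algebra K p\<^esub> y)"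
  by (simp add: base_differential_def mat_map_def fun_eq_iff)

lemma base_differential_map:
  "matrix_bimodule_map K A p (pow_algebra K p) id (L (Suc m)) (pow_algebra K p) id (L m) (d m)
    (\<lambda>i _ y. std_idem K p i \<otimes>\<^bsub>pow_algebra K p\<^esub> y)"
proof (intro matrix_bimodule_map.intro matrix_bimodule_map_axioms.intro L.Y.matrix_bimodule_axioms
      left_module_hom_base[OF A.assoc_algebra_axioms d_hom])
  fix i j
  show "(\<lambda>y. std_idem K p i \<otimes>\<^bsub>pow_algebra K p\<^esub> y) \<in> left_module_hom K (base.pc i j) (base.pc i j)"
    using std_idem_closed[OF S.R.ring_axioms, of p i]
    by (auto simp: left_module_hom_def base.peirce_carrier base.peirce_simps base_e
        pow.r_distr pow.smult_mult_right)
qed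

text \<open>The lifting condition expresses the reduction of D x through the base differential. Its
  second component is left multiplication by the i-th idempotent, which the row absorbs, so on rows
  it agrees with the reduction of \<open>dR\<close>.\<close>

lemma Red_D:
  assumes x: "x \<in> carrier (F (Suc m))"
  shows "Red m (D m x) = Red m (dR m x)"
proof -
  have "Red m (D m x) = base_differential K A p L d m (Red (Suc m) x)"
    using lifting x by (simp add: complex_lifting_def)
  also have "\<dots> = Red m (dR m x)"
    unfolding base_differential_eq
  proof (rule L.X.row_eqI[OF L.Y.MM_abelian_group additive_hom_comp[OF L.red_additive
            matrix_bimodule_map.map_additive[OF base_differential_map]]
          additive_hom_comp[OF dR_additive L.red_additive] _ x])
    fix i n r assume i: "i \<in> {1..p}" and n: "n \<in> carrier (L (Suc m) i)" and r: "r \<in> carrier R"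
    show "mat_map K A p (pow_algebra K p) id (L m) (d m) (\<lambda>i _ y. std_idem K p i \<otimes>\<^bsub>pow_algebra K p\<^esub> y)
        (Red (Suc m) (L.X.row (Suc m) i n r)) = Red m (dR m (L.X.row (Suc m) i n r))"
      unfolding L.red_row[OF i n r] dR_row[OF i n r] L.red_row[OF i d_closed[OF i n] r]
      by (rule matrix_bimodule_map.map_row[OF base_differential_map i n g_closed[OF r] g_closed[OF r]])
        (simp add: base_e[symmetric] pow.m_assoc base.e_idem_left g_closed[OF r])
  qed
  finally show ?thesis .
qed

text \<open>The contraction commutes with reduction, hence congruence modulo the radical passes
  through it; this is needed for the term s D, where \<open>D\<close> is applied first.\<close>

lemma Red_sR:
  assumes "x \<in> carrier (F m)" "y \<in> carrier (F m)" "Red m x = Red m y"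
  shows "Red (Suc m) (sR m x) = Red (Suc m) (sR m y)"
  using reduction_map.red_hR[OF s_map, folded sR_def] assms by simp

lemma Red_zero: "Red m \<zero>\<^bsub>F m\<^esub> = \<zero>\<^bsub>Fk m\<^esub>"
  by (rule additive_hom_zero[OF L.X.MM_abelian_group L.Y.MM_abelian_group L.red_additive])

text \<open>Zero reduction places all values in the product with the radical, and nilpotency of the
  radical gives one exponent for the whole module.\<close>

lemma Red_zero_nilpotent:
  assumes E: "E \<in> right_module_hom R (F m) (F m)" and "\<And>x. x \<in> carrier (F m) \<Longrightarrow> Red m (E x) = \<zero>\<^bsub>Fk m\<^esub>"
  shows "\<exists>n. \<forall>x \<in> carrier (F m). (E ^^ n) x = \<zero>\<^bsub>F m\<^esub>"
proof -
  obtain n where n: "ideal_power R rad n = {\<zero>\<^bsub>R\<^esub>}" using nilpotent by (auto simp: rad_def)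
  have sub: "rad \<subseteq> carrier R" by (auto simp: rad_iff)
  have "(E ^^ n) x = \<zero>\<^bsub>F m\<^esub>" if "x \<in> carrier (F m)" for x
    by (rule nilpotent_endomorphism[OF L.X.MM_right_module E _ sub n that])
      (rule L.red_zero_mod_ideal[OF additive_hom_closed[OF right_module_hom_additive[OF E]] assms(2)])
  then show ?thesis by blast
qed

text \<open>Reduction does not distinguish a, b from a', b', and with the latter the difference is
  exactly zero. The primed elements are the terms of the contraction identity for the constant
  lifting.\<close>

lemma Red_minus_minus:
  assumes "a \<in> carrier (F m)" "a' \<in> carrier (F m)" "b \<in> carrier (F m)" "b' \<in> carrier (F m)"
    and "Red m a = Red m a'" "Red m b = Red m b'" "a' \<oplus>\<^bsub>F m\<^esub> b' = x"
  shows "Red m (x \<ominus>\<^bsub>F m\<^esub> a \<ominus>\<^bsub>F m\<^esub> b) = \<zero>\<^bsub>Fk m\<^esub>"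
proof -
  note red_minus = additive_hom_minus[OF L.X.MM_abelian_group L.Y.MM_abelian_group L.red_additive, of _ m]
  have x: "x \<in> carrier (F m)" using assms(2,4,7) L.X.MM.a_closed by blast
  have "Red m (x \<ominus>\<^bsub>F m\<^esub> a \<ominus>\<^bsub>F m\<^esub> b) = Red m (x \<ominus>\<^bsub>F m\<^esub> a' \<ominus>\<^bsub>F m\<^esub> b')"
    by (simp only: red_minus L.X.MM.minus_closed assms x)
  also have "\<dots> = \<zero>\<^bsub>Fk m\<^esub>"
    unfolding assms(7)[symmetric] L.X.MM.minus_minus_zero[OF assms(2,4)] by (rule Red_zero)
  finally show ?thesis .
qed

definition "E0 x = x \<ominus>\<^bsub>F 0\<^esub> D 0 (sR 0 x) \<ominus>\<^bsub>F 0\<^esub> tR (\<epsilon>R x)"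
text \<open>The index is shifted: \<open>ES m\<close> acts in degree m + 1, where the homotopy has
  two terms.\<close>

definition "ES m x = x \<ominus>\<^bsub>F (Suc m)\<^esub> D (Suc m) (sR (Suc m) x) \<ominus>\<^bsub>F (Suc m)\<^esub> sR m (D m x)"

lemma id_right: "(\<lambda>x. x) \<in> right_module_hom R N N"
  by (simp add: right_module_hom_def)

lemma E0_hom: "E0 \<in> right_module_hom R (F 0) (F 0)"
  unfolding E0_def[abs_def]
  by (intro right_module_hom_minus_fun L.X.MM_right_module id_right
      right_module_hom_comp[OF sR_hom D_right] right_module_hom_comp[OF \<epsilon>R_hom tR_hom])

lemma ES_hom: "ES m \<in> right_module_hom R (F (Suc m)) (F (Suc m))"
  unfolding ES_def[abs_def]
  by (intro right_module_hom_minus_fun L.X.MM_right_module id_right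
      right_module_hom_comp[OF sR_hom D_right] right_module_hom_comp[OF D_right sR_hom])

lemma E0_nilpotent: "\<exists>n. \<forall>x \<in> carrier (F 0). (E0 ^^ n) x = \<zero>\<^bsub>F 0\<^esub>"
proof (rule Red_zero_nilpotent[OF E0_hom])
  fix x assume x: "x \<in> carrier (F 0)"
  show "Red 0 (E0 x) = \<zero>\<^bsub>Fk 0\<^esub>"
    unfolding E0_def
    by (rule Red_minus_minus[OF D_closed[OF sR_closed[OF x]] dR_closed[OF sR_closed[OF x]]
          tR_closed[OF \<epsilon>R_closed[OF x]] tR_closed[OF \<epsilon>R_closed[OF x]] Red_D[OF sR_closed[OF x]] refl
          dR_sR_tR_\<epsilon>R[OF x]])
qed

lemma ES_nilpotent: "\<exists>n. \<forall>x \<in> carrier (F (Suc m)). (ES m ^^ n) x = \<zero>\<^bsub>F (Suc m)\<^esub>"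
proof (rule Red_zero_nilpotent[OF ES_hom])
  fix x assume x: "x \<in> carrier (F (Suc m))"
  show "Red (Suc m) (ES m x) = \<zero>\<^bsub>Fk (Suc m)\<^esub>"
    unfolding ES_def
    by (rule Red_minus_minus[OF D_closed[OF sR_closed[OF x]] dR_closed[OF sR_closed[OF x]]
          sR_closed[OF D_closed[OF x]] sR_closed[OF dR_closed[OF x]] Red_D[OF sR_closed[OF x]]
          Red_sR[OF D_closed[OF x] dR_closed[OF x] Red_D[OF x]] dR_sR_sR_dR[OF x]])
qed

lemma D_zero: "D m \<zero>\<^bsub>F (Suc m)\<^esub> = \<zero>\<^bsub>F m\<^esub>"
  by (rule additive_hom_zero[OF L.X.MM_abelian_group L.X.MM_abelian_group D_additive])

lemma D_image_subgroup: "additive_subgroup (D m ` carrier (F (Suc m))) (F m)"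
proof -
  interpret h: abelian_group_hom "F (Suc m)" "F m" "D m"
    by (rule additive_hom_abelian_group_hom[OF L.X.MM_abelian_group L.X.MM_abelian_group D_additive])
  have "subgroup (D m ` carrier (F (Suc m))) (add_monoid (F m))"
    using group_hom.img_is_subgroup[OF h.a_group_hom] by simp
  then show ?thesis by (rule additive_subgroup.intro)
qed

text \<open>Without the term s D y the error is y - D s y, and D D = 0 shows that passing to it
  leaves D y unchanged. The hypothesis on s D y, weaker than D y = 0, also covers elements y with D
  y = t u, for which s D y = s t u = 0.\<close>

lemma ES_step:
  assumes y: "y \<in> carrier (F (Suc m))" and sD: "sR m (D m y) = \<zero>\<^bsub>F (Suc m)\<^esub>"
  shows "ES m y \<in> carrier (F (Suc m))" "y = D (Suc m) (sR (Suc m) y) \<oplus>\<^bsub>F (Suc m)\<^esub> ES m y"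
    "D m (ES m y) = D m y"
proof -
  note c = D_closed[OF sR_closed[OF y]]
  show Ec: "ES m y \<in> carrier (F (Suc m))"
    by (rule additive_hom_closed[OF right_module_hom_additive[OF ES_hom] y])
  show eq: "y = D (Suc m) (sR (Suc m) y) \<oplus>\<^bsub>F (Suc m)\<^esub> ES m y"
    using L.X.MM.minus_minus_cancel[OF c L.X.MM.zero_closed y] c by (simp add: ES_def sD)
  have "D m y = D m (D (Suc m) (sR (Suc m) y)) \<oplus>\<^bsub>F m\<^esub> D m (ES m y)"
    by (subst eq) (rule additive_hom_add[OF D_additive c Ec])
  then show "D m (ES m y) = D m y"
    using D_D[OF sR_closed[OF y]] D_closed[OF Ec] L.X.MM.l_zero by simp
qed

text \<open>On cycles the error equals y - D s y and is again a cycle. Its nilpotency lets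
  \<open>absorb_nilpotent\<close> write every cycle as a sum of boundaries.\<close>

lemma exact:
  assumes x: "x \<in> carrier (F (Suc m))" and Dx: "D m x = \<zero>\<^bsub>F m\<^esub>"
  shows "x \<in> D (Suc m) ` carrier (F (Suc (Suc m)))"
proof -
  interpret U: additive_subgroup "D (Suc m) ` carrier (F (Suc (Suc m)))" "F (Suc m)"
    by (rule D_image_subgroup)
  obtain n where n: "\<And>x. x \<in> carrier (F (Suc m)) \<Longrightarrow> (ES m ^^ n) x = \<zero>\<^bsub>F (Suc m)\<^esub>"
    using ES_nilpotent by blast
  have s0: "sR m \<zero>\<^bsub>F m\<^esub> = \<zero>\<^bsub>F (Suc m)\<^esub>"
    by (rule additive_hom_zero[OF L.X.MM_abelian_group L.X.MM_abelian_group sR_additive])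
  show ?thesis
  proof (rule absorb_nilpotent[where F = "F (Suc m)" and E = "ES m" and n = n
        and C = "{y \<in> carrier (F (Suc m)). D m y = \<zero>\<^bsub>F m\<^esub>}"])
    show "\<exists>w \<in> D (Suc m) ` carrier (F (Suc (Suc m))). y = w \<oplus>\<^bsub>F (Suc m)\<^esub> ES m y"
      if "y \<in> {y \<in> carrier (F (Suc m)). D m y = \<zero>\<^bsub>F m\<^esub>}" for y
      using ES_step(2)[of y m] that s0 sR_closed[of y "Suc m"] by auto
  qed (use ES_step(1,3)[of _ m] s0 n x Dx U.a_subset in auto)
qed

end

text \<open>Once cycles and boundaries coincide, cohomology is the quotient of U by itself, formed
  in the record whose carrier has been cut down to U.\<close>

lemma (in abelian_group) rcosets_restrict_carrier:
  assumes "additive_subgroup U G"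
  shows "a_rcosets\<^bsub>G\<lparr>carrier := U\<rparr>\<^esub> U = {U}"
proof -
  interpret U: additive_subgroup U G by fact
  have "U +> a = U" if "a \<in> U" for a
    using a_coset_join2[OF _ U.a_subgroup that] U.a_Hcarr that by blast
  then have "\<And>a. a \<in> U \<Longrightarrow> (\<Union>h\<in>U. {h \<oplus> a}) = U" by (simp add: a_r_coset_def')
  moreover have "U \<noteq> {}" using U.zero_closed by blast
  ultimately show ?thesis by (auto simp: A_RCOSETS_def' a_r_coset_def')
qed

section \<open>Cohomology of the lifting and its right module structure\<close>

context contracted_lifting
begin

abbreviation "B0 \<equiv> D 0 ` carrier (F (Suc 0))"
abbreviation "H0 \<equiv> quot_bimodule (F 0) B0"

lemma higher_cohomology:
  "carrier (cohomology F D (Suc m)) = {\<zero>\<^bsub>cohomology F D (Suc m)\<^esub>}"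
proof -
  let ?U = "D (Suc m) ` carrier (F (Suc (Suc m)))"
  have "a_kernel (F (Suc m)) (F m) (D m) = ?U"
    using exact[of _ m] D_D[of _ m] D_closed[of _ "Suc m"] by (auto simp: a_kernel_def')
  then show ?thesis
    by (simp add: quot_bimodule_def L.X.MM.rcosets_restrict_carrier[OF D_image_subgroup])
qed

sublocale H: sub_bimodule K A R "F 0" B0
proof (rule sub_bimodule.intro[OF L.X.MM_is_bimodule D_image_subgroup])
  fix a x assume a: "a \<in> carrier A" and "x \<in> B0"
  then obtain z where z: "z \<in> carrier (F (Suc 0))" "x = D 0 z" by blast
  have "a \<odot>\<^bsub>F 0\<^esub> x = D 0 (a \<odot>\<^bsub>F (Suc 0)\<^esub> z)"
    using left_module_hom_smult[OF D_left a z(1)] z(2) by simp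
  then show "a \<odot>\<^bsub>F 0\<^esub> x \<in> B0"
    using left_module.left_closed[OF L.X.MM_left_module a z(1)] by blast
next
  fix r x assume r: "r \<in> carrier R" and "x \<in> B0"
  then obtain z where z: "z \<in> carrier (F (Suc 0))" "x = D 0 z" by blast
  have "rsmult (F 0) x r = D 0 (rsmult (F (Suc 0)) z r)"
    using right_module_hom_smult[OF D_right r z(1)] z(2) by simp
  then show "rsmult (F 0) x r \<in> B0"
    using right_module.right_closed[OF L.X.MM_right_module r z(1)] by blast
qed

lemma q_D: "z \<in> carrier (F (Suc 0)) \<Longrightarrow> H.q (D 0 z) = \<zero>\<^bsub>H0\<^esub>"
  by (rule H.q_zero) simp

text \<open>Every preimage z of t u under D can be replaced by its error without changing D z, since
  s t u = 0. Iterating makes z zero, so t u = 0, and applying the augmentation recovers u =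
  0.\<close>

lemma tR_D_zero:
  assumes u: "u \<in> carrier FM" and z: "z \<in> carrier (F (Suc 0))" and eq: "tR u = D 0 z"
  shows "u = \<zero>\<^bsub>FM\<^esub>"
proof -
  obtain n where n: "\<And>x. x \<in> carrier (F (Suc 0)) \<Longrightarrow> (ES 0 ^^ n) x = \<zero>\<^bsub>F (Suc 0)\<^esub>"
    using ES_nilpotent by blast
  have step: "D 0 (ES 0 y) = tR u \<and> ES 0 y \<in> carrier (F (Suc 0))"
    if "y \<in> carrier (F (Suc 0))" "D 0 y = tR u" for y
    using ES_step[OF that(1)] sR_tR[OF u] that(2) by simp
  have "D 0 ((ES 0 ^^ k) z) = tR u \<and> (ES 0 ^^ k) z \<in> carrier (F (Suc 0))" for k
    using step z eq by (induction k) simp_all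
  from this[of n] have "tR u = \<zero>\<^bsub>F 0\<^esub>" using n[OF z] D_zero by simp
  then have "u = \<epsilon>R \<zero>\<^bsub>F 0\<^esub>" using \<epsilon>R_tR[OF u] by simp
  then show ?thesis
    using additive_hom_zero[OF L.X.MM_abelian_group M.X.MM_abelian_group \<epsilon>R_additive] by simp
qed

text \<open>Each x equals t \<epsilon> x + D s x + \<open>E0 x\<close>, and the first two terms lie
  in the subgroup of sums of a value of \<open>tR\<close> and a boundary. Nilpotency of
  \<open>E0\<close> puts all of degree 0 into that subgroup.\<close>

lemma tR_generates:
  assumes y: "y \<in> carrier (F 0)"
  shows "\<exists>u \<in> carrier FM. H.q y = H.q (tR u)"
proof -
  let ?U = "{tR u \<oplus>\<^bsub>F 0\<^esub> D 0 z | u z. u \<in> carrier FM \<and> z \<in> carrier (F (Suc 0))}"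
  obtain n where n: "\<And>x. x \<in> carrier (F 0) \<Longrightarrow> (E0 ^^ n) x = \<zero>\<^bsub>F 0\<^esub>"
    using E0_nilpotent by blast
  have U_mem: "tR u \<oplus>\<^bsub>F 0\<^esub> D 0 z \<in> ?U" if "u \<in> carrier FM" "z \<in> carrier (F (Suc 0))" for u z
    using that by blast
  have "y \<in> ?U"
  proof (rule absorb_nilpotent[where F = "F 0" and E = E0 and n = n and C = "carrier (F 0)"])
    show "?U \<subseteq> carrier (F 0)" using tR_closed D_closed by auto
    show "\<zero>\<^bsub>F 0\<^esub> \<in> ?U"
      using U_mem[OF M.X.MM.zero_closed L.X.MM.zero_closed] D_zero
        additive_hom_zero[OF M.X.MM_abelian_group L.X.MM_abelian_group tR_additive] by simp
    show "x \<oplus>\<^bsub>F 0\<^esub> x' \<in> ?U" if x: "x \<in> ?U" and x': "x' \<in> ?U" for x x'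
    proof -
      obtain u z where uz: "x = tR u \<oplus>\<^bsub>F 0\<^esub> D 0 z" "u \<in> carrier FM" "z \<in> carrier (F (Suc 0))"
        using x by blast
      obtain u' z' where uz': "x' = tR u' \<oplus>\<^bsub>F 0\<^esub> D 0 z'" "u' \<in> carrier FM" "z' \<in> carrier (F (Suc 0))"
        using x' by blast
      have "x \<oplus>\<^bsub>F 0\<^esub> x' = tR (u \<oplus>\<^bsub>FM\<^esub> u') \<oplus>\<^bsub>F 0\<^esub> D 0 (z \<oplus>\<^bsub>F (Suc 0)\<^esub> z')"
        using uz uz' by (simp add: additive_hom_add[OF tR_additive] additive_hom_add[OF D_additive]
            tR_closed D_closed L.X.MM.a_ac)
      also have "\<dots> \<in> ?U"
        by (rule U_mem[OF M.X.MM.a_closed[OF uz(2) uz'(2)] L.X.MM.a_closed[OF uz(3) uz'(3)]])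
      finally show ?thesis .
    qed
    fix x assume x: "x \<in> carrier (F 0)"
    show "E0 x \<in> carrier (F 0)"
      by (rule additive_hom_closed[OF right_module_hom_additive[OF E0_hom] x])
    note c = D_closed[OF sR_closed[OF x]] and c' = tR_closed[OF \<epsilon>R_closed[OF x]]
    have "x = (tR (\<epsilon>R x) \<oplus>\<^bsub>F 0\<^esub> D 0 (sR 0 x)) \<oplus>\<^bsub>F 0\<^esub> E0 x"
      using L.X.MM.minus_minus_cancel[OF c c' x] L.X.MM.a_comm[OF c c'] by (simp add: E0_def)
    then show "\<exists>w \<in> ?U. x = w \<oplus>\<^bsub>F 0\<^esub> E0 x"
      using U_mem[OF \<epsilon>R_closed[OF x] sR_closed[OF x]] by blast
  qed (use n y in auto)
  then obtain u z where uz: "y = tR u \<oplus>\<^bsub>F 0\<^esub> D 0 z" "u \<in> carrier FM" "z \<in> carrier (F (Suc 0))" by blast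
  have "H.q y = H.q (tR u)"
    using uz H.q_add[OF tR_closed[OF uz(2)] D_closed[OF uz(3)]] q_D[OF uz(3)]
      H.q_closed[OF tR_closed[OF uz(2)]] abelian_monoid.r_zero[OF abelian_group.axioms(1)[OF H.Q_abelian_group]]
    by simp
  then show ?thesis using uz(2) by blast
qed

lemma H0_right_iso: "\<exists>\<theta>. \<theta> \<in> right_module_iso R H0 FM"
proof -
  let ?h = "\<lambda>u. H.q (tR u)"
  have "H.q \<in> right_module_hom R (F 0) H0"
    by (rule right_module_homI[OF H.q_additive]) (simp add: H.q_rsmult)
  then have hom: "?h \<in> right_module_hom R FM H0"
    by (rule right_module_hom_comp[OF tR_hom])
  note add = right_module_hom_additive[OF hom]
  have "bij_betw ?h (carrier FM) (carrier H0)"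
    unfolding bij_betw_def
  proof (intro conjI inj_onI)
    fix u v assume u: "u \<in> carrier FM" and v: "v \<in> carrier FM" and eq: "?h u = ?h v"
    have uv: "u \<ominus>\<^bsub>FM\<^esub> v \<in> carrier FM" using u v by (rule M.X.MM.minus_closed)
    have "?h (u \<ominus>\<^bsub>FM\<^esub> v) = ?h u \<ominus>\<^bsub>H0\<^esub> ?h u"
      using additive_hom_minus[OF M.X.MM_abelian_group H.Q_abelian_group add u v] eq by simp
    also have "\<dots> = \<zero>\<^bsub>H0\<^esub>"
      using abelian_group.r_neg[OF H.Q_abelian_group additive_hom_closed[OF add u]] by (simp add: a_minus_def)
    finally have "tR (u \<ominus>\<^bsub>FM\<^esub> v) \<in> B0" using H.q_zero_mem[OF tR_closed[OF uv]] by simp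
    then have "u \<ominus>\<^bsub>FM\<^esub> v = \<zero>\<^bsub>FM\<^esub>" using tR_D_zero[OF uv] by blast
    then show "u = v" using u v M.X.MM.minus_minus_cancel[OF v M.X.MM.zero_closed u]
      by (metis M.X.MM.r_zero M.X.MM.minus_equality M.X.MM.minus_minus M.X.MM.a_inv_closed M.X.MM.minus_eq)
  next
    show "?h ` carrier FM = carrier H0"
    proof
      show "?h ` carrier FM \<subseteq> carrier H0" using additive_hom_closed[OF add] by blast
      show "carrier H0 \<subseteq> ?h ` carrier FM"
      proof
        fix W assume "W \<in> carrier H0"
        then obtain y where "y \<in> carrier (F 0)" "W = H.q y" by (rule H.Q_cases)
        then show "W \<in> ?h ` carrier FM" using tR_generates by blast
      qed
    qed
  qed
  then have "?h \<in> right_module_iso R FM H0" using hom by (simp add: right_module_iso_def)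
  then show ?thesis
    using right_module_iso_inverse[OF M.X.MM_right_module H.Q_right_module] by blast
qed

end

section \<open>The isomorphisms with the given modules\<close>

lemma simple_module_simps:
  "carrier (simple_module K g i) = carrier K" "add (simple_module K g i) = add K"
  "\<zero>\<^bsub>simple_module K g i\<^esub> = \<zero>\<^bsub>K\<^esub>" "r \<odot>\<^bsub>simple_module K g i\<^esub> c = g r i \<otimes>\<^bsub>K\<^esub> c"
  by (simp_all add: simple_module_def)

lemma (in augmented_algebra) g_entry:
  assumes "i \<in> {1..p}"
  shows "r \<in> carrier R \<Longrightarrow> g r i \<in> carrier K"
    "r \<in> carrier R \<Longrightarrow> s \<in> carrier R \<Longrightarrow> g (r \<oplus>\<^bsub>R\<^esub> s) i = g r i \<oplus>\<^bsub>K\<^esub> g s i"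
    "r \<in> carrier R \<Longrightarrow> s \<in> carrier R \<Longrightarrow> g (r \<otimes>\<^bsub>R\<^esub> s) i = g r i \<otimes>\<^bsub>K\<^esub> g s i"
    "g \<one>\<^bsub>R\<^esub> i = \<one>\<^bsub>K\<^esub>"
    "c \<in> carrier K \<Longrightarrow> r \<in> carrier R \<Longrightarrow> g (c \<odot>\<^bsub>R\<^esub> r) i = c \<otimes>\<^bsub>K\<^esub> g r i"
    "g (e j) i = (if j = i then \<one>\<^bsub>K\<^esub> else \<zero>\<^bsub>K\<^esub>)"
  using pow_algebra_entry_closed[OF g_closed assms] assms
  by (simp_all add: additive_hom_add[OF g_additive] g_mult ring_hom_one[OF g_ring_hom] g_smult
      pow_algebra_entry g_e std_idem_def)

lemma (in augmented_algebra) simple_left_module: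
  assumes i: "i \<in> {1..p}"
  shows "left_module R (simple_module K g i)"
proof (rule left_moduleI[OF S.ring_axioms])
  show "abelian_group (simple_module K g i)"
    by (rule abelian_group_cong[OF S.R.abelian_group_axioms]) (simp_all add: simple_module_simps)
qed (simp_all add: simple_module_simps additive_hom_def g_entry[OF i] S.R.r_distr S.R.l_distr S.R.m_assoc)

context reduction
begin

lemma N_ab: "i \<in> {1..p} \<Longrightarrow> abelian_group (N i)"
  by (rule left_module_abelian_group[OF N_module])

lemma diagonal_balanced:
  assumes i: "i \<in> {1..p}"
  shows "balanced_map K (X.B i) (base.pc i i) (N i) (\<lambda>n y. (y i \<odot>\<^bsub>A\<^esub> \<one>\<^bsub>A\<^esub>) \<odot>\<^bsub>N i\<^esub> n)"
proof -
  interpret N: algebra_left_module K A "N i" by (rule X.N_algebra_left_module[OF i])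
  have y: "y i \<in> carrier K" if "y \<in> carrier (base.pc i i)" for y
    using that i by (auto simp: base.peirce_carrier intro: pow_algebra_entry_closed)
  show ?thesis
  proof (rule balanced_mapI)
    fix n c y assume n: "n \<in> carrier (X.B i)" and c: "c \<in> carrier K" and yc: "y \<in> carrier (base.pc i i)"
    have "(y i \<odot>\<^bsub>A\<^esub> \<one>\<^bsub>A\<^esub>) \<odot>\<^bsub>N i\<^esub> ((c \<odot>\<^bsub>A\<^esub> \<one>\<^bsub>A\<^esub>) \<odot>\<^bsub>N i\<^esub> n) = ((y i \<otimes>\<^bsub>K\<^esub> c) \<odot>\<^bsub>A\<^esub> \<one>\<^bsub>A\<^esub>) \<odot>\<^bsub>N i\<^esub> n"
      using n c y[OF yc] N.scalar_mult[OF y[OF yc] c] N.N.left_assoc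
      by (simp add: base_bimodule_simps)
    then show "(y i \<odot>\<^bsub>A\<^esub> \<one>\<^bsub>A\<^esub>) \<odot>\<^bsub>N i\<^esub> rsmult (X.B i) n c
        = ((c \<odot>\<^bsub>base.pc i i\<^esub> y) i \<odot>\<^bsub>A\<^esub> \<one>\<^bsub>A\<^esub>) \<odot>\<^bsub>N i\<^esub> n"
      using i c y[OF yc] by (simp add: base_bimodule_simps base.peirce_simps pow_algebra_entry S.R.m_comm)
  qed (use i y in \<open>simp_all add: base_bimodule_simps base.peirce_simps pow_algebra_entry N.N.left_closed
      N.N.left_add N.N.left_add_scalar A.smult_l_distr\<close>)
qed

lemma diagonal_additive:
  assumes i: "i \<in> {1..p}"
  shows "diagonal_entry A N i \<in> additive_hom Y.MM (N i)"
  unfolding diagonal_entry_def[abs_def]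
  by (rule additive_hom_comp[OF Y.MM_proj[OF i i] tensor_factors.lift_additive[OF
        Y.entry_tensor_factors[OF i] N_ab[OF i] diagonal_balanced[OF i],
        unfolded Y.entry_hom_eq]])

text \<open>Only the entry at (i, i) is read: it is zero for a row with another index, and for row i
  its ring component e_i x e_i has the same i-th coordinate as x.\<close>

lemma diagonal_row:
  assumes i: "i \<in> {1..p}" and j: "j \<in> {1..p}" and n: "n \<in> carrier (N j)"
    and x: "x \<in> carrier (pow_algebra K p)"
  shows "diagonal_entry A N i (Y.row j n x) =
    (if j = i then (x i \<odot>\<^bsub>A\<^esub> \<one>\<^bsub>A\<^esub>) \<odot>\<^bsub>N i\<^esub> n else \<zero>\<^bsub>N i\<^esub>)"
proof (cases "j = i")
  case True
  let ?y = "base.e i \<otimes>\<^bsub>pow_algebra K p\<^esub> x \<otimes>\<^bsub>pow_algebra K p\<^esub> base.e i"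
  have "diagonal_entry A N i (Y.row i n x) = (?y i \<odot>\<^bsub>A\<^esub> \<one>\<^bsub>A\<^esub>) \<odot>\<^bsub>N i\<^esub> n"
    unfolding diagonal_entry_def Y.row_entry[OF i i] if_P[OF refl]
    by (rule tensor_factors.lift_pt[OF Y.entry_tensor_factors[OF i]
          N_ab[OF i] diagonal_balanced[OF i]])
      (use n True base.peirce_compress[OF x] in \<open>simp_all add: base_bimodule_simps\<close>)
  moreover have "?y i = x i"
    using i pow_algebra_entry_closed[OF x i] by (simp add: pow_algebra_entry base_e std_idem_def)
  ultimately show ?thesis using True by simp
next
  case False
  have "diagonal_entry A N i (Y.row j n x) = tensor_lift (N i)
      (\<lambda>(n, y). (y i \<odot>\<^bsub>A\<^esub> \<one>\<^bsub>A\<^esub>) \<odot>\<^bsub>N i\<^esub> n) \<zero>\<^bsub>Y.E i i\<^esub>"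
    using False unfolding diagonal_entry_def Y.row_entry[OF i i] by auto
  also have "\<dots> = \<zero>\<^bsub>N i\<^esub>"
    by (rule additive_hom_zero[OF Y.entry_abelian_group[OF i] N_ab[OF i]
        tensor_factors.lift_additive[OF Y.entry_tensor_factors[OF i]
          N_ab[OF i] diagonal_balanced[OF i], unfolded Y.entry_hom_eq]])
  finally show ?thesis using False by simp
qed

end

context contracted_lifting
begin

text \<open>The map from degree 0 to \<open>M i\<close> on which \<open>induced_eta\<close> is
  built. It is studied on elements before one passes to cosets and their chosen
  representatives.\<close>

definition "\<rho> i x = \<epsilon> i (diagonal_entry A (L 0) i (Red 0 x))"

context
  fixes i assumes i: "i \<in> {1..p}"
begin

interpretation Mi: algebra_left_module K A "M i"
  by (rule M.X.N_algebra_left_module[OF i])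

lemma M_ab: "abelian_group (M i)"
  by (rule left_module_abelian_group[OF M_module[OF i]])

lemma \<epsilon>_additive: "\<epsilon> i \<in> additive_hom (L 0 i) (M i)"
  by (rule left_module_hom_additive[OF \<epsilon>_hom[OF i]])

lemma \<rho>_additive: "\<rho> i \<in> additive_hom (F 0) (M i)"
  unfolding \<rho>_def[abs_def]
  by (rule additive_hom_comp[OF additive_hom_comp[OF L.red_additive L.diagonal_additive[OF i]] \<epsilon>_additive])

lemma \<rho>_closed: "x \<in> carrier (F 0) \<Longrightarrow> \<rho> i x \<in> carrier (M i)"
  by (rule additive_hom_closed[OF \<rho>_additive])

lemma \<rho>_row:
  assumes "j \<in> {1..p}" "n \<in> carrier (L 0 j)" "r \<in> carrier R"
  shows "\<rho> i (L.X.row 0 j n r) = (if j = i then (g r i \<odot>\<^bsub>A\<^esub> \<one>\<^bsub>A\<^esub>) \<odot>\<^bsub>M i\<^esub> \<epsilon> i n else \<zero>\<^bsub>M i\<^esub>)"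
  using left_module_hom_smult[OF \<epsilon>_hom[OF i] Mi.scalar_closed[OF g_entry(1)[OF i assms(3)]], of n]
    additive_hom_zero[OF L_ab[OF i] M_ab \<epsilon>_additive] assms
  by (auto simp: \<rho>_def L.red_row L.diagonal_row[OF i] g_closed)

lemma scalar_additive: "c \<in> carrier K \<Longrightarrow>
    (\<lambda>x. (c \<odot>\<^bsub>A\<^esub> \<one>\<^bsub>A\<^esub>) \<odot>\<^bsub>M i\<^esub> x) \<in> additive_hom (M i) (M i)"
  by (rule left_module_smult_additive[OF M_module[OF i] Mi.scalar_closed])

lemma scalar_scalar:
  "c \<in> carrier K \<Longrightarrow> c' \<in> carrier K \<Longrightarrow> y \<in> carrier (M i) \<Longrightarrow>
    (c \<odot>\<^bsub>A\<^esub> \<one>\<^bsub>A\<^esub>) \<odot>\<^bsub>M i\<^esub> ((c' \<odot>\<^bsub>A\<^esub> \<one>\<^bsub>A\<^esub>) \<odot>\<^bsub>M i\<^esub> y) = ((c \<otimes>\<^bsub>K\<^esub> c') \<odot>\<^bsub>A\<^esub> \<one>\<^bsub>A\<^esub>) \<odot>\<^bsub>M i\<^esub> y"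
  using Mi.scalar_mult Mi.N.left_assoc[OF Mi.scalar_closed Mi.scalar_closed] by simp

text \<open>Through the i-th coordinate of g, the ring acts on \<open>M i\<close> by scalars; this
  is exactly the exchange of ring elements required for tensoring with the i-th simple
  module.\<close>

lemma \<rho>_rsmult:
  assumes r: "r \<in> carrier R" and x: "x \<in> carrier (F 0)"
  shows "\<rho> i (rsmult (F 0) x r) = (g r i \<odot>\<^bsub>A\<^esub> \<one>\<^bsub>A\<^esub>) \<odot>\<^bsub>M i\<^esub> \<rho> i x"
proof (rule L.X.row_eqI[OF M_ab additive_hom_comp[OF L.X.rsmult_additive[OF r] \<rho>_additive]
        additive_hom_comp[OF \<rho>_additive scalar_additive[OF g_entry(1)[OF i r]]] _ x])
  fix j n s assume j: "j \<in> {1..p}" and n: "n \<in> carrier (L 0 j)" and s: "s \<in> carrier R"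
  show "\<rho> i (rsmult (F 0) (L.X.row 0 j n s) r)
      = (g r i \<odot>\<^bsub>A\<^esub> \<one>\<^bsub>A\<^esub>) \<odot>\<^bsub>M i\<^esub> \<rho> i (L.X.row 0 j n s)"
    using j n s r additive_hom_zero[OF M_ab M_ab scalar_additive[OF g_entry(1)[OF i r]]]
    by (auto simp: L.X.rsmult_row \<rho>_row g_entry[OF i] scalar_scalar \<epsilon>_closed S.R.m_comm)
qed

lemma \<rho>_smult:
  assumes a: "a \<in> carrier A" and x: "x \<in> carrier (F 0)"
  shows "\<rho> i (a \<odot>\<^bsub>F 0\<^esub> x) = a \<odot>\<^bsub>M i\<^esub> \<rho> i x"
proof (rule L.X.row_eqI[OF M_ab additive_hom_comp[OF L.X.MM_smult_additive[OF a] \<rho>_additive]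
        additive_hom_comp[OF \<rho>_additive left_module_smult_additive[OF M_module[OF i] a]] _ x])
  fix j n s assume j: "j \<in> {1..p}" and n: "n \<in> carrier (L 0 j)" and s: "s \<in> carrier R"
  have "a \<odot>\<^bsub>L 0 j\<^esub> n \<in> carrier (L 0 j)" by (rule left_module.left_closed[OF L_module[OF j] a n])
  then show "\<rho> i (a \<odot>\<^bsub>F 0\<^esub> L.X.row 0 j n s) = a \<odot>\<^bsub>M i\<^esub> \<rho> i (L.X.row 0 j n s)"
    using j n s a additive_hom_zero[OF M_ab M_ab left_module_smult_additive[OF M_module[OF i] a]]
      left_module_hom_smult[OF \<epsilon>_hom[OF i] a, of n] Mi.base_commute[OF a g_entry(1)[OF i s] \<epsilon>_closed[OF i, of n]]
    by (auto simp: L.X.smult_row \<rho>_row)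
qed

text \<open>Since \<rho> sees only the reduction, \<open>D\<close> may be replaced by the constant
  differential, and the augmentation kills the image of d.\<close>

lemma \<rho>_D:
  assumes z: "z \<in> carrier (F (Suc 0))"
  shows "\<rho> i (D 0 z) = \<zero>\<^bsub>M i\<^esub>"
proof -
  have \<epsilon>d: "\<epsilon> i (d 0 i n) = \<zero>\<^bsub>M i\<^esub>" if "n \<in> carrier (L (Suc 0) i)" for n
  proof -
    have "a_kernel (L 0 i) (M i) (\<epsilon> i) = d 0 i ` carrier (L 1 i)"
      using resolution[OF i] by (simp add: free_resolution_def)
    then show ?thesis using that by (auto simp: a_kernel_def')
  qed
  have "\<rho> i (D 0 z) = \<rho> i (dR 0 z)" unfolding \<rho>_def Red_D[OF z] ..
  also have "\<dots> = \<zero>\<^bsub>M i\<^esub>"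
  proof (rule L.X.row_eqI[OF M_ab additive_hom_comp[OF dR_additive \<rho>_additive] zero_additive[OF M_ab] _ z])
    fix j n r assume j: "j \<in> {1..p}" and n: "n \<in> carrier (L (Suc 0) j)" and r: "r \<in> carrier R"
    show "\<rho> i (dR 0 (L.X.row (Suc 0) j n r)) = \<zero>\<^bsub>M i\<^esub>"
      using additive_hom_zero[OF M_ab M_ab scalar_additive[OF g_entry(1)[OF i r]]] \<epsilon>d n j r
      by (auto simp: dR_row \<rho>_row d_closed)
  qed
  finally show ?thesis .
qed

text \<open>The representative picked by the choice operator differs from x by a boundary, which
  \<rho> annihilates; so the choice inside \<open>induced_eta\<close> is harmless.\<close>

lemma \<rho>_some:
  assumes x: "x \<in> carrier (F 0)"
  shows "\<rho> i (SOME y. y \<in> H.q x) = \<rho> i x"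
proof -
  have "(SOME y. y \<in> H.q x) \<in> H.q x" by (rule someI[of _ x]) (rule H.q_self[OF x])
  then obtain u where u: "u \<in> B0" "(SOME y. y \<in> H.q x) = u \<oplus>\<^bsub>F 0\<^esub> x" by (rule H.q_mem[OF x])
  then obtain z where z: "z \<in> carrier (F (Suc 0))" "u = D 0 z" by blast
  show ?thesis
    unfolding u(2) z(2) additive_hom_add[OF \<rho>_additive D_closed[OF z(1)] x] \<rho>_D[OF z(1)]
    by (rule abelian_groupE(5)[OF M_ab \<rho>_closed[OF x]])
qed

abbreviation "ki \<equiv> simple_module K g i"
abbreviation "\<eta> \<equiv> induced_eta K A p g (L 0) \<epsilon> M i"

lemma \<eta>_eq: "\<eta> = tensor_lift (M i) (\<lambda>(W, c). (c \<odot>\<^bsub>A\<^esub> \<one>\<^bsub>A\<^esub>) \<odot>\<^bsub>M i\<^esub> \<rho> i (SOME y. y \<in> W))"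
  by (simp add: induced_eta_def \<rho>_def)

lemma tensor_H0_factors: "tensor_bimodule_factors R H0 ki A"
  unfolding tensor_bimodule_factors_def tensor_bimodule_factors_axioms_def tensor_factors_def
  using H.Q_is_bimodule[OF A.assoc_algebra_axioms S.assoc_algebra_axioms] simple_left_module[OF i]
  by (simp add: is_bimodule_def)

interpretation T: tensor_bimodule_factors R H0 ki A by (rule tensor_H0_factors)

lemma \<eta>_balanced:
  "balanced_map R H0 ki (M i) (\<lambda>W c. (c \<odot>\<^bsub>A\<^esub> \<one>\<^bsub>A\<^esub>) \<odot>\<^bsub>M i\<^esub> \<rho> i (SOME y. y \<in> W))"
proof (rule balanced_mapI)
  fix W c assume "W \<in> carrier H0" and "c \<in> carrier ki"
  then have c: "c \<in> carrier K" by (simp add: simple_module_simps)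
  obtain x where x: "x \<in> carrier (F 0)" "W = H.q x" using \<open>W \<in> carrier H0\<close> by (rule H.Q_cases)
  show "(c \<odot>\<^bsub>A\<^esub> \<one>\<^bsub>A\<^esub>) \<odot>\<^bsub>M i\<^esub> \<rho> i (SOME y. y \<in> W) \<in> carrier (M i)"
    unfolding x(2) \<rho>_some[OF x(1)] by (rule additive_hom_closed[OF scalar_additive[OF c] \<rho>_closed[OF x(1)]])
  show "(c \<odot>\<^bsub>A\<^esub> \<one>\<^bsub>A\<^esub>) \<odot>\<^bsub>M i\<^esub> \<rho> i (SOME y. y \<in> rsmult H0 W r)
      = ((r \<odot>\<^bsub>ki\<^esub> c) \<odot>\<^bsub>A\<^esub> \<one>\<^bsub>A\<^esub>) \<odot>\<^bsub>M i\<^esub> \<rho> i (SOME y. y \<in> W)" if r: "r \<in> carrier R" for r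
    unfolding x(2) H.q_rsmult[OF r x(1)] \<rho>_some[OF x(1)] \<rho>_some[OF L.X.rsmult_closed[OF x(1) r]]
      \<rho>_rsmult[OF r x(1)] scalar_scalar[OF c g_entry(1)[OF i r] \<rho>_closed[OF x(1)]] simple_module_simps
      S.R.m_comm[OF c g_entry(1)[OF i r]] ..
  show "((c \<oplus>\<^bsub>ki\<^esub> c') \<odot>\<^bsub>A\<^esub> \<one>\<^bsub>A\<^esub>) \<odot>\<^bsub>M i\<^esub> \<rho> i (SOME y. y \<in> W)
      = (c \<odot>\<^bsub>A\<^esub> \<one>\<^bsub>A\<^esub>) \<odot>\<^bsub>M i\<^esub> \<rho> i (SOME y. y \<in> W) \<oplus>\<^bsub>M i\<^esub> (c' \<odot>\<^bsub>A\<^esub> \<one>\<^bsub>A\<^esub>) \<odot>\<^bsub>M i\<^esub> \<rho> i (SOME y. y \<in> W)"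
    if "c' \<in> carrier ki" for c'
    using that c x \<rho>_some[OF x(1)] \<rho>_closed[OF x(1)]
    by (simp add: simple_module_simps A.smult_l_distr Mi.N.left_add_scalar)
  fix W' assume "W' \<in> carrier H0"
  then obtain x' where x': "x' \<in> carrier (F 0)" "W' = H.q x'" by (rule H.Q_cases)
  show "(c \<odot>\<^bsub>A\<^esub> \<one>\<^bsub>A\<^esub>) \<odot>\<^bsub>M i\<^esub> \<rho> i (SOME y. y \<in> W \<oplus>\<^bsub>H0\<^esub> W')
      = (c \<odot>\<^bsub>A\<^esub> \<one>\<^bsub>A\<^esub>) \<odot>\<^bsub>M i\<^esub> \<rho> i (SOME y. y \<in> W) \<oplus>\<^bsub>M i\<^esub> (c \<odot>\<^bsub>A\<^esub> \<one>\<^bsub>A\<^esub>) \<odot>\<^bsub>M i\<^esub> \<rho> i (SOME y. y \<in> W')"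
    unfolding x(2) x'(2) H.q_add[OF x(1) x'(1), symmetric] \<rho>_some[OF x(1)] \<rho>_some[OF x'(1)]
      \<rho>_some[OF L.X.MM.a_closed[OF x(1) x'(1)]] additive_hom_add[OF \<rho>_additive x(1) x'(1)]
    by (rule additive_hom_add[OF scalar_additive[OF c] \<rho>_closed[OF x(1)] \<rho>_closed[OF x'(1)]])
qed

lemma \<eta>_additive: "\<eta> \<in> additive_hom T.T (M i)"
  unfolding \<eta>_eq by (rule T.lift_additive[OF M_ab \<eta>_balanced])

lemma \<eta>_pt:
  assumes x: "x \<in> carrier (F 0)" and c: "c \<in> carrier K"
  shows "\<eta> (T.pt (H.q x) c) = (c \<odot>\<^bsub>A\<^esub> \<one>\<^bsub>A\<^esub>) \<odot>\<^bsub>M i\<^esub> \<rho> i x"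
  using T.lift_pt[OF M_ab \<eta>_balanced H.q_closed[OF x], of c] c
  unfolding \<eta>_eq \<rho>_some[OF x] by (simp add: simple_module_simps)

lemma \<eta>_left_hom: "\<eta> \<in> left_module_hom A (tensor R H0 ki) (M i)"
proof (rule left_module_homI)
  show "\<eta> \<in> additive_hom (tensor R H0 ki) (M i)"
    using \<eta>_additive additive_hom_cong[OF tensor_simps(1) tensor_simps(3) refl refl] by blast
  fix a w assume a: "a \<in> carrier A" and "w \<in> carrier (tensor R H0 ki)"
  then have w: "w \<in> carrier T.T" by (simp add: tensor_simps)
  show "\<eta> (a \<odot>\<^bsub>tensor R H0 ki\<^esub> w) = a \<odot>\<^bsub>M i\<^esub> \<eta> w"
  proof (rule T.additive_hom_eqI[OF M_ab additive_hom_comp[OF T.tensor_smult_additive[OF a] \<eta>_additive]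
          additive_hom_comp[OF \<eta>_additive left_module_smult_additive[OF M_module[OF i] a]] _ w])
    fix W c assume W: "W \<in> carrier H0" and "c \<in> carrier ki"
    then have c: "c \<in> carrier K" by (simp add: simple_module_simps)
    obtain x where x: "x \<in> carrier (F 0)" "W = H.q x" using W by (rule H.Q_cases)
    show "\<eta> (a \<odot>\<^bsub>tensor R H0 ki\<^esub> T.pt W c) = a \<odot>\<^bsub>M i\<^esub> \<eta> (T.pt W c)"
      unfolding T.tensor_smult_pt[OF a W \<open>c \<in> carrier ki\<close>]
      unfolding x(2) H.q_smult[OF a x(1)] \<eta>_pt[OF x(1) c]
        \<eta>_pt[OF left_module.left_closed[OF L.X.MM_left_module a x(1)] c] \<rho>_smult[OF a x(1)]
      by (rule Mi.base_commute[OF a c \<rho>_closed[OF x(1)], symmetric])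
  qed
qed

text \<open>The row of l with second component 1 has the single nonzero entry l tensor e_i, at (i,
  i). As \<open>gen\<close> is additive on \<open>L 0 i\<close>, its image is a subgroup, and no
  sums of such tensors have to be carried along.\<close>

definition "gen l = T.pt (H.q (L.X.row 0 i l \<one>\<^bsub>R\<^esub>)) \<one>\<^bsub>K\<^esub>"

lemma one_ki: "\<one>\<^bsub>K\<^esub> \<in> carrier ki"
  by (simp add: simple_module_simps)

lemma gen_additive: "gen \<in> additive_hom (L 0 i) T.T"
proof -
  have "(\<lambda>W. T.pt W \<one>\<^bsub>K\<^esub>) \<in> additive_hom H0 T.T"
    using T.pt_balanced one_ki by (simp add: balanced_map_def)
  then show ?thesis
    unfolding gen_def[abs_def]
    by (rule additive_hom_comp[OF additive_hom_comp[OF L.X.row_additive_left[OF i S.one_closed] H.q_additive]])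
qed

lemma \<eta>_gen: "l \<in> carrier (L 0 i) \<Longrightarrow> \<eta> (gen l) = \<epsilon> i l"
  unfolding gen_def using i
  by (simp add: \<eta>_pt L.X.row_closed \<rho>_row g_entry[OF i] Mi.N.left_one \<epsilon>_closed)

lemma pt_rsmult:
  assumes "x \<in> carrier (F 0)" "r \<in> carrier R" "c \<in> carrier K"
  shows "T.pt (H.q (rsmult (F 0) x r)) c = T.pt (H.q x) (g r i \<otimes>\<^bsub>K\<^esub> c)"
  using T.pt_smult[OF H.q_closed[OF assms(1)] assms(2), of c] assms
  by (simp add: H.q_rsmult simple_module_simps)

lemma pt_zero_right: "W \<in> carrier H0 \<Longrightarrow> T.pt W \<zero>\<^bsub>K\<^esub> = \<zero>\<^bsub>T.T\<^esub>"
  using additive_hom_zero[OF left_module_abelian_group[OF simple_left_module[OF i]] T.tensor_abelian_group,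
      of "T.pt W"] T.pt_balanced by (simp add: balanced_map_def simple_module_simps)

lemma pt_q_additive: "c \<in> carrier K \<Longrightarrow> (\<lambda>x. T.pt (H.q x) c) \<in> additive_hom (F 0) T.T"
  using T.pt_balanced
  by (intro additive_hom_comp[OF H.q_additive, of "\<lambda>W. T.pt W c"]) (simp add: balanced_map_def simple_module_simps)

text \<open>The row j of n with component 1 is fixed by right multiplication with e_j. For j
  different from i this idempotent acts as zero on the simple module and the tensor vanishes; for j
  = i the ring component acts by a scalar, which is absorbed into n.\<close>

lemma pt_q_gen:
  assumes x: "x \<in> carrier (F 0)" and c: "c \<in> carrier K"
  shows "T.pt (H.q x) c \<in> gen ` carrier (L 0 i)"
  using x
proof (induction rule: L.X.MM_induct)
  case zero
  show ?case
    unfolding additive_hom_zero[OF L.X.MM_abelian_group T.tensor_abelian_group pt_q_additive[OF c]]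
    by (rule additive_hom_image_zero[OF L_ab[OF i] T.tensor_abelian_group gen_additive])
next
  case (add x y)
  then show ?case
    unfolding additive_hom_add[OF pt_q_additive[OF c] add(1,2)]
    by (intro additive_hom_image_add[OF L_ab[OF i] gen_additive])
next
  case (row j n r)
  define w where "w = L.X.row 0 j n \<one>\<^bsub>R\<^esub>"
  have w: "w \<in> carrier (F 0)" unfolding w_def using row by (intro L.X.row_closed) auto
  define c' where "c' = g r i \<otimes>\<^bsub>K\<^esub> c"
  have c': "c' \<in> carrier K" using g_entry(1)[OF i row(3)] c by (simp add: c'_def)
  have we: "rsmult (F 0) w (e j) = w"
    using row L.X.row_e[OF row(1) S.one_closed, of 0 n] by (simp add: w_def L.X.rsmult_row)
  have "L.X.row 0 j n r = rsmult (F 0) w r" using row by (simp add: w_def L.X.rsmult_row)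
  then have eq: "T.pt (H.q (L.X.row 0 j n r)) c = T.pt (H.q w) c'"
    using pt_rsmult[OF w row(3) c] by (simp add: c'_def)
  show ?case
  proof (cases "j = i")
    case True
    \<comment> \<open>The scalar returns across the tensor sign as a multiple of the unit of
      \<open>R\<close>, whose i-th coordinate under g is c', and from there it moves to the
      coefficient n.\<close>
    have "T.pt (H.q w) c' = T.pt (H.q (rsmult (F 0) w (c' \<odot>\<^bsub>R\<^esub> \<one>\<^bsub>R\<^esub>))) \<one>\<^bsub>K\<^esub>"
      using c' by (simp add: pt_rsmult[OF w] g_entry[OF i])
    also have "rsmult (F 0) w (c' \<odot>\<^bsub>R\<^esub> \<one>\<^bsub>R\<^esub>) = L.X.row 0 i ((c' \<odot>\<^bsub>A\<^esub> \<one>\<^bsub>A\<^esub>) \<odot>\<^bsub>L 0 i\<^esub> n) \<one>\<^bsub>R\<^esub>"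
      using row c' True by (simp add: w_def L.X.rsmult_row L.X.row_scalar)
    finally have "T.pt (H.q w) c' = gen ((c' \<odot>\<^bsub>A\<^esub> \<one>\<^bsub>A\<^esub>) \<odot>\<^bsub>L 0 i\<^esub> n)" by (simp add: gen_def)
    then show ?thesis
      using eq left_module.left_closed[OF L_module[OF i] Mi.scalar_closed[OF c'], of n 0] row(2) True by auto
  next
    case False
    have "T.pt (H.q w) c' = T.pt (H.q w) (g (e j) i \<otimes>\<^bsub>K\<^esub> c')"
      using pt_rsmult[OF w e_closed c', of j] we by simp
    also have "\<dots> = \<zero>\<^bsub>T.T\<^esub>" using False c' pt_zero_right[OF H.q_closed[OF w]] by (simp add: g_entry[OF i])
    finally show ?thesis
      unfolding eq using additive_hom_image_zero[OF L_ab[OF i] T.tensor_abelian_group gen_additive] by simp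
  qed
qed

lemma gen_surj:
  assumes "w \<in> carrier T.T"
  shows "w \<in> gen ` carrier (L 0 i)"
  using assms
proof (induction rule: T.tensor_induct)
  case zero
  show ?case by (rule additive_hom_image_zero[OF L_ab[OF i] T.tensor_abelian_group gen_additive])
next
  case (add v w)
  then show ?case by (intro additive_hom_image_add[OF L_ab[OF i] gen_additive])
next
  case (pure W c)
  obtain x where x: "x \<in> carrier (F 0)" "W = H.q x" using pure(1) by (rule H.Q_cases)
  show ?case unfolding x(2) by (rule pt_q_gen[OF x(1)]) (use pure(2) in \<open>simp add: simple_module_simps\<close>)
qed

text \<open>Radical elements act as zero on the simple module, so tensoring with it kills the
  product of the module with the radical.\<close>

lemma pt_mod_ideal:
  assumes "y \<in> mod_ideal R (F 0) rad"
  shows "T.pt (H.q y) \<one>\<^bsub>K\<^esub> = \<zero>\<^bsub>T.T\<^esub>"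
  using assms
proof induction
  case zero
  show ?case
    by (rule additive_hom_zero[OF L.X.MM_abelian_group T.tensor_abelian_group pt_q_additive[OF S.R.one_closed]])
next
  case (add x y)
  show ?case
    unfolding additive_hom_add[OF pt_q_additive[OF S.R.one_closed] mod_ideal_closed[OF L.X.MM_right_module add(1)]
        mod_ideal_closed[OF L.X.MM_right_module add(2)]] add(3,4)
    by (rule T.T.l_zero[OF T.T.zero_closed])
next
  case (incl y r)
  have "g r i = \<zero>\<^bsub>K\<^esub>" using incl(2) i by (simp add: rad_iff pow_algebra_entry)
  then show ?case
    unfolding pt_rsmult[OF incl(1,3) S.R.one_closed] using pt_zero_right[OF H.q_closed[OF incl(1)]] by simp
qed

text \<open>Exactness gives l = d k, so the row of l is \<open>dR\<close> of the row of k. Replacing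
  \<open>dR\<close> by \<open>D\<close> costs an element of zero reduction, which dies in the tensor
  product, while the value of \<open>D\<close> already dies in cohomology.\<close>

lemma gen_kernel:
  assumes l: "l \<in> carrier (L 0 i)" and \<epsilon>l: "\<epsilon> i l = \<zero>\<^bsub>M i\<^esub>"
  shows "gen l = \<zero>\<^bsub>T.T\<^esub>"
proof -
  have "a_kernel (L 0 i) (M i) (\<epsilon> i) = d 0 i ` carrier (L 1 i)"
    using resolution[OF i] by (simp add: free_resolution_def)
  then obtain k where k: "k \<in> carrier (L (Suc 0) i)" "l = d 0 i k"
    using l \<epsilon>l by (auto simp: a_kernel_def')
  define x where "x = L.X.row 0 i l \<one>\<^bsub>R\<^esub>"
  define z where "z = L.X.row (Suc 0) i k \<one>\<^bsub>R\<^esub>"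
  have x: "x \<in> carrier (F 0)" unfolding x_def by (rule L.X.row_closed[OF i l S.one_closed])
  have z: "z \<in> carrier (F (Suc 0))" unfolding z_def by (rule L.X.row_closed[OF i k(1) S.one_closed])
  have xz: "x = dR 0 z" unfolding x_def z_def k(2) by (rule dR_row[OF i k(1) S.one_closed, symmetric])
  have y: "x \<ominus>\<^bsub>F 0\<^esub> D 0 z \<in> carrier (F 0)" by (rule L.X.MM.minus_closed[OF x D_closed[OF z]])
  have "Red 0 (x \<ominus>\<^bsub>F 0\<^esub> D 0 z) = Red 0 x \<ominus>\<^bsub>Fk 0\<^esub> Red 0 x"
    using additive_hom_minus[OF L.X.MM_abelian_group L.Y.MM_abelian_group L.red_additive x D_closed[OF z]]
      Red_D[OF z] xz by simp
  also have "\<dots> = \<zero>\<^bsub>Fk 0\<^esub>"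
    unfolding a_minus_def by (rule L.Y.MM.r_neg[OF additive_hom_closed[OF L.red_additive x]])
  finally have "T.pt (H.q (x \<ominus>\<^bsub>F 0\<^esub> D 0 z)) \<one>\<^bsub>K\<^esub> = \<zero>\<^bsub>T.T\<^esub>"
    by (intro pt_mod_ideal L.red_zero_mod_ideal[OF y])
  moreover have "H.q (x \<ominus>\<^bsub>F 0\<^esub> D 0 z) = H.q x"
  proof -
    have "H.q x = H.q (D 0 z \<oplus>\<^bsub>F 0\<^esub> (x \<ominus>\<^bsub>F 0\<^esub> D 0 z))"
      by (simp only: L.X.MM.add_minus_cancel D_closed[OF z] x)
    also have "\<dots> = H.q (x \<ominus>\<^bsub>F 0\<^esub> D 0 z)"
      unfolding H.q_add[OF D_closed[OF z] y] q_D[OF z] by (rule abelian_groupE(5)[OF H.Q_abelian_group H.q_closed[OF y]])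
    finally show ?thesis by simp
  qed
  ultimately show ?thesis by (simp add: gen_def x_def)
qed

text \<open>Because \<open>gen\<close> is onto, the difference of two elements with the same image
  is \<open>gen l\<close> for some l, and its image \<epsilon> l is zero; \<open>gen_kernel\<close>
  finishes injectivity. Surjectivity is that of \<epsilon>, carried over by
  \<open>\<eta>_gen\<close>.\<close>

lemma \<eta>_iso: "\<eta> \<in> left_module_iso A (tensor R H0 ki) (M i)"
proof -
  have "bij_betw \<eta> (carrier T.T) (carrier (M i))"
    unfolding bij_betw_def
  proof (intro conjI inj_onI)
    fix v w assume v: "v \<in> carrier T.T" and w: "w \<in> carrier T.T" and eq: "\<eta> v = \<eta> w"
    have vw: "v \<ominus>\<^bsub>T.T\<^esub> w \<in> carrier T.T" by (rule T.T.minus_closed[OF v w])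
    then obtain l where l: "l \<in> carrier (L 0 i)" "v \<ominus>\<^bsub>T.T\<^esub> w = gen l" using gen_surj by blast
    have "\<epsilon> i l = \<eta> v \<ominus>\<^bsub>M i\<^esub> \<eta> v"
      using \<eta>_gen[OF l(1)] l(2) additive_hom_minus[OF T.tensor_abelian_group M_ab \<eta>_additive v w] eq by simp
    also have "\<dots> = \<zero>\<^bsub>M i\<^esub>"
      unfolding a_minus_def by (rule abelian_group.r_neg[OF M_ab additive_hom_closed[OF \<eta>_additive v]])
    finally have "v \<ominus>\<^bsub>T.T\<^esub> w = \<zero>\<^bsub>T.T\<^esub>" using gen_kernel[OF l(1)] l(2) by simp
    then show "v = w"
      using T.T.minus_minus_cancel[OF w T.T.zero_closed v] v w by (simp add: a_minus_def)
  next
    show "\<eta> ` carrier T.T = carrier (M i)"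
    proof
      show "\<eta> ` carrier T.T \<subseteq> carrier (M i)" using additive_hom_closed[OF \<eta>_additive] by blast
      show "carrier (M i) \<subseteq> \<eta> ` carrier T.T"
      proof
        fix y assume y: "y \<in> carrier (M i)"
        have "\<epsilon> i ` carrier (L 0 i) = carrier (M i)"
          using resolution[OF i] by (simp add: free_resolution_def)
        then obtain l where "l \<in> carrier (L 0 i)" "y = \<epsilon> i l" using y by blast
        then show "y \<in> \<eta> ` carrier T.T"
          using \<eta>_gen additive_hom_closed[OF gen_additive] by (metis imageI)
      qed
    qed
  qed
  then show ?thesis using \<eta>_left_hom by (simp add: left_module_iso_def tensor_simps)
qed

end

lemma H0_family_lifting: "family_lifting K A p R f g M H0 (induced_eta K A p g (L 0) \<epsilon> M)"
  unfolding family_lifting_def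
  using H.Q_is_bimodule[OF A.assoc_algebra_axioms S.assoc_algebra_axioms] \<eta>_iso H0_right_iso by blast

end

theorem lemma3p2:
  fixes K :: "'k ring"
    and A :: "('k, 'a) module"
    and p :: nat
    and M :: "nat \<Rightarrow> ('a, 'm) module"
    and L :: "nat \<Rightarrow> nat \<Rightarrow> ('a, 'l) module"
    and d :: "nat \<Rightarrow> nat \<Rightarrow> 'l \<Rightarrow> 'l"
    and \<epsilon> :: "nat \<Rightarrow> 'l \<Rightarrow> 'm"
    and R :: "('k, 'r) module"
    and f :: "(nat \<Rightarrow> 'k) \<Rightarrow> 'r"
    and g :: "'r \<Rightarrow> (nat \<Rightarrow> 'k)"
    and D :: "nat \<Rightarrow> (nat \<times> nat \<Rightarrow> ('l \<times> 'r \<Rightarrow>\<^sub>0 int) set) \<Rightarrow> (nat \<times> nat \<Rightarrow> ('l \<times> 'r \<Rightarrow>\<^sub>0 int) set)"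
  assumes "algebraically_closed K"
    and "assoc_algebra K A"
    and "\<forall>i \<in> {1..p}. left_module A (M i)"
    and "\<forall>i \<in> {1..p}. free_resolution A (\<lambda>m. L m i) (\<lambda>m. d m i) (\<epsilon> i) (M i)"
    and "ap_object K p R f g"
    and "complex_lifting K A p R f g L d D"
  shows "(\<forall>m \<ge> 1. carrier (cohomology (\<lambda>m. mat_module K A p R f (L m)) D m) =
           {\<zero>\<^bsub>cohomology (\<lambda>m. mat_module K A p R f (L m)) D m\<^esub>}) \<and>
         family_lifting K A p R f g M
           (cohomology (\<lambda>m. mat_module K A p R f (L m)) D 0)
           (induced_eta K A p g (L 0) \<epsilon> M)"
proof -
  have K: "field K" using assms(1) by (simp add: algebraically_closed_def)
  have "\<forall>i \<in> {1..p}. \<exists>t s. contraction K A (M i) (\<lambda>m. L m i) (\<lambda>m. d m i) (\<epsilon> i) t s"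
    using resolution_contraction[OF K assms(2)] assms(3,4) by blast
  \<comment> \<open>Contractions exist separately for each i; two bounded choices turn them into
    families over {1..p}.\<close>
  from bchoice[OF this] obtain t where
    "\<forall>i \<in> {1..p}. \<exists>s. contraction K A (M i) (\<lambda>m. L m i) (\<lambda>m. d m i) (\<epsilon> i) (t i) s" ..
  from bchoice[OF this] obtain s where
    ts: "\<forall>i \<in> {1..p}. contraction K A (M i) (\<lambda>m. L m i) (\<lambda>m. d m i) (\<epsilon> i) (t i) (s i)" ..
  \<comment> \<open>The choice yields s with the index of the module first, whereas the locale
    expects the degree first; hence the swapped arguments.\<close>
  interpret C: contracted_lifting K A p R f g M L d \<epsilon> D t "\<lambda>m i. s i m"
  proof (rule contracted_lifting.intro[OF ap_object_augmented_algebra[OF assms(5)] assms(2)],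
      rule contracted_lifting_axioms.intro)
    show "\<exists>n. ideal_power R (a_kernel R (pow_algebra K p) g) n = {\<zero>\<^bsub>R\<^esub>}"
      using assms(5) by (simp add: ap_object_def)
  qed (use assms(3,4,6) ts in auto)
  show ?thesis
  proof (intro conjI allI impI)
    fix m :: nat assume "1 \<le> m"
    then obtain k where "m = Suc k" by (cases m) auto
    then show "carrier (cohomology (\<lambda>m. mat_module K A p R f (L m)) D m) =
           {\<zero>\<^bsub>cohomology (\<lambda>m. mat_module K A p R f (L m)) D m\<^esub>}"
      using C.higher_cohomology by simp
  next
    show "family_lifting K A p R f g M
           (cohomology (\<lambda>m. mat_module K A p R f (L m)) D 0)
           (induced_eta K A p g (L 0) \<epsilon> M)"
      using C.H0_family_lifting by simp
  qed
qed

end
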